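(* Let $k\geq 2$ be an integer and, for $n\geq 0$, let $R_k(n)$ denote the number of relaxed $k$-ary trees with $n$ internal nodes. Then, as $n\to\infty$, \[ R_k(n)=\Theta\!\left( (n!)^{k-1} \left(\frac{k^k}{(k-1)^{k-1}}\right)^{n} e^{3 \left(\frac{k(k-1)}{2}\right)^{1/3} a_1 n^{1/3}}\, n^{\frac{2k-1}{3}} \right), \] i.e., there are constants $0<c_1\le c_2$ such that $c_1 E_n\le R_k(n)\le c_2 E_n$ for all sufficiently large $n$, where $E_n$ is the expression inside $\Theta$. Here $a_1\approx -2.338$ is the largest root of the Airy function $\mathrm{Ai}(x)$, the unique function satisfying $\mathrm{Ai}''(x)=x\,\mathrm{Ai}(x)$ and $\lim_{x\to\infty}\mathrm{Ai}(x)=0$.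
   Context: An ordered DAG is a finite directed acyclic graph in which the outgoing edges (children) of each node carry a left-to-right order; multiple edges between the same pair of nodes are allowed. A relaxed $k$-ary tree is an ordered DAG with a unique source and a unique sink in which every node other than the sink has out-degree exactly $k$. Relaxed $k$-ary trees are counted up to isomorphism of ordered DAGs. All nodes except the sink are called internal nodes. *)

theory Defs
  imports "HOL-Analysis.Analysis" "HOL-Library.Landau_Symbols"
begin

text \<open>
  The list \<open>children G v\<close> holds the heads of the edges leaving \<open>v\<close>, from left to right; repeated
  entries are multiple edges. Values of \<open>children G\<close> outside \<open>nodes G\<close> carry no meaning:
  isomorphism ignores them.
\<close>

record 'a ordered_digraph =
  nodes :: "'a set"
  children :: "'a \<Rightarrow> 'a list"

definition edge_rel :: "'a ordered_digraph \<Rightarrow> ('a \<times> 'a) set" where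
  "edge_rel G = {(u, v). u \<in> nodes G \<and> v \<in> set (children G u)}"

definition ordered_dag :: "'a ordered_digraph \<Rightarrow> bool" where
  "ordered_dag G \<longleftrightarrow> finite (nodes G) \<and> edge_rel G \<subseteq> nodes G \<times> nodes G \<and> acyclic (edge_rel G)"

definition outdegree :: "'a ordered_digraph \<Rightarrow> 'a \<Rightarrow> nat" where
  "outdegree G v = length (children G v)"

definition sources :: "'a ordered_digraph \<Rightarrow> 'a set" where
  "sources G = {v \<in> nodes G. \<forall>u. (u, v) \<notin> edge_rel G}"

definition sinks :: "'a ordered_digraph \<Rightarrow> 'a set" where
  "sinks G = {v \<in> nodes G. \<forall>u. (v, u) \<notin> edge_rel G}"

definition internal_nodes :: "'a ordered_digraph \<Rightarrow> 'a set" where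
  "internal_nodes G = nodes G - sinks G"

definition relaxed_tree :: "nat \<Rightarrow> 'a ordered_digraph \<Rightarrow> bool" where
  "relaxed_tree k G \<longleftrightarrow>
     ordered_dag G \<and> (\<exists>!s. s \<in> sources G) \<and> (\<exists>!t. t \<in> sinks G) \<and>
     (\<forall>v \<in> internal_nodes G. outdegree G v = k)"

definition ordered_iso :: "'a ordered_digraph \<Rightarrow> 'b ordered_digraph \<Rightarrow> bool" where
  "ordered_iso G H \<longleftrightarrow>
     (\<exists>h. bij_betw h (nodes G) (nodes H) \<and>
          (\<forall>v \<in> nodes G. children H (h v) = map h (children G v)))"

text \<open>
  Every finite ordered digraph is isomorphic to one whose nodes are natural numbers, so
  isomorphism classes may be counted among the latter.
\<close>

definition relaxed_trees :: "nat \<Rightarrow> nat \<Rightarrow> nat ordered_digraph set" where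
  "relaxed_trees k n = {G. relaxed_tree k G \<and> card (internal_nodes G) = n}"

definition num_relaxed_trees :: "nat \<Rightarrow> nat \<Rightarrow> nat" where
  "num_relaxed_trees k n =
     card (relaxed_trees k n //
       {(G, H). G \<in> relaxed_trees k n \<and> H \<in> relaxed_trees k n \<and> ordered_iso G H})"

text \<open>
  The differential equation and the decay at infinity determine the Airy function only up to a
  constant factor; the usual value at 0 fixes the factor (and excludes the zero function).
\<close>

definition airy_Ai :: "real \<Rightarrow> real" where
  "airy_Ai = (THE f.
     (\<exists>f'. \<forall>x. (f has_real_derivative f' x) (at x) \<and>
                (f' has_real_derivative x * f x) (at x)) \<and>
     (f \<longlongrightarrow> 0) at_top \<and>
     f 0 = 1 / (3 powr (2 / 3) * Gamma (2 / 3)))"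

definition airy_a1 :: real where
  "airy_a1 = (GREATEST x. airy_Ai x = 0)"

end

theory Submission
  imports Defs "HOL-Real_Asymp.Real_Asymp"
begin

text \<open>
  Reading the internal nodes of a relaxed tree in the postorder of its depth-first spanning tree
  turns it into a word of pointer steps and node steps acting on a stack; a pointer made when \<open>y\<close>
  internal nodes are finished has \<open>y + 1\<close> possible targets. If the stack has \<open>m + 1\<close> entries,
  the number \<open>r y m\<close> of such words satisfies
  \<open>r y m = (y + 1) * r y (m - 1) + r (y - 1) (m + k - 1)\<close>.
  After normalisation this is a centred random walk with steps \<open>-1\<close> and \<open>k - 1\<close> run backwards,
  absorbed below \<open>0\<close> and killed at rate \<open>m / N\<close> at time \<open>N = k * y + m\<close>. On the scale
  \<open>m ~ N\<^bsup>1/3\<^esup>\<close> the killing balances the diffusion and the generator becomes the Airy operator,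
  whose ground state on the half line is \<open>Ai (a\<^sub>1 + z)\<close> with a multiple of \<open>a\<^sub>1\<close> as its
  eigenvalue. Multiplying \<open>Ai\<close> by a factor \<open>1 + o(1)\<close> that removes all errors of relative order
  \<open>1 / N\<close>, and perturbing the eigenvalue by \<open>N\<^bsup>-13/12\<^esup>\<close>, which is summable, gives a super- and a
  subsolution of the recurrence. They agree up to constant factors, and the comparison principle
  transfers their growth to \<open>r\<close>.
\<close>

section \<open>Postorder codes of relaxed trees\<close>

text \<open>Two obstacles shape the barriers. At the wall \<open>Ai\<close> vanishes, so a margin
  proportional to \<open>Ai\<close> cannot pay for error terms containing \<open>Ai'\<close>; since
  the zero is simple, \<open>Ai'\<close> is positive there, and tilting the profile by a small term
  linear in the height gives the coefficient of \<open>Ai'\<close> a definite sign. Far out, errors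
  relative to \<open>Ai\<close> grow polynomially in the scaled height; there the profile is already
  smaller than any power of the time, and a small term constant in the height, strongly damped by
  the killing, takes over. Everything is measured in \<open>t = n powr (- 1 / 12)\<close>: the scale
  is of order \<open>t ^ 4\<close>, the eigenvalue \<open>t ^ 8\<close>, \<open>1 / n\<close> is
  \<open>t ^ 12\<close>, the summable perturbation \<open>t ^ 13\<close>, the tilt acts at
  \<open>t ^ 15\<close>, and the discarded errors are \<open>t ^ 16\<close>. The power of
  \<open>n\<close> in the theorem has three sources: (7k - 6)/6 from the order \<open>1 / n\<close>
  of the eigenvalue, - 1/3 from the profile one unit away from the wall, where complete trees sit,
  and (2 - k)/2 from replacing the factorial of (k - 1) n by a power of n!.\<close>

text \<open>The list \<open>ls\<close> holds the child lists of the internal nodes \<open>1, 2, \<dots>\<close> in postorder, with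
  \<open>0\<close> for the sink; the stack holds, top first, the subtrees that still wait for their parent.\<close>

inductive code :: "nat \<Rightarrow> nat list list \<Rightarrow> nat list \<Rightarrow> bool" for k where
  sink: "code k [] [0]"
| pointer: "code k ls S \<Longrightarrow> j \<le> length ls \<Longrightarrow> code k ls (j # S)"
| node: "code k ls (c @ S) \<Longrightarrow> length c = k \<Longrightarrow> code k (ls @ [c]) (Suc (length ls) # S)"

definition codes :: "nat \<Rightarrow> nat \<Rightarrow> nat \<Rightarrow> (nat list list \<times> nat list) set" where
  "codes k y m = {(ls, S). code k ls S \<and> length ls = y \<and> length S = Suc m}"

definition num_codes :: "nat \<Rightarrow> nat \<Rightarrow> nat \<Rightarrow> nat" where
  "num_codes k y m = card (codes k y m)"

lemma code_stack_le: "code k ls S \<Longrightarrow> set S \<subseteq> {..length ls}"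
  by (induction rule: code.induct) auto

lemma code_stack_ne: "code k ls S \<Longrightarrow> S \<noteq> []"
  by (induction rule: code.induct) auto

text \<open>Only node steps remove stack entries, and each of them pushes the new newest node. This
  separates the two kinds of steps in \<open>num_codes_rec\<close> and determines the final stack of
  a tree.\<close>

lemma code_top_in_stack: "code k ls S \<Longrightarrow> k \<ge> 1 \<Longrightarrow> length ls \<in> set S"
  by (induction rule: code.induct) auto

lemma code_entries:
  "code k ls S \<Longrightarrow> i < length ls \<Longrightarrow> length (ls ! i) = k \<and> set (ls ! i) \<subseteq> {..i}"
proof (induction arbitrary: i rule: code.induct)
  case (node ls c S)
  then show ?case
    using code_stack_le[OF node(1)] by (cases "i < length ls") (auto simp: nth_append less_Suc_eq)
qed auto

lemma codes_0_0: "codes k 0 0 = {([], [0])}"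
proof -
  have "ls = [] \<and> S = [0]" if "code k ls S" "length ls = 0" "length S = Suc 0" for ls S
    using that
  proof cases
    case (pointer S j)
    then show ?thesis using that code_stack_ne[OF pointer(2)] by simp
  qed auto
  then show ?thesis
    by (auto simp: codes_def intro: code.sink)
qed

text \<open>Inverts the last step. A pointer raises \<open>m\<close> by 1; a node raises
  \<open>y\<close> by 1 and lowers \<open>m\<close> by \<open>k - 1\<close>. So
  \<open>k * y + m\<close> counts the steps made, and it serves as the induction measure and later
  as the time.\<close>

lemma codes_rec:
  assumes "k \<ge> 1" "k * y + m > 0"
  shows "codes k y m =
    (\<lambda>((ls, S), j). (ls, j # S)) ` (if m > 0 then codes k y (m - 1) \<times> {..y} else {}) \<union>
    (\<lambda>(ls, S). (ls @ [take k S], y # drop k S)) ` (if y > 0 then codes k (y - 1) (m + k - 1) else {})"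
    (is "_ = ?P \<union> ?Q")
proof
  show "codes k y m \<subseteq> ?P \<union> ?Q"
  proof (rule subrelI)
    fix ls S assume *: "(ls, S) \<in> codes k y m"
    from * have "code k ls S" "length ls = y" "length S = Suc m"
      by (auto simp: codes_def)
    then show "(ls, S) \<in> ?P \<union> ?Q"
    proof cases
      case sink
      with \<open>length ls = y\<close> \<open>length S = Suc m\<close> assms show ?thesis by simp
    next
      case (pointer S' j)
      with \<open>length S = Suc m\<close> code_stack_ne[OF pointer(2)] have m: "m > 0" by (cases m) auto
      have "((ls, S'), j) \<in> codes k y (m - 1) \<times> {..y}"
        using pointer m \<open>length ls = y\<close> \<open>length S = Suc m\<close> by (auto simp: codes_def)
      then have "(ls, S) \<in> ?P"
        using m pointer by (auto intro!: image_eqI[of _ _ "((ls, S'), j)"])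
      then show ?thesis by blast
    next
      case (node ls' c S')
      then have y: "y > 0" using \<open>length ls = y\<close> by auto
      have "(ls', c @ S') \<in> codes k (y - 1) (m + k - 1)"
        using node assms y \<open>length ls = y\<close> \<open>length S = Suc m\<close> by (auto simp: codes_def)
      then have "(ls, S) \<in> ?Q"
        using y node \<open>length ls = y\<close> by (auto intro!: image_eqI[of _ _ "(ls', c @ S')"])
      then show ?thesis by blast
    qed
  qed
  have "?P \<subseteq> codes k y m"
    by (auto simp: codes_def intro: code.pointer split: if_splits)
  moreover have "(ls @ [take k S], y # drop k S) \<in> codes k y m"
    if "y > 0" "(ls, S) \<in> codes k (y - 1) (m + k - 1)" for ls S
  proof -
    have *: "code k ls (take k S @ drop k S)" "length ls = y - 1" "length S = m + k"
      using that assms by (auto simp: codes_def)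
    have "code k (ls @ [take k S]) (Suc (length ls) # drop k S)"
      by (rule code.node) (use * in auto)
    then show ?thesis using * that by (auto simp: codes_def)
  qed
  ultimately show "?P \<union> ?Q \<subseteq> codes k y m"
    by (auto split: if_splits)
qed

lemma finite_codes: "k \<ge> 1 \<Longrightarrow> finite (codes k y m)"
proof (induction "k * y + m" arbitrary: y m rule: less_induct)
  case less
  show ?case
  proof (cases "k * y + m > 0")
    case True
    have "finite (codes k y (m - 1))" if "m > 0"
      using that less by simp
    moreover have "finite (codes k (y - 1) (m + k - 1))" if "y > 0"
    proof -
      have "k * (y - 1) + (m + k - 1) < k * y + m" using that less(2) by (cases y) auto
      then show ?thesis using less by blast
    qed
    ultimately show ?thesis
      by (subst codes_rec[OF less(2) True]) auto
  next
    case False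
    with less(2) show ?thesis by (auto simp: codes_0_0)
  qed
qed

lemma num_codes_0_0: "num_codes k 0 0 = 1"
  by (simp add: num_codes_def codes_0_0)

text \<open>A pointer to the newest node always has another copy of that node below it on the stack,
  which tells the two kinds of steps apart.\<close>

lemma num_codes_rec:
  assumes "k \<ge> 1" "k * y + m > 0"
  shows "num_codes k y m =
    (if m > 0 then (y + 1) * num_codes k y (m - 1) else 0) +
    (if y > 0 then num_codes k (y - 1) (m + k - 1) else 0)"
proof -
  let ?A = "if m > 0 then codes k y (m - 1) \<times> {..y} else {}"
  let ?B = "if y > 0 then codes k (y - 1) (m + k - 1) else {}"
  let ?f = "\<lambda>((ls, S), j). (ls, j # S) :: nat list list \<times> nat list"
  let ?g = "\<lambda>(ls, S). (ls @ [take k S], y # drop k S)"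
  have fin: "finite ?A" "finite ?B" using finite_codes assms by auto
  have injf: "inj_on ?f ?A" by (auto simp: inj_on_def)
  have injg: "inj_on ?g ?B"
  proof (rule inj_onI)
    fix p q assume "?g p = ?g q"
    then have "fst p = fst q" "take k (snd p) = take k (snd q)" "drop k (snd p) = drop k (snd q)"
      by (auto simp: case_prod_unfold)
    then show "p = q" by (metis append_take_drop_id prod_eqI)
  qed
  have "?f ` ?A \<inter> ?g ` ?B = {}"
  proof (rule ccontr)
    assume "?f ` ?A \<inter> ?g ` ?B \<noteq> {}"
    then obtain ls S ls' S' where *: "(ls, S) \<in> codes k y (m - 1)"
      "(ls', S') \<in> codes k (y - 1) (m + k - 1)" "y > 0" "S = drop k S'"
      by (auto split: if_splits)
    then have "y \<in> set (drop k S')"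
      using code_top_in_stack assms by (auto simp: codes_def)
    then have "y \<in> set S'" using in_set_dropD by metis
    with *(2,3) code_stack_le show False by (fastforce simp: codes_def)
  qed
  then have "num_codes k y m = card ?A + card ?B"
    unfolding num_codes_def codes_rec[OF assms]
    using fin card_image[OF injf] card_image[OF injg] by (subst card_Un_disjoint) auto
  then show ?thesis by (auto simp: num_codes_def card_cartesian_product)
qed

lemma num_codes_pos: "k \<ge> 1 \<Longrightarrow> num_codes k y m > 0"
proof (induction "k * y + m" arbitrary: y m rule: less_induct)
  case less
  consider "y = 0" "m = 0" | "m > 0" | "y > 0" "m = 0" by auto
  then show ?case
  proof cases
    case 1
    then show ?thesis by (simp add: num_codes_0_0)
  next
    case 2
    then have "num_codes k y (m - 1) > 0" using less by simp
    then show ?thesis using 2 num_codes_rec[of k y m] less(2) by simp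
  next
    case 3
    then have "k * (y - 1) + (m + k - 1) < k * y + m" using less(2) by (cases y) auto
    then have "num_codes k (y - 1) (m + k - 1) > 0" using less by blast
    then show ?thesis using 3 num_codes_rec[of k y m] less(2) by simp
  qed
qed

section \<open>Decoding: codes correspond to dags with a stack, up to isomorphism\<close>

definition graph_of :: "nat list list \<Rightarrow> nat ordered_digraph" where
  "graph_of ls = \<lparr>nodes = {..length ls}, children = (\<lambda>i. if i = 0 then [] else ls ! (i - 1))\<rparr>"

lemma graph_of_simps [simp]:
  "nodes (graph_of ls) = {..length ls}"
  "children (graph_of ls) 0 = []"
  "children (graph_of ls) (Suc i) = ls ! i"
  by (auto simp: graph_of_def)

text \<open>The general objects of the induction: the stack replaces the unique source. Its top entry is
  a pointer if and only if it is reachable from the rest of the stack, which makes the decoding of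
  a graph unique.\<close>

definition stack_dag :: "nat \<Rightarrow> 'a ordered_digraph \<Rightarrow> 'a list \<Rightarrow> bool" where
  "stack_dag k G S \<longleftrightarrow> ordered_dag G \<and> (\<exists>!t. t \<in> sinks G) \<and>
     (\<forall>v \<in> internal_nodes G. outdegree G v = k) \<and>
     set S \<subseteq> nodes G \<and> (\<forall>v \<in> nodes G. \<exists>s \<in> set S. (s, v) \<in> (edge_rel G)\<^sup>*)"

lemma stack_dag_reach:
  "stack_dag k G S \<Longrightarrow> v \<in> nodes G \<Longrightarrow> \<exists>s \<in> set S. (s, v) \<in> (edge_rel G)\<^sup>*"
  by (simp only: stack_dag_def)

text \<open>The map is kept explicit because the uniqueness induction also needs it to carry one
  stack to the other.\<close>

definition dag_iso :: "('a \<Rightarrow> 'b) \<Rightarrow> 'a ordered_digraph \<Rightarrow> 'b ordered_digraph \<Rightarrow> bool" where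
  "dag_iso h G H \<longleftrightarrow> bij_betw h (nodes G) (nodes H) \<and>
     (\<forall>v \<in> nodes G. children H (h v) = map h (children G v))"

lemma ordered_iso_iff: "ordered_iso G H \<longleftrightarrow> (\<exists>h. dag_iso h G H)"
  by (simp add: ordered_iso_def dag_iso_def)

lemma edge_relD: "(u, v) \<in> edge_rel G \<Longrightarrow> u \<in> nodes G \<and> v \<in> set (children G u)"
  by (simp add: edge_rel_def)

lemma code_edge_less: "code k ls S \<Longrightarrow> (u, v) \<in> edge_rel (graph_of ls) \<Longrightarrow> v < u"
  using code_entries[of k ls S "u - 1"] by (cases u) (auto simp: edge_rel_def)

lemma code_reach_le:
  assumes "code k ls S" "(u, v) \<in> (edge_rel (graph_of ls))\<^sup>*" shows "v \<le> u"
  using assms(2) by (induction rule: rtrancl_induct) (auto dest: code_edge_less[OF assms(1)])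

lemma edge_rel_graph_of_snoc: "edge_rel (graph_of ls) \<subseteq> edge_rel (graph_of (ls @ [c]))"
proof
  fix p assume "p \<in> edge_rel (graph_of ls)"
  then show "p \<in> edge_rel (graph_of (ls @ [c]))"
    by (cases p; cases "fst p") (auto simp: edge_rel_def nth_append)
qed

text \<open>A node step takes \<open>c\<close> off the stack, but the new top entry has edges to all
  of \<open>c\<close>, so nothing becomes unreachable.\<close>

lemma code_covers:
  "code k ls S \<Longrightarrow> v \<le> length ls \<Longrightarrow> \<exists>s \<in> set S. (s, v) \<in> (edge_rel (graph_of ls))\<^sup>*"
proof (induction arbitrary: v rule: code.induct)
  case (node ls c S)
  let ?E = "edge_rel (graph_of (ls @ [c]))"
  show ?case
  proof (cases "v = Suc (length ls)")
    case False
    then have "v \<le> length ls" using node.prems by simp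
    then obtain s where s: "s \<in> set (c @ S)" "(s, v) \<in> (edge_rel (graph_of ls))\<^sup>*"
      using node.IH by blast
    then have sv: "(s, v) \<in> ?E\<^sup>*"
      using rtrancl_mono[OF edge_rel_graph_of_snoc] by blast
    show ?thesis
    proof (cases "s \<in> set c")
      case True
      then have "(Suc (length ls), s) \<in> ?E" by (auto simp: edge_rel_def)
      with sv show ?thesis by (meson converse_rtrancl_into_rtrancl list.set_intros(1))
    qed (use s sv in auto)
  qed auto
qed auto

lemma code_sinks:
  assumes "code k ls S" "k \<ge> 1" shows "sinks (graph_of ls) = {0}"
proof -
  have "ls ! i \<noteq> []" if "i < length ls" for i
    using code_entries[OF assms(1) that] assms(2) by auto
  then have "v = 0" if "v \<in> sinks (graph_of ls)" for v
    using that \<open>\<And>i. i < length ls \<Longrightarrow> ls ! i \<noteq> []\<close>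
    by (cases v) (auto simp: sinks_def edge_rel_def Suc_le_eq)
  moreover have "0 \<in> sinks (graph_of ls)"
    by (simp add: sinks_def edge_rel_def)
  ultimately show ?thesis by blast
qed

lemma code_stack_dag:
  assumes "code k ls S" "k \<ge> 1" shows "stack_dag k (graph_of ls) S"
proof -
  have "acyclic (edge_rel (graph_of ls))"
  proof (rule acyclic_subset)
    have "acyclic ({(u, v). u < (v::nat)}\<inverse>)"
      using wf_less wf_acyclic acyclic_converse by blast
    then show "acyclic {(v, u). u < (v::nat)}"
      by (simp add: converse_unfold)
    show "edge_rel (graph_of ls) \<subseteq> {(v, u). u < v}"
      using code_edge_less[OF assms(1)] by auto
  qed
  moreover have "edge_rel (graph_of ls) \<subseteq> {..length ls} \<times> {..length ls}"
    using code_edge_less[OF assms(1)] by (fastforce dest: edge_relD)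
  moreover have "outdegree (graph_of ls) v = k" if "v \<le> length ls" "v \<noteq> 0" for v
    using that code_entries[OF assms(1), of "v - 1"] by (cases v) (auto simp: outdegree_def)
  ultimately show ?thesis
    using code_sinks[OF assms] code_covers[OF assms(1)] code_stack_le[OF assms(1)]
    by (auto simp: stack_dag_def ordered_dag_def internal_nodes_def)
qed

lemma dag_iso_edge:
  assumes "dag_iso h G H" "(u, v) \<in> edge_rel G" shows "(h u, h v) \<in> edge_rel H"
  using assms by (auto simp: dag_iso_def edge_rel_def bij_betw_def)

lemma dag_iso_reach:
  assumes "dag_iso h G H" "(u, v) \<in> (edge_rel G)\<^sup>*" shows "(h u, h v) \<in> (edge_rel H)\<^sup>*"
  using assms(2) by (induction rule: rtrancl_induct) (auto dest: dag_iso_edge[OF assms(1)])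

lemma dag_iso_inv:
  assumes "dag_iso h G H" "edge_rel G \<subseteq> nodes G \<times> nodes G"
  shows "dag_iso (inv_into (nodes G) h) H G"
proof -
  have bij: "bij_betw h (nodes G) (nodes H)" using assms by (simp add: dag_iso_def)
  have "children G (inv_into (nodes G) h w) = map (inv_into (nodes G) h) (children H w)"
    if w: "w \<in> nodes H" for w
  proof -
    obtain v where v: "v \<in> nodes G" "w = h v" using bij w by (auto simp: bij_betw_def)
    have "set (children G v) \<subseteq> nodes G" using assms(2) v by (auto simp: edge_rel_def)
    then have "map (inv_into (nodes G) h) (map h (children G v)) = children G v"
      using bij by (auto simp: bij_betw_def intro!: map_idI)
    then show ?thesis using v assms(1) bij by (simp add: dag_iso_def bij_betw_def)
  qed
  then show ?thesis using bij_betw_inv_into[OF bij] by (simp add: dag_iso_def)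
qed

lemma dag_iso_trans:
  assumes "dag_iso h G H" "dag_iso g H K" shows "dag_iso (g \<circ> h) G K"
proof -
  have "children K (g (h v)) = map g (map h (children G v))" if "v \<in> nodes G" for v
  proof -
    have "h v \<in> nodes H" using assms(1) that by (auto simp: dag_iso_def bij_betw_def)
    then show ?thesis using assms that by (simp add: dag_iso_def)
  qed
  moreover have "bij_betw (g \<circ> h) (nodes G) (nodes K)"
    using assms bij_betw_trans by (auto simp: dag_iso_def)
  ultimately show ?thesis by (simp add: dag_iso_def)
qed

lemma code_edges_closed:
  "code k ls S \<Longrightarrow> edge_rel (graph_of ls) \<subseteq> nodes (graph_of ls) \<times> nodes (graph_of ls)"
  using code_edge_less by (fastforce dest: edge_relD)

text \<open>Induction along the first code. The last step of the second code must be of the same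
  kind: isomorphisms preserve whether the top entry is reachable from the rest of the stack, and
  since edges lower labels this is false right after a node step.\<close>

lemma code_iso_unique:
  assumes "code k ls S" "code k ls' (map h S)" "dag_iso h (graph_of ls) (graph_of ls')"
  shows "ls = ls' \<and> (\<forall>v \<le> length ls. h v = v)"
  using assms
proof (induction arbitrary: ls' h rule: code.induct)
  case (sink)
  then have "bij_betw h {..0} {..length ls'}" by (simp add: dag_iso_def)
  then have "card {..length ls'} = 1" using bij_betw_same_card by fastforce
  then show ?case using sink by (auto simp: dag_iso_def bij_betw_def)
next
  case (pointer ls S j)
  have eq: "length ls = length ls'"
    using bij_betw_same_card pointer.prems(2) by (fastforce simp: dag_iso_def)
  from pointer.prems(1) show ?case
  proof cases
    case sink
    with code_stack_ne[OF pointer.hyps(1)] show ?thesis by auto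
  next
    case (pointer S' j')
    with pointer.IH pointer.prems show ?thesis by auto
  next
    \<comment> \<open>Impossible: \<open>j\<close> is reachable from the rest of the stack, whereas
      \<open>h j\<close> is a fresh node exceeding every label below it.\<close>
    case (node ls'' c S')
    obtain s where s: "s \<in> set S" "(s, j) \<in> (edge_rel (graph_of ls))\<^sup>*"
      using code_covers[OF pointer.hyps] by blast
    have "(h s, h j) \<in> (edge_rel (graph_of ls'))\<^sup>*"
      by (rule dag_iso_reach[OF pointer.prems(2) s(2)])
    then have "h j \<le> h s" using code_reach_le pointer.prems(1) by blast
    moreover have "h s \<le> length ls''"
      using code_stack_le[OF node(3)] s(1) node(2) by (auto simp: image_subset_iff)
    moreover have "h j = Suc (length ls'')" using node by simp
    ultimately show ?thesis by simp
  qed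
next
  case (node ls c S)
  have eq: "length (ls @ [c]) = length ls'"
    using bij_betw_same_card[of h "{..length (ls @ [c])}" "{..length ls'}"] node.prems(2)
    by (simp add: dag_iso_def)
  have full: "code k (ls @ [c]) (Suc (length ls) # S)" using node.hyps code.node by blast
  from node.prems(1) show ?case
  proof cases
    case sink
    then show ?thesis using eq by simp
  next
    \<comment> \<open>The mirror image of the mismatch above, so reachability is pulled back along
      the inverse isomorphism.\<close>
    case (pointer S' j')
    let ?g = "inv_into (nodes (graph_of (ls @ [c]))) h"
    have g: "dag_iso ?g (graph_of ls') (graph_of (ls @ [c]))"
      by (rule dag_iso_inv[OF node.prems(2) code_edges_closed[OF full]])
    have injh: "inj_on h (nodes (graph_of (ls @ [c])))"
      using node.prems(2) by (simp add: dag_iso_def bij_betw_def)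
    obtain s' where s': "s' \<in> set S'" "(s', j') \<in> (edge_rel (graph_of ls'))\<^sup>*"
      using code_covers[OF pointer(2,3)] by blast
    then obtain s where s: "s \<in> set S" "s' = h s" using pointer by auto
    have sle: "s \<le> length ls" using code_stack_le[OF node.hyps(1)] s by auto
    have "(?g s', ?g j') \<in> (edge_rel (graph_of (ls @ [c])))\<^sup>*"
      by (rule dag_iso_reach[OF g s'(2)])
    moreover have "?g s' = s" using s sle injh by (simp add: inv_into_f_f)
    moreover have "?g j' = Suc (length ls)" using pointer injh by (auto simp: inv_into_f_f)
    ultimately have "Suc (length ls) \<le> s" using code_reach_le full by metis
    with sle show ?thesis by simp
  next
    case (node ls'' c' S')
    have len: "length ls'' = length ls" using eq node by simp
    have top: "h (Suc (length ls)) = Suc (length ls)" using node len by simp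
    have bij: "bij_betw h {..Suc (length ls)} {..Suc (length ls)}"
      using node.prems(2) len node by (simp add: dag_iso_def)
    have "bij_betw h ({..Suc (length ls)} - {Suc (length ls)}) ({..Suc (length ls)} - {Suc (length ls)})"
      using bij_betw_DiffI[OF bij, of "{Suc (length ls)}" "{Suc (length ls)}"] top by auto
    moreover have "{..Suc (length ls)} - {Suc (length ls)} = {..length ls}" by auto
    ultimately have bij': "bij_betw h {..length ls} {..length ls}" by simp
    have ch: "children (graph_of ls') (h v) = map h (children (graph_of (ls @ [c])) v)"
      if "v \<le> Suc (length ls)" for v
      using node.prems(2) that by (simp add: dag_iso_def)
    have cc: "c' = map h c" using ch[of "Suc (length ls)"] top len node by (simp add: nth_append)
    have "children (graph_of ls'') (h v) = map h (children (graph_of ls) v)" if v: "v \<le> length ls" for v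
    proof -
      have hv: "h v \<le> length ls" using bij' v by (auto simp: bij_betw_def)
      have "children (graph_of ls'') (h v) = children (graph_of ls') (h v)"
        using hv len node by (cases "h v") (auto simp: nth_append)
      also have "\<dots> = map h (children (graph_of (ls @ [c])) v)" using ch v by simp
      also have "children (graph_of (ls @ [c])) v = children (graph_of ls) v"
        using v by (cases v) (auto simp: nth_append)
      finally show ?thesis .
    qed
    then have "dag_iso h (graph_of ls) (graph_of ls'')"
      using bij' len by (simp add: dag_iso_def)
    moreover have "code k ls'' (map h (c @ S))" using node cc by simp
    ultimately have IH: "ls = ls'' \<and> (\<forall>v\<le>length ls. h v = v)" using node.IH by blast
    have "c' = c"
      using cc IH code_stack_le[OF node.hyps(1)] by (auto intro!: map_idI)
    then show ?thesis using IH node(1) top by (simp add: le_Suc_eq)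
  qed
qed

lemma dag_wf:
  assumes "ordered_dag G" shows "wf (edge_rel G)" "wf ((edge_rel G)\<inverse>)"
proof -
  have "finite (edge_rel G)" "acyclic (edge_rel G)"
    using assms finite_subset[of "edge_rel G" "nodes G \<times> nodes G"] by (auto simp: ordered_dag_def)
  then show "wf (edge_rel G)" "wf ((edge_rel G)\<inverse>)"
    by (auto intro: finite_acyclic_wf finite_acyclic_wf_converse)
qed

lemma dag_reach_sink:
  assumes "ordered_dag G" "v \<in> nodes G" "sinks G = {t}"
  shows "(v, t) \<in> (edge_rel G)\<^sup>*"
  using assms(2)
proof (induction v rule: wf_induct_rule[OF dag_wf(2)[OF assms(1)]])
  case (1 v)
  show ?case
  proof (cases "v = t")
    case False
    then have "v \<notin> sinks G" using assms(3) by simp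
    then obtain u where u: "(v, u) \<in> edge_rel G" using 1(2) by (auto simp: sinks_def)
    then have "u \<in> nodes G" using assms(1) by (auto simp: ordered_dag_def)
    with u 1(1) have "(u, t) \<in> (edge_rel G)\<^sup>*" by auto
    with u show ?thesis by (meson converse_rtrancl_into_rtrancl)
  qed auto
qed

lemma dag_reach_from_source:
  assumes "ordered_dag G" "v \<in> nodes G" "sources G = {s}"
  shows "(s, v) \<in> (edge_rel G)\<^sup>*"
  using assms(2)
proof (induction v rule: wf_induct_rule[OF dag_wf(1)[OF assms(1)]])
  case (1 v)
  show ?case
  proof (cases "v = s")
    case False
    then have "v \<notin> sources G" using assms(3) by simp
    then obtain u where u: "(u, v) \<in> edge_rel G" using 1(2) by (auto simp: sources_def)
    then have "u \<in> nodes G" by (simp add: edge_rel_def)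
    with u 1(1) have "(s, u) \<in> (edge_rel G)\<^sup>*" by auto
    with u show ?thesis by (meson rtrancl_into_rtrancl)
  qed auto
qed

definition remove_node :: "'a \<Rightarrow> 'a ordered_digraph \<Rightarrow> 'a ordered_digraph" where
  "remove_node v G = \<lparr>nodes = nodes G - {v}, children = children G\<rparr>"

lemma remove_node_simps [simp]:
  "nodes (remove_node v G) = nodes G - {v}" "children (remove_node v G) = children G"
  by (auto simp: remove_node_def)

lemma rtrancl_avoid:
  assumes "(u, w) \<in> R\<^sup>*" "(u, v) \<notin> R\<^sup>*"
  shows "(u, w) \<in> {(a, b). (a, b) \<in> R \<and> a \<noteq> v}\<^sup>*"
  using assms
proof (induction rule: rtrancl_induct)
  case (step y z)
  then have "y \<noteq> v" by auto
  with step have "(y, z) \<in> {(a, b). (a, b) \<in> R \<and> a \<noteq> v}" by auto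
  with step show ?case by (meson rtrancl_into_rtrancl)
qed auto

text \<open>Undoes a node step. Every node other than \<open>v\<close> is reached from the rest of
  the stack or from a child of \<open>v\<close>, and none of those reaches \<open>v\<close> (a child
  doing so would close a cycle). Hence no edge enters \<open>v\<close>, and deleting it is
  harmless.\<close>

lemma stack_dag_remove:
  assumes G: "stack_dag k G (v # S)" and k: "k \<ge> 1"
    and nr: "\<And>s. s \<in> set S \<Longrightarrow> (s, v) \<notin> (edge_rel G)\<^sup>*" and int: "v \<in> internal_nodes G"
  shows "stack_dag k (remove_node v G) (children G v @ S)" "length (children G v) = k"
    "\<And>u. u \<in> nodes G \<Longrightarrow> v \<notin> set (children G u)"
proof -
  let ?E = "edge_rel G" and ?H = "remove_node v G"
  have dag: "ordered_dag G" using G by (simp add: stack_dag_def)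
  have vG: "v \<in> nodes G" using int by (simp add: internal_nodes_def)
  have acyc: "acyclic ?E" and closed: "?E \<subseteq> nodes G \<times> nodes G"
    using dag by (auto simp: ordered_dag_def)
  show len: "length (children G v) = k" using G int by (auto simp: stack_dag_def outdegree_def)
  have ch: "(v, c) \<in> ?E" if "c \<in> set (children G v)" for c
    using that vG by (simp add: edge_rel_def)
  have nr': "(s, v) \<notin> ?E\<^sup>*" if "s \<in> set (children G v @ S)" for s
  proof
    assume "(s, v) \<in> ?E\<^sup>*"
    with that nr ch have "(v, s) \<in> ?E" by auto
    with \<open>(s, v) \<in> ?E\<^sup>*\<close> have "(v, v) \<in> ?E\<^sup>+" by (meson rtrancl_into_trancl2)
    with acyc show False by (simp add: acyclic_def)
  qed
  have from_stack: "\<exists>s \<in> set (children G v @ S). (s, u) \<in> ?E\<^sup>*" if u: "u \<in> nodes G" "u \<noteq> v" for u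
  proof -
    obtain s where s: "s \<in> set (v # S)" "(s, u) \<in> ?E\<^sup>*" using stack_dag_reach[OF G u(1)] by (rule bexE)
    show ?thesis
    proof (cases "s = v")
      case True
      with s(2) u(2) obtain c where "(v, c) \<in> ?E" "(c, u) \<in> ?E\<^sup>*"
        by (metis converse_rtranclE)
      then show ?thesis by (auto simp: edge_rel_def)
    qed (use s in auto)
  qed
  show nov: "v \<notin> set (children G u)" if u: "u \<in> nodes G" for u
  proof
    assume "v \<in> set (children G u)"
    then have uv: "(u, v) \<in> ?E" using u by (simp add: edge_rel_def)
    then have "u \<noteq> v" using acyc by (auto simp: acyclic_def)
    then obtain s where "s \<in> set (children G v @ S)" "(s, u) \<in> ?E\<^sup>*" using from_stack u by blast
    with uv nr' show False by (meson rtrancl_into_rtrancl)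
  qed
  have EH: "edge_rel ?H = {(a, b). (a, b) \<in> ?E \<and> a \<noteq> v}" by (auto simp: edge_rel_def)
  have "ordered_dag ?H"
    unfolding ordered_dag_def
  proof (intro conjI)
    show "finite (nodes ?H)" using dag by (simp add: ordered_dag_def)
    show "acyclic (edge_rel ?H)" using acyc by (rule acyclic_subset) (auto simp: EH)
    show "edge_rel ?H \<subseteq> nodes ?H \<times> nodes ?H"
    proof (rule subrelI)
      fix a b assume "(a, b) \<in> edge_rel ?H"
      then have ab: "(a, b) \<in> ?E" "a \<noteq> v" by (auto simp: EH)
      then have "a \<in> nodes G" "b \<in> nodes G" "b \<noteq> v"
        using closed nov[of a] by (auto simp: edge_rel_def)
      with ab show "(a, b) \<in> nodes ?H \<times> nodes ?H" by simp
    qed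
  qed
  moreover have sinks: "sinks ?H = sinks G"
    using int by (auto simp: sinks_def EH internal_nodes_def)
  moreover have "internal_nodes ?H = internal_nodes G - {v}"
    using sinks by (auto simp: internal_nodes_def)
  moreover have "set (children G v @ S) \<subseteq> nodes ?H"
  proof
    fix s assume s: "s \<in> set (children G v @ S)"
    then have "s \<in> nodes G" using G ch closed by (auto simp: stack_dag_def)
    moreover have "s \<noteq> v" using nr'[OF s] by auto
    ultimately show "s \<in> nodes ?H" by simp
  qed
  moreover have "\<exists>s \<in> set (children G v @ S). (s, u) \<in> (edge_rel ?H)\<^sup>*" if "u \<in> nodes ?H" for u
  proof -
    obtain s where s: "s \<in> set (children G v @ S)" "(s, u) \<in> ?E\<^sup>*"
      using from_stack[of u] \<open>u \<in> nodes ?H\<close> by auto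
    then have "(s, u) \<in> (edge_rel ?H)\<^sup>*"
      unfolding EH by (intro rtrancl_avoid nr')
    with s show ?thesis by blast
  qed
  ultimately show "stack_dag k ?H (children G v @ S)"
    using G by (auto simp: stack_dag_def outdegree_def)
qed

lemma code_exists:
  assumes "stack_dag k G S" "S \<noteq> []" "k \<ge> 1"
  shows "\<exists>ls h. code k ls (map h S) \<and> dag_iso h G (graph_of ls)"
  using assms
\<comment> \<open>Undoing a pointer shortens the stack by 1; undoing a node saves \<open>k\<close>
  for the node and lengthens the stack by only \<open>k - 1\<close>.\<close>
proof (induction "k * card (nodes G) + length S" arbitrary: G S rule: less_induct)
  case less
  obtain v S' where S: "S = v # S'" using less.prems by (cases S) auto
  let ?E = "edge_rel G"
  have dag: "ordered_dag G" and fin: "finite (nodes G)"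
    using less.prems by (auto simp: stack_dag_def ordered_dag_def)
  obtain t where t: "sinks G = {t}" using less.prems unfolding stack_dag_def by blast
  have vG: "v \<in> nodes G" using less.prems S by (auto simp: stack_dag_def)
  consider (ptr) s where "s \<in> set S'" "(s, v) \<in> ?E\<^sup>*"
    | (int) "\<And>s. s \<in> set S' \<Longrightarrow> (s, v) \<notin> ?E\<^sup>*" "v \<in> internal_nodes G"
    | (snk) "\<And>s. s \<in> set S' \<Longrightarrow> (s, v) \<notin> ?E\<^sup>*" "v = t"
    using t vG by (auto simp: internal_nodes_def)
  then show ?case
  proof cases
    case ptr
    have "\<exists>s\<in>set S'. (s, u) \<in> ?E\<^sup>*" if u: "u \<in> nodes G" for u
    proof -
      obtain s' where s': "s' \<in> set S" "(s', u) \<in> ?E\<^sup>*"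
        using stack_dag_reach[OF less.prems(1) u] by (rule bexE)
      show ?thesis
      proof (cases "s' = v")
        case True
        with s' ptr show ?thesis by (meson rtrancl_trans)
      qed (use s' S in auto)
    qed
    then have "stack_dag k G S'"
      using less.prems(1) S by (auto simp: stack_dag_def)
    moreover have "S' \<noteq> []" using ptr by auto
    ultimately obtain ls h where lh: "code k ls (map h S')" "dag_iso h G (graph_of ls)"
      using less.hyps[of G S'] less.prems(3) S by auto
    have "h v \<le> length ls" using lh(2) vG by (auto simp: dag_iso_def bij_betw_def)
    then have "code k ls (map h S)" using code.pointer[OF lh(1)] S by simp
    with lh show ?thesis by blast
  next
    case int
    note rem = stack_dag_remove[OF less.prems(1)[unfolded S] less.prems(3) int]
    let ?c = "children G v"
    have "k * card (nodes (remove_node v G)) + length (?c @ S') < k * card (nodes G) + length S"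
    proof -
      have "card (nodes G) = Suc (card (nodes G - {v}))" using fin vG by (metis card.remove)
      then show ?thesis using rem(2) S by simp
    qed
    moreover have "?c @ S' \<noteq> []" using rem(2) less.prems(3) by auto
    ultimately obtain ls h where lh: "code k ls (map h (?c @ S'))"
        "dag_iso h (remove_node v G) (graph_of ls)"
      using less.hyps rem(1) less.prems(3) by blast
    define h' where "h' = h(v := Suc (length ls))"
    have vnc: "v \<notin> set (children G u)" if "u \<in> nodes G" for u using rem(3) that by blast
    have vS: "v \<notin> set S'" using int by auto
    have mS: "map h' S' = map h S'" using vS by (auto simp: h'_def)
    have mc: "map h' (children G u) = map h (children G u)" if "u \<in> nodes G" for u
      using vnc[OF that] by (auto simp: h'_def)
    have "code k ls (map h ?c @ map h S')" using lh by simp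
    then have "code k (ls @ [map h ?c]) (Suc (length ls) # map h S')"
      by (rule code.node) (use rem in simp)
    then have 1: "code k (ls @ [map h ?c]) (map h' S)"
      by (simp only: S list.map mS) (simp add: h'_def)
    have bij: "bij_betw h (nodes G - {v}) {..length ls}" using lh(2) by (simp add: dag_iso_def)
    have "bij_betw h' (nodes G - {v}) {..length ls}"
      using bij by (rule bij_betw_cong[THEN iffD1, rotated]) (auto simp: h'_def)
    moreover have "bij_betw h' {v} {Suc (length ls)}" by (simp add: h'_def bij_betw_def)
    ultimately have "bij_betw h' ((nodes G - {v}) \<union> {v}) ({..length ls} \<union> {Suc (length ls)})"
      by (rule bij_betw_combine) auto
    moreover have "(nodes G - {v}) \<union> {v} = nodes G" using vG by auto
    moreover have "{..length ls} \<union> {Suc (length ls)} = {..length (ls @ [map h ?c])}" by auto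
    ultimately have bij': "bij_betw h' (nodes G) {..length (ls @ [map h ?c])}" by simp
    have "children (graph_of (ls @ [map h ?c])) (h' u) = map h' (children G u)"
      if u: "u \<in> nodes G" for u
    proof (cases "u = v")
      case True
      then show ?thesis using mc[OF vG] by (simp add: h'_def)
    next
      case False
      then have "h u \<le> length ls" using bij u by (auto simp: bij_betw_def)
      then have "children (graph_of (ls @ [map h ?c])) (h u) = children (graph_of ls) (h u)"
        by (cases "h u") (auto simp: nth_append)
      also have "\<dots> = map h (children G u)" using lh(2) u False by (simp add: dag_iso_def)
      finally show ?thesis using mc[OF u] False by (simp add: h'_def)
    qed
    then have "dag_iso h' G (graph_of (ls @ [map h ?c]))" using bij' by (simp add: dag_iso_def)
    with 1 show ?thesis by blast
  next
    case snk
    \<comment> \<open>Every node reaches the sink, so nothing can lie below a sink that is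
      unreachable from the rest of the stack. All nodes are then reached from \<open>t\<close>, and
      the graph is a single node.\<close>
    have "S' = []"
    proof (rule ccontr)
      assume "S' \<noteq> []"
      then obtain s where "s \<in> set S'" by (cases S') auto
      moreover from this have "s \<in> nodes G" using less.prems S by (auto simp: stack_dag_def)
      ultimately show False using dag_reach_sink[OF dag _ t] snk by blast
    qed
    have noch: "children G t = []"
    proof -
      have "t \<in> sinks G" using t by simp
      then have "u \<notin> set (children G t)" for u by (auto simp: sinks_def edge_rel_def)
      then show ?thesis by (metis ex_in_conv set_empty)
    qed
    have "u = t" if "u \<in> nodes G" for u
    proof -
      have "(t, u) \<in> ?E\<^sup>*" using less.prems(1) that S snk \<open>S' = []\<close> by (auto simp: stack_dag_def)
      then show ?thesis
        by (rule converse_rtranclE) (use noch in \<open>auto dest: edge_relD\<close>)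
    qed
    then have "nodes G = {t}" using vG snk(2) by blast
    then have "dag_iso (\<lambda>_. 0) G (graph_of [])"
      using noch by (auto simp: dag_iso_def bij_betw_def)
    moreover have "code k [] (map (\<lambda>_. 0) S)" using S \<open>S' = []\<close> by (simp add: code.sink)
    ultimately show ?thesis by blast
  qed
qed

lemma relaxed_tree_stack_dag:
  assumes "relaxed_tree k G" shows "\<exists>s. stack_dag k G [s]"
proof -
  obtain s where s: "sources G = {s}" using assms unfolding relaxed_tree_def by blast
  then have "s \<in> nodes G" by (auto simp: sources_def)
  then have "stack_dag k G [s]"
    using assms dag_reach_from_source[of G _ s] s by (simp add: relaxed_tree_def stack_dag_def)
  then show ?thesis ..
qed

lemma code_relaxed_tree:
  assumes "(ls, S) \<in> codes k n 0" "k \<ge> 1"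
  shows "graph_of ls \<in> relaxed_trees k n" "S = [n]"
proof -
  have c: "code k ls S" "length ls = n" "length S = 1" using assms by (auto simp: codes_def)
  then show S: "S = [n]" using code_top_in_stack[OF c(1) assms(2)] by (cases S) auto
  have sd: "stack_dag k (graph_of ls) S" by (rule code_stack_dag[OF c(1) assms(2)])
  have "sources (graph_of ls) = {n}"
  proof -
    have "v = n" if v: "v \<in> sources (graph_of ls)" for v
    proof -
      have "(n, v) \<in> (edge_rel (graph_of ls))\<^sup>*"
        using code_covers[OF c(1), of v] v S c(2) by (auto simp: sources_def)
      then show ?thesis using v by (auto simp: sources_def elim: rtranclE)
    qed
    moreover have "n \<in> sources (graph_of ls)"
      using c code_edge_less[OF c(1)] by (fastforce simp: sources_def dest: edge_relD)
    ultimately show ?thesis by blast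
  qed
  then have "relaxed_tree k (graph_of ls)" using sd by (auto simp: relaxed_tree_def stack_dag_def)
  moreover have "internal_nodes (graph_of ls) = {..n} - {0}"
    using code_sinks[OF c(1) assms(2)] c by (simp add: internal_nodes_def)
  ultimately show "graph_of ls \<in> relaxed_trees k n" by (simp add: relaxed_trees_def)
qed

lemma dag_iso_sinks:
  assumes "dag_iso h G H" shows "sinks H = h ` sinks G"
proof -
  have s: "sinks G = {v \<in> nodes G. children G v = []}" for G :: "'c ordered_digraph"
    by (auto simp: sinks_def edge_rel_def)
  have H: "nodes H = h ` nodes G" "\<And>v. v \<in> nodes G \<Longrightarrow> children H (h v) = map h (children G v)"
    using assms by (auto simp: dag_iso_def bij_betw_def)
  show ?thesis unfolding s H(1) using H(2) by auto
qed

text \<open>A code is sent to the class of its decoded graph; \<open>code_iso_unique\<close> gives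
  injectivity and \<open>code_exists\<close> surjectivity.\<close>

theorem num_relaxed_trees_eq_num_codes:
  assumes k: "k \<ge> 1" shows "num_relaxed_trees k n = num_codes k n 0"
proof -
  let ?A = "relaxed_trees k n"
  let ?R = "{(G, H). G \<in> ?A \<and> H \<in> ?A \<and> ordered_iso G H}"
  let ?f = "\<lambda>(ls, S). ?R `` {graph_of ls}"
  have closed: "edge_rel G \<subseteq> nodes G \<times> nodes G" if "G \<in> ?A" for G
    using that by (auto simp: relaxed_trees_def relaxed_tree_def ordered_dag_def)
  have sym: "ordered_iso H G" if "G \<in> ?A" "ordered_iso G H" for G H :: "nat ordered_digraph"
    using that dag_iso_inv closed unfolding ordered_iso_iff by blast
  have trans: "ordered_iso G K" if "ordered_iso G H" "ordered_iso H K"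
    for G H K :: "nat ordered_digraph"
    using that dag_iso_trans unfolding ordered_iso_iff by blast
  have refl: "ordered_iso G G" for G :: "nat ordered_digraph"
    unfolding ordered_iso_iff by (rule exI[of _ id]) (simp add: dag_iso_def)
  have "bij_betw ?f (codes k n 0) (?A // ?R)"
    unfolding bij_betw_def
  proof
    show "inj_on ?f (codes k n 0)"
    proof (rule inj_onI)
      fix p q assume pq: "p \<in> codes k n 0" "q \<in> codes k n 0" "?f p = ?f q"
      obtain ls S ls' S' where p: "p = (ls, S)" and q: "q = (ls', S')" by (cases p, cases q)
      have A: "graph_of ls \<in> ?A" "graph_of ls' \<in> ?A" and S: "S = [n]" "S' = [n]"
        using code_relaxed_tree[OF pq(1)[unfolded p] k] code_relaxed_tree[OF pq(2)[unfolded q] k]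
        by simp_all
      have "graph_of ls' \<in> ?R `` {graph_of ls'}" using A refl by simp
      then have "graph_of ls' \<in> ?R `` {graph_of ls}" using pq(3) p q by simp
      then obtain h where h: "dag_iso h (graph_of ls) (graph_of ls')"
        by (auto simp: ordered_iso_iff)
      have c: "code k ls [n]" "code k ls' [n]" "length ls = n" "length ls' = n"
        using pq p q S by (auto simp: codes_def)
      \<comment> \<open>The last node reaches all nodes and edges lower labels, so its image carries
        the largest label. This is the stack condition of \<open>code_iso_unique\<close>.\<close>
      have hn: "h n = n"
      proof (rule ccontr)
        assume "h n \<noteq> n"
        have le: "h n \<le> n" using h c by (auto simp: dag_iso_def bij_betw_def)
        define u where "u = inv_into {..n} h n"
        have u: "u \<le> n" "h u = n"
          using h c inv_into_into[of n h "{..n}"] f_inv_into_f[of n h "{..n}"]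
          unfolding u_def dag_iso_def bij_betw_def by auto
        obtain s where "s \<in> set [n]" "(s, u) \<in> (edge_rel (graph_of ls))\<^sup>*"
          using code_covers[OF c(1)] u c by metis
        then have "(h n, h u) \<in> (edge_rel (graph_of ls'))\<^sup>*" using dag_iso_reach[OF h] by simp
        then have "h u \<le> h n" using code_reach_le c(2) by blast
        with le u \<open>h n \<noteq> n\<close> show False by simp
      qed
      have "ls = ls'" using code_iso_unique[OF c(1) _ h] c(2) hn by simp
      with S p q show "p = q" by simp
    qed
    show "?f ` codes k n 0 = ?A // ?R"
    proof
      show "?f ` codes k n 0 \<subseteq> ?A // ?R"
      proof (rule image_subsetI)
        fix p assume p: "p \<in> codes k n 0"
        obtain ls S where "p = (ls, S)" by (cases p)
        then have "?R `` {graph_of ls} \<in> ?A // ?R"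
          using code_relaxed_tree(1)[OF _ k] p by (intro quotientI) blast
        then show "?f p \<in> ?A // ?R" by (simp only: \<open>p = (ls, S)\<close> prod.case)
      qed
      show "?A // ?R \<subseteq> ?f ` codes k n 0"
      proof
        fix X assume "X \<in> ?A // ?R"
        then obtain G where G: "G \<in> ?A" "X = ?R `` {G}" by (auto elim: quotientE)
        obtain s where "stack_dag k G [s]"
          using G relaxed_tree_stack_dag by (auto simp: relaxed_trees_def)
        then obtain ls h where lh: "code k ls [h s]" "dag_iso h G (graph_of ls)"
          using code_exists[of k G "[s]"] k by auto
        have bij: "bij_betw h (nodes G) {..length ls}" using lh by (simp add: dag_iso_def)
        have "internal_nodes (graph_of ls) = h ` internal_nodes G"
        proof -
          have "h ` (nodes G - sinks G) = h ` nodes G - h ` sinks G"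
            using bij by (intro inj_on_image_set_diff) (auto simp: bij_betw_def sinks_def)
          moreover have "h ` nodes G = nodes (graph_of ls)" using bij by (simp add: bij_betw_def)
          ultimately show ?thesis
            unfolding internal_nodes_def dag_iso_sinks[OF lh(2)] by simp
        qed
        moreover have "inj_on h (internal_nodes G)"
          using bij by (auto simp: bij_betw_def internal_nodes_def intro: inj_on_subset)
        ultimately have "card (internal_nodes (graph_of ls)) = n"
          using G by (simp add: card_image relaxed_trees_def)
        moreover have "internal_nodes (graph_of ls) = {..length ls} - {0}"
          using code_sinks[OF lh(1) k] by (simp add: internal_nodes_def)
        ultimately have len: "length ls = n" by simp
        then have c: "(ls, [h s]) \<in> codes k n 0" using lh by (simp add: codes_def)
        then have A: "graph_of ls \<in> ?A" using code_relaxed_tree k by blast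
        have iso: "ordered_iso G (graph_of ls)" using lh by (auto simp: ordered_iso_iff)
        have "ordered_iso G H = ordered_iso (graph_of ls) H" for H :: "nat ordered_digraph"
          using trans[OF iso] trans[OF sym[OF G(1) iso]] by blast
        then have "?R `` {G} = ?R `` {graph_of ls}"
          using G(1) A by auto
        then have "X = ?f (ls, [h s])" by (simp only: G(2) prod.case)
        then show "X \<in> ?f ` codes k n 0" using c by (rule image_eqI)
      qed
    qed
  qed
  then show ?thesis
    unfolding num_relaxed_trees_def num_codes_def by (rule bij_betw_same_card[symmetric])
qed

section \<open>The Airy function\<close>

definition airy_ode :: "(real \<Rightarrow> real) \<Rightarrow> (real \<Rightarrow> real) \<Rightarrow> bool" where
  "airy_ode f f' \<longleftrightarrow> (\<forall>x. (f has_real_derivative f' x) (at x) \<and>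
                          (f' has_real_derivative x * f x) (at x))"

lemma airy_odeD:
  assumes "airy_ode f f'"
  shows "(f has_real_derivative f' x) (at x)" "(f' has_real_derivative x * f x) (at x)"
  using assms by (auto simp: airy_ode_def)

lemma airy_ode_linear:
  assumes "airy_ode f f'" "airy_ode g g'"
  shows "airy_ode (\<lambda>x. a * f x + b * g x) (\<lambda>x. a * f' x + b * g' x)"
  unfolding airy_ode_def
  by (auto intro!: derivative_eq_intros airy_odeD[OF assms(1)] airy_odeD[OF assms(2)]
      simp: algebra_simps)

text \<open>Comparing coefficients in f'' = x f: the free values are f(0) and f'(0), the quadratic
  coefficient is 0, and the rest is a recursion with stride three.\<close>

fun airy_coeff :: "real \<Rightarrow> real \<Rightarrow> nat \<Rightarrow> real" where
  "airy_coeff p q 0 = p"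
| "airy_coeff p q (Suc 0) = q"
| "airy_coeff p q (Suc (Suc 0)) = 0"
| "airy_coeff p q (Suc (Suc (Suc n))) = airy_coeff p q n / (real (n + 3) * real (n + 2))"

text \<open>Once the index exceeds \<open>R ^ 3\<close>, a stride of three multiplies the term by at
  most 1, so a finite maximum bounds all terms. Abel's lemma then makes the series converge
  everywhere.\<close>

lemma airy_coeff_bounded:
  assumes "R \<ge> 1" shows "\<exists>M. \<forall>n. \<bar>airy_coeff p q n\<bar> * R ^ n \<le> M"
proof -
  obtain n0 :: nat where n0: "real n0 \<ge> R ^ 3" using real_arch_simple by blast
  define M where "M = Max ((\<lambda>n. \<bar>airy_coeff p q n\<bar> * R ^ n) ` {..n0 + 3})"
  have "\<bar>airy_coeff p q n\<bar> * R ^ n \<le> M" for n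
  proof (induction n rule: less_induct)
    case (less n)
    show ?case
    proof (cases "n \<le> n0 + 3")
      case True
      then show ?thesis unfolding M_def by (intro Max_ge) auto
    next
      case False
      then obtain m where m: "n = Suc (Suc (Suc m))" "m > n0"
        by (intro that[of "n - 3"]) auto
      have "R ^ 3 \<le> real (m + 3) * 1" using m n0 by simp
      also have "\<dots> \<le> real (m + 3) * real (m + 2)" by (intro mult_left_mono) auto
      finally have le: "R ^ 3 / (real (m + 3) * real (m + 2)) \<le> 1" by (simp add: divide_le_eq_1)
      have "\<bar>airy_coeff p q n\<bar> * R ^ n =
          (\<bar>airy_coeff p q m\<bar> * R ^ m) * (R ^ 3 / (real (m + 3) * real (m + 2)))"
        unfolding m airy_coeff.simps by (simp add: abs_mult power3_eq_cube mult_ac)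
      also have "\<dots> \<le> (\<bar>airy_coeff p q m\<bar> * R ^ m) * 1"
        using le assms by (intro mult_left_mono) auto
      also have "\<dots> \<le> M" using less m by simp
      finally show ?thesis .
    qed
  qed
  then show ?thesis by blast
qed

lemma airy_coeff_summable: "summable (\<lambda>n. airy_coeff p q n * x ^ n)"
proof -
  obtain M where M: "\<And>n. \<bar>airy_coeff p q n\<bar> * (\<bar>x\<bar> + 1) ^ n \<le> M"
    using airy_coeff_bounded[of "\<bar>x\<bar> + 1" p q] by auto
  have "summable (\<lambda>n. norm (airy_coeff p q n) * \<bar>x\<bar> ^ n)"
    using Abel_lemma[of "\<bar>x\<bar>" "\<bar>x\<bar> + 1" "airy_coeff p q" M] M by simp
  then show ?thesis
    by (intro summable_norm_cancel[of "\<lambda>n. airy_coeff p q n * x ^ n"])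
      (simp add: abs_mult power_abs)
qed

definition airy_series :: "real \<Rightarrow> real \<Rightarrow> real \<Rightarrow> real" where
  "airy_series p q x = (\<Sum>n. airy_coeff p q n * x ^ n)"

definition airy_series' :: "real \<Rightarrow> real \<Rightarrow> real \<Rightarrow> real" where
  "airy_series' p q x = (\<Sum>n. diffs (airy_coeff p q) n * x ^ n)"

lemma airy_series_ode: "airy_ode (airy_series p q) (airy_series' p q)"
proof -
  let ?c = "airy_coeff p q"
  have s1: "summable (\<lambda>n. diffs ?c n * x ^ n)" for x
    by (rule termdiff_converges_all[OF airy_coeff_summable])
  have s2: "summable (\<lambda>n. diffs (diffs ?c) n * x ^ n)" for x
    by (rule termdiff_converges_all[OF s1])
  have "(\<Sum>n. diffs (diffs ?c) n * x ^ n) = x * airy_series p q x" for x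
  proof -
    have "diffs (diffs ?c) (Suc n) = ?c n" for n
    proof -
      have "diffs (diffs ?c) (Suc n) =
          real (n + 2) * (real (n + 3) * (?c n / (real (n + 3) * real (n + 2))))"
        unfolding diffs_def airy_coeff.simps by (simp add: add_ac)
      also have "\<dots> = ?c n" by (simp del: of_nat_add)
      finally show ?thesis .
    qed
    moreover have "diffs (diffs ?c) 0 = 0" by (simp add: diffs_def)
    ultimately have "(\<Sum>n. diffs (diffs ?c) n * x ^ n) = (\<Sum>n. x * (?c n * x ^ n))"
      using suminf_split_head[OF s2[of x]] by (simp add: mult_ac)
    then show ?thesis unfolding airy_series_def by (simp add: suminf_mult airy_coeff_summable)
  qed
  moreover have "(airy_series p q has_real_derivative airy_series' p q x) (at x)" for x
    unfolding airy_series_def [abs_def] airy_series'_def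
    by (rule termdiffs_strong_converges_everywhere) (rule airy_coeff_summable)
  moreover have "(airy_series' p q has_real_derivative (\<Sum>n. diffs (diffs ?c) n * x ^ n)) (at x)" for x
    unfolding airy_series'_def [abs_def]
    by (rule termdiffs_strong_converges_everywhere) (rule s1)
  ultimately show ?thesis by (simp add: airy_ode_def)
qed

lemma airy_coeff_nonneg: "p \<ge> 0 \<Longrightarrow> q \<ge> 0 \<Longrightarrow> airy_coeff p q n \<ge> 0"
  by (induction p q n rule: airy_coeff.induct) auto

lemma airy_series_ge:
  assumes "p \<ge> 0" "q \<ge> 0" "x \<ge> 0" shows "airy_series p q x \<ge> p + q * x"
proof -
  have "(\<Sum>n<2. airy_coeff p q n * x ^ n) \<le> airy_series p q x"
    unfolding airy_series_def
    by (rule sum_le_suminf[OF airy_coeff_summable]) (auto simp: airy_coeff_nonneg assms)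
  then show ?thesis by (simp add: numeral_2_eq_2)
qed

text \<open>Comes from the terms x + x^4/12 of the series. The growth makes the bound
  \<open>1 / v'\<close> on the decaying solution tend to 0.\<close>

lemma airy_series'_ge:
  assumes "x \<ge> 0" shows "airy_series' 0 1 x \<ge> 1 + x ^ 3 / 3"
proof -
  have "(\<Sum>n<4. diffs (airy_coeff 0 1) n * x ^ n) \<le> airy_series' 0 1 x"
    unfolding airy_series'_def
    by (rule sum_le_suminf[OF termdiff_converges_all[OF airy_coeff_summable]])
      (auto simp: airy_coeff_nonneg assms diffs_def)
  moreover have "(\<Sum>n<4. diffs (airy_coeff 0 1) n * x ^ n) = 1 + x ^ 3 / 3"
    by (simp add: numeral_eq_Suc diffs_def)
  ultimately show ?thesis by simp
qed

lemma airy_series_0: "airy_series p q 0 = p" "airy_series' p q 0 = q"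
  unfolding airy_series_def airy_series'_def by (simp_all add: diffs_def)

text \<open>Gronwall's argument in both directions: the derivative of
  \<open>(f s)\<^sup>2 + (f' s)\<^sup>2\<close> is \<open>2 * (1 + s) * (f s * f' s)\<close>. It
  yields uniqueness for the initial value problem and, later, a Taylor remainder relative to the
  values at the base point.\<close>

lemma airy_energy_bound:
  assumes ode: "airy_ode f f'" and K: "\<And>s. s \<in> closed_segment x y \<Longrightarrow> 1 + \<bar>s\<bar> \<le> K"
  shows "(f y)\<^sup>2 + (f' y)\<^sup>2 \<le> ((f x)\<^sup>2 + (f' x)\<^sup>2) * exp (K * \<bar>y - x\<bar>)"
proof -
  define E where "E = (\<lambda>s. (f s)\<^sup>2 + (f' s)\<^sup>2)"
  define E' where "E' = (\<lambda>s. 2 * (1 + s) * (f s * f' s))"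
  have dE: "(E has_real_derivative E' s) (at s)" for s
    unfolding E_def E'_def
    by (auto intro!: derivative_eq_intros airy_odeD[OF ode] simp: algebra_simps)
  have bnd: "\<bar>E' s\<bar> \<le> K * E s" if "s \<in> closed_segment x y" for s
  proof -
    have "\<bar>2 * (f s * f' s)\<bar> \<le> E s"
      using sum_squares_bound[of "\<bar>f s\<bar>" "\<bar>f' s\<bar>"] by (simp add: E_def abs_mult mult_ac)
    moreover have "\<bar>1 + s\<bar> \<le> K" using K[OF that] by linarith
    ultimately have "\<bar>1 + s\<bar> * \<bar>2 * (f s * f' s)\<bar> \<le> K * E s"
      by (intro mult_mono) auto
    moreover have "E' s = (1 + s) * (2 * (f s * f' s))" by (simp add: E'_def)
    ultimately show ?thesis by (simp only: abs_mult)
  qed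
  show ?thesis
  proof (cases "x \<le> y")
    case True
    have "E y * exp (- K * y) \<le> E x * exp (- K * x)"
    proof (rule DERIV_nonpos_imp_nonincreasing[OF True])
      fix s assume s: "x \<le> s" "s \<le> y"
      have "((\<lambda>s. E s * exp (- K * s)) has_real_derivative (E' s - K * E s) * exp (- K * s)) (at s)"
        by (auto intro!: derivative_eq_intros dE simp: algebra_simps)
      moreover have "(E' s - K * E s) * exp (- K * s) \<le> 0"
      proof -
        have "s \<in> closed_segment x y" using s True by (auto simp: closed_segment_eq_real_ivl)
        then show ?thesis using bnd[of s] by (intro mult_nonpos_nonneg) auto
      qed
      ultimately show "\<exists>D. ((\<lambda>s. E s * exp (- K * s)) has_real_derivative D) (at s) \<and> D \<le> 0" by blast
    qed
    then have "E y * exp (- K * y) * exp (K * y) \<le> E x * exp (- K * x) * exp (K * y)"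
      by (rule mult_right_mono) simp
    then have "E y \<le> E x * exp (K * (y - x))"
      unfolding mult.assoc exp_add[symmetric] by (simp add: algebra_simps)
    then show ?thesis using True by (simp add: E_def)
  next
    case False
    then have yx: "y \<le> x" by simp
    have "E y * exp (K * y) \<le> E x * exp (K * x)"
    proof (rule DERIV_nonneg_imp_nondecreasing[OF yx])
      fix s assume s: "y \<le> s" "s \<le> x"
      have "((\<lambda>s. E s * exp (K * s)) has_real_derivative (E' s + K * E s) * exp (K * s)) (at s)"
        by (auto intro!: derivative_eq_intros dE simp: algebra_simps)
      moreover have "(E' s + K * E s) * exp (K * s) \<ge> 0"
      proof -
        have "s \<in> closed_segment x y" using s False by (auto simp: closed_segment_eq_real_ivl)
        then show ?thesis using bnd[of s] by (intro mult_nonneg_nonneg) auto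
      qed
      ultimately show "\<exists>D. ((\<lambda>s. E s * exp (K * s)) has_real_derivative D) (at s) \<and> D \<ge> 0" by blast
    qed
    then have "E y * exp (K * y) * exp (- K * y) \<le> E x * exp (K * x) * exp (- K * y)"
      by (rule mult_right_mono) simp
    then have "E y \<le> E x * exp (K * (x - y))"
      unfolding mult.assoc exp_add[symmetric] by (simp add: algebra_simps)
    then show ?thesis using False by (simp add: E_def)
  qed
qed

lemma airy_ode_zero:
  assumes ode: "airy_ode f f'" and "f x = 0" "f' x = 0"
  shows "f y = 0"
proof -
  have "(f y)\<^sup>2 + (f' y)\<^sup>2 \<le> ((f x)\<^sup>2 + (f' x)\<^sup>2) * exp ((1 + \<bar>x\<bar> + \<bar>y\<bar>) * \<bar>y - x\<bar>)"
    by (rule airy_energy_bound[OF ode]) (auto simp: closed_segment_eq_real_ivl split: if_splits)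
  then have "(f y)\<^sup>2 + (f' y)\<^sup>2 \<le> 0" using assms by simp
  then show ?thesis by (simp add: sum_power2_le_zero_iff)
qed

text \<open>\<open>f * f'\<close> is nondecreasing on the positive half line, so once it is nonnegative \<open>f\<^sup>2\<close> cannot
  decrease to \<open>0\<close> any more.\<close>

lemma decaying_solution_vanishes:
  assumes ode: "airy_ode f f'" and lim: "(f \<longlongrightarrow> 0) at_top" and x0: "x0 \<ge> 0" "f x0 * f' x0 \<ge> 0"
  shows "f y = 0"
proof -
  have "f x0 * f' x0 \<le> f x * f' x" if "x \<ge> x0" for x
  proof (rule DERIV_nonneg_imp_nondecreasing[OF that])
    fix s assume s: "x0 \<le> s" "s \<le> x"
    have "((\<lambda>s. f s * f' s) has_real_derivative ((f' s)\<^sup>2 + s * (f s)\<^sup>2)) (at s)"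
      by (auto intro!: derivative_eq_intros airy_odeD[OF ode] simp: power2_eq_square algebra_simps)
    moreover have "(f' s)\<^sup>2 + s * (f s)\<^sup>2 \<ge> 0" using s x0 by simp
    ultimately show "\<exists>D. ((\<lambda>s. f s * f' s) has_real_derivative D) (at s) \<and> D \<ge> 0" by blast
  qed
  then have prod: "f x * f' x \<ge> 0" if "x \<ge> x0" for x using that x0 by fastforce
  have mono: "(f x)\<^sup>2 \<le> (f z)\<^sup>2" if "x \<ge> x0" "x \<le> z" for x z
  proof (rule DERIV_nonneg_imp_nondecreasing[OF that(2)])
    fix s assume s: "x \<le> s" "s \<le> z"
    have "((\<lambda>s. (f s)\<^sup>2) has_real_derivative (2 * (f s * f' s))) (at s)"
      by (auto intro!: derivative_eq_intros airy_odeD[OF ode] simp: power2_eq_square algebra_simps)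
    moreover have "2 * (f s * f' s) \<ge> 0" using prod[of s] s that by simp
    ultimately show "\<exists>D. ((\<lambda>s. (f s)\<^sup>2) has_real_derivative D) (at s) \<and> D \<ge> 0" by blast
  qed
  have lim2: "((\<lambda>x. (f x)\<^sup>2) \<longlongrightarrow> 0) at_top" using tendsto_power[OF lim, of 2] by simp
  have zero: "f x = 0" if "x \<ge> x0" for x
  proof -
    have "(f x)\<^sup>2 \<le> 0"
      by (rule tendsto_lowerbound[OF lim2])
        (use mono[OF that] in \<open>auto simp: eventually_at_top_linorder\<close>)
    then show ?thesis by simp
  qed
  have "f' (x0 + 1) = 0"
    by (rule DERIV_local_min[OF airy_odeD(1)[OF ode], of 1]) (auto simp: zero abs_if split: if_splits)
  with zero[of "x0 + 1"] show ?thesis using airy_ode_zero[OF ode] by simp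
qed

text \<open>With \<open>u\<close>, \<open>v\<close> the fundamental system at \<open>0\<close>, the decaying solution is \<open>u - c * v\<close> for
  \<open>c = lim (u / v)\<close>: as \<open>u / v\<close> decreases and \<open>u / v - 1 / (v * v')\<close> increases, it lies between
  \<open>0\<close> and \<open>1 / v'\<close>.\<close>

lemma decaying_solution_exists: "\<exists>f f'. airy_ode f f' \<and> (f \<longlongrightarrow> 0) at_top \<and> f 0 = 1"
proof -
  define u u' v v' where "u = airy_series 1 0" "u' = airy_series' 1 0"
    "v = airy_series 0 1" "v' = airy_series' 0 1"
  have ou: "airy_ode u u'" and ov: "airy_ode v v'"
    by (simp_all add: u_u'_v_v'_def airy_series_ode)
  have v: "v x \<ge> x" and u: "u x \<ge> 1" and v': "v' x \<ge> 1 + x ^ 3 / 3" if "x \<ge> 0" for x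
    using that airy_series_ge[of 0 1 x] airy_series_ge[of 1 0 x] airy_series'_ge[of x]
    by (simp_all add: u_u'_v_v'_def)
  have v'1: "v' x \<ge> 1" if "x \<ge> 0" for x using v'[OF that] zero_le_power[OF that, of 3] by linarith
  have wronski: "u x * v' x - u' x * v x = 1" for x
  proof -
    have "((\<lambda>x. u x * v' x - u' x * v x) has_real_derivative 0) (at x)" for x
      by (auto intro!: derivative_eq_intros airy_odeD[OF ou] airy_odeD[OF ov] simp: algebra_simps)
    then have "u x * v' x - u' x * v x = u 0 * v' 0 - u' 0 * v 0"
      by (metis (no_types, lifting) DERIV_isconst_all)
    then show ?thesis by (simp add: u_u'_v_v'_def airy_series_0)
  qed
  have dec: "u y / v y \<le> u x / v x" if "1 \<le> x" "x \<le> y" for x y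
  proof (rule DERIV_nonpos_imp_nonincreasing[OF that(2)])
    fix s assume s: "x \<le> s" "s \<le> y"
    then have vs: "v s > 0" using v[of s] that by simp
    have "((\<lambda>s. u s / v s) has_real_derivative (u' s * v s - u s * v' s) / (v s * v s)) (at s)"
      using vs by (auto intro!: derivative_eq_intros airy_odeD[OF ou] airy_odeD[OF ov])
    moreover have "(u' s * v s - u s * v' s) / (v s * v s) \<le> 0"
      using wronski[of s] vs by (intro divide_nonpos_pos) auto
    ultimately show "\<exists>D. ((\<lambda>s. u s / v s) has_real_derivative D) (at s) \<and> D \<le> 0" by blast
  qed
  have inc: "u x / v x - 1 / (v x * v' x) \<le> u y / v y - 1 / (v y * v' y)" if "1 \<le> x" "x \<le> y" for x y
  proof (rule DERIV_nonneg_imp_nondecreasing[OF that(2)])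
    fix s assume s: "x \<le> s" "s \<le> y"
    then have vs: "v s > 0" "v' s > 0" using v[of s] v'1[of s] that by auto
    let ?D = "(u' s * v s - u s * v' s) / (v s * v s)
        + (v' s * v' s + v s * (s * v s)) / ((v s * v' s) * (v s * v' s))"
    have "((\<lambda>s. u s / v s - 1 / (v s * v' s)) has_real_derivative ?D) (at s)"
      using vs by (auto intro!: derivative_eq_intros airy_odeD[OF ou] airy_odeD[OF ov] simp: algebra_simps)
        (simp add: add_divide_distrib[symmetric])
    \<comment> \<open>The Wronskian turns the first summand into -1/v^2, which cancels against the
      same term in the second.\<close>
    moreover have "?D = s / (v' s * v' s)"
    proof -
      have *: "u' s * v s - u s * v' s = - 1" using wronski[of s] by simp
      show ?thesis unfolding * using vs by (simp add: divide_simps)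
    qed
    moreover have "s / (v' s * v' s) \<ge> 0" using s that by simp
    ultimately show "\<exists>D. ((\<lambda>s. u s / v s - 1 / (v s * v' s)) has_real_derivative D) (at s) \<and> D \<ge> 0"
      by auto
  qed
  define c where "c = Inf ((\<lambda>x. u x / v x) ` {1..})"
  have pos: "u x / v x \<ge> 0" if "x \<ge> 1" for x
    using u[of x] v[of x] that by (intro divide_nonneg_nonneg) auto
  have lower: "c \<le> u x / v x" if "x \<ge> 1" for x
    unfolding c_def using that pos by (intro cInf_lower) (auto intro!: bdd_belowI[of _ 0])
  have upper: "u x / v x - 1 / (v x * v' x) \<le> c" if x: "x \<ge> 1" for x
    unfolding c_def
  proof (rule cInf_greatest)
    fix r assume "r \<in> (\<lambda>x. u x / v x) ` {1..}"
    then obtain y where y: "y \<ge> 1" "r = u y / v y" by auto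
    have p: "1 / (v z * v' z) \<ge> 0" if "z \<ge> 1" for z
      using v[of z] v'1[of z] that by (intro divide_nonneg_nonneg mult_nonneg_nonneg) auto
    show "u x / v x - 1 / (v x * v' x) \<le> r"
    proof (cases "x \<le> y")
      case True
      show ?thesis using inc[OF x True] p[OF y(1)] unfolding y(2) by linarith
    next
      case False
      then have "u x / v x \<le> u y / v y" using dec[of y x] y by simp
      then show ?thesis using p[OF x] unfolding y(2) by linarith
    qed
  qed auto
  define f where "f = (\<lambda>x. 1 * u x + (- c) * v x)"
  have ode: "airy_ode f (\<lambda>x. 1 * u' x + (- c) * v' x)"
    unfolding f_def by (rule airy_ode_linear[OF ou ov])
  have bounds: "0 \<le> f x \<and> f x \<le> 1 / (1 + x ^ 3 / 3)" if x: "x \<ge> 1" for x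
  proof
    have vx: "v x > 0" "v' x > 0" using v[of x] v'1[of x] x by auto
    show "0 \<le> f x" using lower[OF x] vx by (simp add: f_def field_simps)
    have "f x \<le> 1 / v' x" using upper[OF x] vx by (simp add: f_def field_simps)
    also have "\<dots> \<le> 1 / (1 + x ^ 3 / 3)"
      using v'[of x] vx x by (intro divide_left_mono mult_pos_pos) (auto intro: add_pos_nonneg)
    finally show "f x \<le> 1 / (1 + x ^ 3 / 3)" .
  qed
  have "((\<lambda>x::real. 1 / (1 + x ^ 3 / 3)) \<longlongrightarrow> 0) at_top"
    by real_asymp
  then have "(f \<longlongrightarrow> 0) at_top"
    by (rule tendsto_sandwich[rotated 2, OF tendsto_const])
      (use bounds in \<open>auto simp: eventually_at_top_linorder intro!: exI[of _ 1]\<close>)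
  moreover have "f 0 = 1" by (simp add: f_def u_u'_v_v'_def airy_series_0)
  ultimately show ?thesis using ode by blast
qed

text \<open>The difference of two candidates decays and vanishes at 0, hence is zero by
  \<open>decaying_solution_vanishes\<close>; scaling the solution found above gives existence, so
  the \<open>THE\<close> in \<open>airy_Ai\<close> denotes.\<close>

lemma airy_Ai_properties:
  "\<exists>f'. airy_ode airy_Ai f'" "(airy_Ai \<longlongrightarrow> 0) at_top" "airy_Ai 0 > 0"
proof -
  define C :: real where "C = 1 / (3 powr (2 / 3) * Gamma (2 / 3))"
  have C: "C > 0" by (simp add: C_def Gamma_real_pos)
  define P where "P = (\<lambda>f. (\<exists>f'. airy_ode f f') \<and> (f \<longlongrightarrow> 0) at_top \<and> f 0 = C)"
  obtain f f' where f: "airy_ode f f'" "(f \<longlongrightarrow> 0) at_top" "f 0 = 1"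
    using decaying_solution_exists by blast
  have ex: "P (\<lambda>x. C * f x)"
    unfolding P_def using airy_ode_linear[OF f(1) f(1), of C 0] tendsto_mult_right_zero[OF f(2)] f(3) by auto
  have uniq: "g = h" if Pg: "P g" and Ph: "P h" for g h
  proof
    fix x
    note gP = Pg[unfolded P_def] and hP = Ph[unfolded P_def]
    obtain g' h' where gh: "airy_ode g g'" "airy_ode h h'" using gP hP by blast
    let ?d = "\<lambda>x. 1 * g x + (- 1) * h x"
    have "airy_ode ?d (\<lambda>x. 1 * g' x + (- 1) * h' x)" by (rule airy_ode_linear[OF gh])
    moreover have "(?d \<longlongrightarrow> 0) at_top" using tendsto_diff[of g 0 at_top h 0] gP hP by simp
    ultimately have "?d x = 0"
      by (rule decaying_solution_vanishes[of _ _ 0]) (use gP hP in simp_all)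
    then show "g x = h x" by simp
  qed
  have "P (THE f. P f)" by (rule theI[of P, OF ex]) (rule uniq[OF _ ex])
  moreover have "airy_Ai = (THE f. P f)"
    unfolding airy_Ai_def P_def C_def airy_ode_def by (rule refl)
  ultimately have "P airy_Ai" by simp
  then show "\<exists>f'. airy_ode airy_Ai f'" "(airy_Ai \<longlongrightarrow> 0) at_top" "airy_Ai 0 > 0"
    using C unfolding P_def by auto
qed

definition airy_Ai' :: "real \<Rightarrow> real" where
  "airy_Ai' = (SOME f'. airy_ode airy_Ai f')"

lemma airy_Ai_ode: "airy_ode airy_Ai airy_Ai'"
  unfolding airy_Ai'_def using airy_Ai_properties(1) by (rule someI_ex)

lemmas airy_Ai_deriv = airy_odeD[OF airy_Ai_ode]

lemma continuous_airy: "continuous_on A airy_Ai" "continuous_on A airy_Ai'"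
  using airy_Ai_deriv by (auto intro!: continuous_at_imp_continuous_on DERIV_isCont)

lemma airy_Ai_prod_neg: "x \<ge> 0 \<Longrightarrow> airy_Ai x * airy_Ai' x < 0"
  using decaying_solution_vanishes[OF airy_Ai_ode airy_Ai_properties(2), of x 0] airy_Ai_properties(3)
  by force

lemma airy_Ai_pos_nonneg: assumes "x \<ge> 0" shows "airy_Ai x > 0"
proof (rule ccontr)
  assume "\<not> airy_Ai x > 0"
  then have "\<exists>y\<ge>0. y \<le> x \<and> airy_Ai y = 0"
    using IVT2'[of airy_Ai x 0 0] continuous_airy airy_Ai_properties(3) assms by auto
  then show False using airy_Ai_prod_neg by fastforce
qed

lemma airy_Ai'_neg_nonneg: "x \<ge> 0 \<Longrightarrow> airy_Ai' x < 0"
  using airy_Ai_prod_neg[of x] airy_Ai_pos_nonneg[of x] by (simp add: mult_less_0_iff)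

text \<open>Sturm comparison with \<open>sin\<close> on an interval where \<open>x \<le> - 1\<close>.\<close>

lemma airy_Ai_has_zero: "\<exists>x<0. airy_Ai x = 0"
proof (rule ccontr)
  assume no: "\<not> (\<exists>x<0. airy_Ai x = 0)"
  have pos: "airy_Ai x > 0" for x
  proof (rule ccontr)
    assume n: "\<not> airy_Ai x > 0"
    then have "x < 0" using airy_Ai_pos_nonneg[of x] by linarith
    then have "\<exists>y\<ge>x. y \<le> 0 \<and> airy_Ai y = 0"
      using IVT'[of airy_Ai x 0 0] continuous_airy airy_Ai_properties(3) n by auto
    then show False using no airy_Ai_properties(3) by (metis less_eq_real_def less_irrefl)
  qed
  \<comment> \<open>A positive arch of the sine vanishing at \<open>- 1 - pi\<close> and
    \<open>- 1\<close>. If \<open>airy_Ai\<close> had no zero, the Wronskian \<open>F\<close> would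
    be nonincreasing on this interval, yet negative at the left end and positive at the right
    one.\<close>
  define s where "s = (\<lambda>x::real. sin (x + 1 + pi))"
  define s' where "s' = (\<lambda>x::real. cos (x + 1 + pi))"
  define F where "F = (\<lambda>x. airy_Ai' x * s x - airy_Ai x * s' x)"
  have "F (- 1) \<le> F (- 1 - pi)"
  proof (rule DERIV_nonpos_imp_nonincreasing[where f = F])
    fix x assume x: "- 1 - pi \<le> x" "x \<le> - 1"
    have "(F has_real_derivative (x + 1) * (airy_Ai x * s x)) (at x)"
      unfolding F_def s_def s'_def
      by (auto intro!: derivative_eq_intros airy_Ai_deriv simp: algebra_simps)
    moreover have "s x \<ge> 0" unfolding s_def using x by (intro sin_ge_zero) auto
    then have "(x + 1) * (airy_Ai x * s x) \<le> 0"
      using x pos[of x] by (intro mult_nonpos_nonneg mult_nonneg_nonneg) auto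
    ultimately show "\<exists>D. (F has_real_derivative D) (at x) \<and> D \<le> 0" by blast
  qed simp
  moreover have "F (- 1) = airy_Ai (- 1)" "F (- 1 - pi) = - airy_Ai (- 1 - pi)"
    by (simp_all add: F_def s_def s'_def)
  ultimately show False using pos[of "-1"] pos[of "-1 - pi"] by simp
qed

text \<open>The zero set is nonempty, closed and bounded above by 0, so it contains its supremum and
  the \<open>GREATEST\<close> denotes. To the right of it a sign change would produce a larger
  zero.\<close>

lemma airy_a1:
  "airy_Ai airy_a1 = 0" "airy_a1 < 0" "x > airy_a1 \<Longrightarrow> airy_Ai x > 0"
proof -
  define Z where "Z = {x. airy_Ai x = 0}"
  have Zneg: "x < 0" if "x \<in> Z" for x
    using that airy_Ai_pos_nonneg[of x] by (force simp: Z_def)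
  have cl: "closed Z"
    unfolding Z_def using continuous_airy(1)[of UNIV] by (intro closed_Collect_eq) auto
  have ne: "Z \<noteq> {}" using airy_Ai_has_zero by (auto simp: Z_def)
  have bdd: "bdd_above Z" using Zneg by (intro bdd_aboveI[of _ 0]) (auto intro: less_imp_le)
  have SZ: "Sup Z \<in> Z" by (rule closed_contains_Sup[OF ne bdd cl])
  have le: "x \<le> Sup Z" if "x \<in> Z" for x using bdd that by (rule cSup_upper[rotated])
  have a: "airy_a1 = Sup Z"
    unfolding airy_a1_def by (rule Greatest_equality) (use SZ le in \<open>auto simp: Z_def\<close>)
  show "airy_Ai airy_a1 = 0" "airy_a1 < 0" using SZ Zneg a by (auto simp: Z_def)
  show "airy_Ai x > 0" if x: "x > airy_a1"
  proof (rule ccontr)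
    assume n: "\<not> airy_Ai x > 0"
    then have "x < 0" using airy_Ai_pos_nonneg[of x] by linarith
    then obtain y where "y \<ge> x" "airy_Ai y = 0"
      using IVT'[of airy_Ai x 0 0] continuous_airy airy_Ai_properties(3) n by auto
    then show False using le[of y] x a by (simp add: Z_def)
  qed
qed

text \<open>The zero is simple by uniqueness. The linear growth at the wall gives the barriers their
  size at \<open>M = 1\<close> and supplies the positive \<open>Ai'\<close> on which the margin near
  the wall rests.\<close>

lemma airy_Ai'_a1_pos: "airy_Ai' airy_a1 > 0"
proof (rule ccontr)
  assume n: "\<not> airy_Ai' airy_a1 > 0"
  have "airy_Ai' airy_a1 \<noteq> 0"
    using airy_ode_zero[OF airy_Ai_ode airy_a1(1), of 0] airy_Ai_properties(3) by auto
  with n have "airy_Ai' airy_a1 < 0" by simp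
  then obtain d where "d > 0" "\<And>h. h > 0 \<Longrightarrow> h < d \<Longrightarrow> airy_Ai (airy_a1 + h) < airy_Ai airy_a1"
    using DERIV_neg_dec_right[OF airy_Ai_deriv(1)] by blast
  then have "airy_Ai (airy_a1 + d / 2) < 0" using airy_a1(1) by fastforce
  then show False using airy_a1(3)[of "airy_a1 + d / 2"] \<open>d > 0\<close> by simp
qed

lemma airy_Ai_nonneg: "x \<ge> airy_a1 \<Longrightarrow> airy_Ai x \<ge> 0"
  using airy_a1(1) airy_a1(3)[of x] by (cases "x = airy_a1") auto

lemma airy_Ai_antimono: assumes "0 \<le> x" "x \<le> y" shows "airy_Ai y \<le> airy_Ai x"
proof (rule DERIV_nonpos_imp_nonincreasing[OF assms(2)])
  fix s assume "x \<le> s" "s \<le> y"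
  then have "airy_Ai' s \<le> 0" using airy_Ai'_neg_nonneg[of s] assms by simp
  then show "\<exists>D. (airy_Ai has_real_derivative D) (at s) \<and> D \<le> 0" using airy_Ai_deriv by blast
qed

text \<open>If \<open>w\<close> were negative at \<open>x0\<close>, then \<open>Ai + Ai'\<close>
  would be negative as long as \<open>w\<close> is, so \<open>w\<close> would keep decreasing. This
  forces \<open>Ai'\<close> below the negative constant \<open>w x0\<close> forever, and
  \<open>Ai\<close> would become nonpositive.\<close>

lemma airy_Ai'_ge: assumes "x0 \<ge> 0" shows "- airy_Ai' x0 \<le> (1 + x0) * airy_Ai x0"
proof (rule ccontr)
  define w where "w = (\<lambda>x. airy_Ai' x + (1 + x) * airy_Ai x)"
  assume "\<not> - airy_Ai' x0 \<le> (1 + x0) * airy_Ai x0"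
  then have w0: "w x0 < 0" by (simp add: w_def)
  have dw: "(w has_real_derivative (1 + x) * (airy_Ai x + airy_Ai' x)) (at x)" for x
    unfolding w_def by (auto intro!: derivative_eq_intros airy_Ai_deriv simp: algebra_simps)
  have w_le: "w x \<le> w x0" if "x \<ge> x0" for x
  proof (rule ccontr)
    assume n: "\<not> w x \<le> w x0"
    have cw: "continuous_on A w" for A
      using dw by (meson DERIV_isCont continuous_at_imp_continuous_on)
    define m where "m = (w x0 + min 0 (w x)) / 2"
    have m: "w x0 < m" "m < w x" "m < 0" using n w0 by (auto simp: m_def min_def field_simps)
    \<comment> \<open>Until \<open>w\<close> first reaches the level \<open>m < 0\<close>, its slope is nonpositive.\<close>
    define B where "B = {y \<in> {x0..x}. w y = m}"
    have "closed B"
      unfolding B_def using continuous_closed_preimage_constant[OF cw, of "{x0..x}" m] by simp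
    moreover have "B \<noteq> {}" using IVT'[of w x0 m x] m cw that by (auto simp: B_def)
    moreover have bb: "bdd_below B" by (intro bdd_belowI[of _ x0]) (auto simp: B_def)
    ultimately have IB: "Inf B \<in> B" by (intro closed_contains_Inf)
    define y where "y = Inf B"
    have y: "x0 \<le> y" "y \<le> x" "w y = m" using IB by (auto simp: B_def y_def)
    have below: "w s \<le> m" if s: "x0 \<le> s" "s \<le> y" for s
    proof (rule ccontr)
      assume "\<not> w s \<le> m"
      then obtain r where r: "x0 \<le> r" "r \<le> s" "w r = m"
        using IVT'[of w x0 m s] m cw s by auto
      then have "r \<in> B" using s y by (auto simp: B_def)
      then have "y \<le> r" unfolding y_def using bb by (rule cInf_lower)
      then have "s = r" using r s by simp
      with r \<open>\<not> w s \<le> m\<close> show False by simp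
    qed
    have "w y \<le> w x0"
    proof (rule DERIV_nonpos_imp_nonincreasing[OF y(1)])
      fix s assume s: "x0 \<le> s" "s \<le> y"
      have "w s < 0" using below[OF s] m by simp
      moreover have "airy_Ai s \<le> (1 + s) * airy_Ai s"
        using airy_Ai_pos_nonneg[of s] s assms by (simp add: algebra_simps)
      ultimately have "airy_Ai s + airy_Ai' s \<le> 0" by (simp add: w_def)
      then have "(1 + s) * (airy_Ai s + airy_Ai' s) \<le> 0"
        using s assms by (intro mult_nonneg_nonpos) auto
      then show "\<exists>D. (w has_real_derivative D) (at s) \<and> D \<le> 0" using dw by blast
    qed
    with m y show False by simp
  qed
  \<comment> \<open>Where the line of slope \<open>w x0\<close> through the value at
    \<open>x0\<close> meets zero.\<close>
  define y where "y = x0 - airy_Ai x0 / w x0"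
  have yx: "y \<ge> x0" using w0 airy_Ai_pos_nonneg[OF assms] by (simp add: y_def divide_nonneg_neg)
  have "airy_Ai y - w x0 * y \<le> airy_Ai x0 - w x0 * x0"
  proof (rule DERIV_nonpos_imp_nonincreasing[OF yx])
    fix s assume s: "x0 \<le> s" "s \<le> y"
    have "((\<lambda>s. airy_Ai s - w x0 * s) has_real_derivative (airy_Ai' s - w x0)) (at s)"
      by (auto intro!: derivative_eq_intros airy_Ai_deriv)
    moreover have "(1 + s) * airy_Ai s \<ge> 0" using s assms airy_Ai_pos_nonneg[of s] by simp
    then have "airy_Ai' s - w x0 \<le> 0" using w_le[OF s(1)] unfolding w_def by linarith
    ultimately show "\<exists>D. ((\<lambda>s. airy_Ai s - w x0 * s) has_real_derivative D) (at s) \<and> D \<le> 0" by blast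
  qed
  then have "airy_Ai y \<le> 0" using w0 by (simp add: y_def algebra_simps)
  then show False using airy_Ai_pos_nonneg[of y] yx assms by simp
qed

text \<open>Lets a multiple of \<open>Ai\<close> absorb a negative \<open>Ai'\<close> at the cost of
  one factor of the scaled height. Left of 0 the derivative decreases because x Ai is nonpositive
  there, so its value at 0 is the worst case.\<close>

lemma airy_Ai'_neg_bound:
  "\<exists>A>0. \<forall>x\<ge>airy_a1. airy_Ai' x < 0 \<longrightarrow> - airy_Ai' x \<le> A * (1 + (x - airy_a1)) * airy_Ai x"
proof -
  define A where "A = max 1 (- airy_Ai' 0 / airy_Ai 0)"
  have A: "A \<ge> 1" by (simp add: A_def)
  have "- airy_Ai' x \<le> A * (1 + (x - airy_a1)) * airy_Ai x" if x: "x \<ge> airy_a1" "airy_Ai' x < 0" for x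
  proof (cases "x \<ge> 0")
    case True
    have "- airy_Ai' x \<le> (1 + x) * airy_Ai x" by (rule airy_Ai'_ge[OF True])
    also have "1 + x \<le> 1 * (1 + (x - airy_a1))" using airy_a1(2) by simp
    also have "\<dots> \<le> A * (1 + (x - airy_a1))" using A x by (intro mult_right_mono) auto
    finally show ?thesis using airy_Ai_nonneg[OF x(1)] by (simp add: mult_right_mono)
  next
    case False
    have dec: "airy_Ai' z \<le> airy_Ai' y" if "x \<le> y" "y \<le> z" "z \<le> 0" for y z
    proof (rule DERIV_nonpos_imp_nonincreasing[OF that(2)])
      fix s assume s: "y \<le> s" "s \<le> z"
      have "s * airy_Ai s \<le> 0"
        using that s x airy_Ai_nonneg[of s] by (intro mult_nonpos_nonneg) auto
      then show "\<exists>D. (airy_Ai' has_real_derivative D) (at s) \<and> D \<le> 0" using airy_Ai_deriv by blast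
    qed
    have "airy_Ai 0 \<le> airy_Ai x"
    proof (rule DERIV_nonpos_imp_nonincreasing[where f = airy_Ai])
      fix s assume s: "x \<le> s" "s \<le> 0"
      have "airy_Ai' s \<le> 0" using dec[of x s] s x(2) by simp
      then show "\<exists>D. (airy_Ai has_real_derivative D) (at s) \<and> D \<le> 0" using airy_Ai_deriv by blast
    qed (use False in simp)
    have A0: "A \<ge> 0" using A by simp
    have "- airy_Ai' x \<le> - airy_Ai' 0" using dec[of x 0] False by simp
    also have "\<dots> = (- airy_Ai' 0 / airy_Ai 0) * airy_Ai 0" using airy_Ai_properties(3) by simp
    also have "\<dots> \<le> A * airy_Ai 0"
      using airy_Ai_properties(3) by (intro mult_right_mono) (auto simp: A_def)
    also have "\<dots> \<le> A * airy_Ai x" using \<open>airy_Ai 0 \<le> airy_Ai x\<close> A0 by (rule mult_left_mono)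
    also have "\<dots> \<le> A * (1 + (x - airy_a1)) * airy_Ai x"
      using A0 x airy_Ai_nonneg[OF x(1)] by (intro mult_right_mono) (auto simp: algebra_simps mult_left_mono)
    finally show ?thesis .
  qed
  with A show ?thesis by (intro exI[of _ A]) auto
qed

text \<open>For \<open>v = Ai + Ai'\<close> the derivative of \<open>v * exp (- s)\<close> is
  \<open>(s - 1) * Ai * exp (- s)\<close>. A positive value of \<open>v\<close> beyond 1 would
  therefore grow exponentially, although \<open>v\<close> lies below \<open>airy_Ai 0\<close>; so
  \<open>Ai * exp\<close> is nonincreasing there.\<close>

lemma airy_Ai_le_exp: "\<exists>C>0. \<forall>x\<ge>airy_a1. airy_Ai x \<le> C * exp (- (x - airy_a1))"
proof -
  have v: "airy_Ai x0 + airy_Ai' x0 \<le> 0" if x0: "x0 \<ge> 1" for x0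
  proof (rule ccontr)
    define v where "v = (\<lambda>x. airy_Ai x + airy_Ai' x)"
    assume "\<not> airy_Ai x0 + airy_Ai' x0 \<le> 0"
    then have v0: "v x0 > 0" by (simp add: v_def)
    \<comment> \<open>The linear lower bound for the exponential already lifts \<open>v\<close>
      above \<open>airy_Ai 0\<close> at this point.\<close>
    define x where "x = x0 + airy_Ai 0 / v x0"
    have xx: "x \<ge> x0" using v0 airy_Ai_properties(3) by (simp add: x_def)
    have "v x0 * exp (- x0) \<le> v x * exp (- x)"
    proof (rule DERIV_nonneg_imp_nondecreasing[OF xx])
      fix s assume s: "x0 \<le> s" "s \<le> x"
      have "((\<lambda>s. v s * exp (- s)) has_real_derivative ((s - 1) * airy_Ai s * exp (- s))) (at s)"
        unfolding v_def by (auto intro!: derivative_eq_intros airy_Ai_deriv simp: algebra_simps)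
      moreover have "(s - 1) * airy_Ai s * exp (- s) \<ge> 0"
        using s x0 airy_Ai_pos_nonneg[of s] by simp
      ultimately show "\<exists>D. ((\<lambda>s. v s * exp (- s)) has_real_derivative D) (at s) \<and> D \<ge> 0" by blast
    qed
    then have "v x0 * exp (- x0) * exp x \<le> v x * exp (- x) * exp x" by (rule mult_right_mono) simp
    then have "v x0 * exp (x - x0) \<le> v x" by (simp add: mult.assoc flip: exp_add)
    moreover have "v x0 * (1 + (x - x0)) \<le> v x0 * exp (x - x0)"
      using v0 by (intro mult_left_mono exp_ge_add_one_self) auto
    moreover have "v x0 * (1 + (x - x0)) = v x0 + airy_Ai 0"
      using v0 by (simp add: x_def field_simps)
    moreover have "v x < airy_Ai 0"
      using airy_Ai'_neg_nonneg[of x] airy_Ai_antimono[of 0 x] xx x0 by (simp add: v_def)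
    ultimately show False using v0 by linarith
  qed
  have dec: "airy_Ai x * exp x \<le> airy_Ai 1 * exp 1" if "x \<ge> 1" for x
  proof (rule DERIV_nonpos_imp_nonincreasing[OF that])
    fix s :: real assume s: "1 \<le> s" "s \<le> x"
    have "((\<lambda>s. airy_Ai s * exp s) has_real_derivative ((airy_Ai s + airy_Ai' s) * exp s)) (at s)"
      by (auto intro!: derivative_eq_intros airy_Ai_deriv simp: algebra_simps)
    moreover have "(airy_Ai s + airy_Ai' s) * exp s \<le> 0"
      using v[OF s(1)] by (intro mult_nonpos_nonneg) auto
    ultimately show "\<exists>D. ((\<lambda>s. airy_Ai s * exp s) has_real_derivative D) (at s) \<and> D \<le> 0" by blast
  qed
  have "continuous_on {airy_a1..1} (\<lambda>x. airy_Ai x * exp x)"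
    by (intro continuous_intros continuous_airy)
  then have "bdd_above ((\<lambda>x. airy_Ai x * exp x) ` {airy_a1..1})"
    by (intro compact_imp_bounded bounded_imp_bdd_above compact_continuous_image) auto
  then obtain M where M: "\<And>x. x \<in> {airy_a1..1} \<Longrightarrow> airy_Ai x * exp x \<le> M"
    unfolding bdd_above_def by blast
  define C where "C = (\<bar>M\<bar> + airy_Ai 1 * exp 1) * exp (- airy_a1)"
  have A1: "airy_Ai 1 * exp 1 > 0" using airy_Ai_pos_nonneg[of 1] by simp
  have "airy_Ai x \<le> C * exp (- (x - airy_a1))" if x: "x \<ge> airy_a1" for x
  proof -
    have "airy_Ai x * exp x \<le> \<bar>M\<bar> + airy_Ai 1 * exp 1"
      using M[of x] dec[of x] x A1 by (cases "x \<le> 1") auto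
    then have "airy_Ai x * exp x * exp (- x) \<le> (\<bar>M\<bar> + airy_Ai 1 * exp 1) * exp (- x)"
      by (rule mult_right_mono) simp
    then show ?thesis by (simp add: C_def mult.assoc flip: exp_add)
  qed
  moreover have "C > 0" using A1 by (simp add: C_def)
  ultimately show ?thesis by blast
qed

text \<open>The sum is the quantity in which the margin of \<open>Y\<close> is expressed. It is
  positive even at the wall, where only \<open>Ai'\<close> contributes, so compactness gives a
  uniform bound.\<close>

lemma airy_Ai_compact_lower:
  "\<exists>c>0. \<forall>x\<ge>airy_a1. x \<le> X \<longrightarrow> c \<le> airy_Ai x + max (airy_Ai' x) 0"
proof (cases "airy_a1 \<le> X")
  case True
  define F where "F = (\<lambda>x. airy_Ai x + max (airy_Ai' x) 0)"
  have "continuous_on {airy_a1..X} F"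
    unfolding F_def by (intro continuous_intros continuous_airy)
  then obtain x where x: "x \<in> {airy_a1..X}" "\<And>y. y \<in> {airy_a1..X} \<Longrightarrow> F x \<le> F y"
    using continuous_attains_inf[of "{airy_a1..X}" F] True by auto
  have "F x > 0"
  proof (cases "x = airy_a1")
    case True
    then show ?thesis using airy_a1(1) airy_Ai'_a1_pos by (simp add: F_def)
  next
    case False
    then show ?thesis using airy_a1(3)[of x] x by (simp add: F_def add_pos_nonneg)
  qed
  with x show ?thesis by (intro exI[of _ "F x"]) (auto simp: F_def)
qed (auto intro: exI[of _ 1])

text \<open>The equation reduces all derivatives to \<open>Ai\<close> and \<open>Ai'\<close>. The
  remainder must be relative to the values at \<open>x\<close>, since these are exponentially small
  far out; the hypothesis on \<open>h\<close> keeps the exponent in \<open>airy_energy_bound\<close>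
  below 1.\<close>

lemma airy_Ai_taylor:
  assumes h: "\<bar>h\<bar> * (2 + \<bar>x\<bar>) \<le> 1"
  shows "\<bar>airy_Ai (x + h) - (airy_Ai x * (1 + x * h\<^sup>2 / 2 + h ^ 3 / 6) + airy_Ai' x * (h + x * h ^ 3 / 6))\<bar>
    \<le> h ^ 4 * (1 + \<bar>x\<bar>)\<^sup>2 * (\<bar>airy_Ai x\<bar> + \<bar>airy_Ai' x\<bar>)"
proof (cases "h = 0")
  case False
  let ?f = airy_Ai and ?g = airy_Ai'
  define diff where "diff = (\<lambda>(m::nat) s. if m = 0 then ?f s else if m = 1 then ?g s else if m = 2 then s * ?f s
     else if m = 3 then ?f s + s * ?g s else 2 * ?g s + s\<^sup>2 * ?f s)"
  have d: "(diff m has_real_derivative diff (Suc m) s) (at s)" if m4: "m < 4" for m :: nat and s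
  proof -
    consider "m = 0" | "m = 1" | "m = 2" | "m = 3" using m4 by linarith
    then show ?thesis
      by cases (auto simp: diff_def power2_eq_square algebra_simps
          intro!: derivative_eq_intros airy_Ai_deriv)
  qed
  have h1: "\<bar>h\<bar> \<le> 1"
  proof -
    have "\<bar>h\<bar> * 1 \<le> \<bar>h\<bar> * (2 + \<bar>x\<bar>)" by (intro mult_left_mono) auto
    with h show ?thesis by simp
  qed
  have "\<exists>s. (if x + h < x then x + h < s \<and> s < x else x < s \<and> s < x + h) \<and>
      ?f (x + h) = (\<Sum>m<4. diff m x / fact m * (x + h - x) ^ m) + diff 4 s / fact 4 * (x + h - x) ^ 4"
    by (rule Taylor[where a = "x - \<bar>h\<bar>" and b = "x + \<bar>h\<bar>"]) (use False d in \<open>auto simp: diff_def\<close>)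
  then obtain s where s0: "if x + h < x then x + h < s \<and> s < x else x < s \<and> s < x + h"
    and eq: "?f (x + h) = (\<Sum>m<4. diff m x / fact m * h ^ m) + diff 4 s / fact 4 * h ^ 4"
    by auto
  have s: "\<bar>s - x\<bar> \<le> \<bar>h\<bar>" using s0 by (simp split: if_splits)
  have eq': "?f (x + h) - (?f x * (1 + x * h\<^sup>2 / 2 + h ^ 3 / 6) + ?g x * (h + x * h ^ 3 / 6)) =
      (2 * ?g s + s\<^sup>2 * ?f s) * h ^ 4 / 24"
    unfolding eq by (simp add: diff_def eval_nat_numeral field_simps)
  have sx: "\<bar>s\<bar> \<le> \<bar>x\<bar> + 1" using s h1 by linarith
  let ?A = "\<bar>?f s\<bar> + \<bar>?g s\<bar>" and ?B = "\<bar>?f x\<bar> + \<bar>?g x\<bar>"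
  have "(?f s)\<^sup>2 + (?g s)\<^sup>2 \<le> ((?f x)\<^sup>2 + (?g x)\<^sup>2) * exp ((2 + \<bar>x\<bar>) * \<bar>s - x\<bar>)"
  proof (rule airy_energy_bound[OF airy_Ai_ode])
    fix r assume "r \<in> closed_segment x s"
    then show "1 + \<bar>r\<bar> \<le> 2 + \<bar>x\<bar>"
      using sx by (auto simp: closed_segment_eq_real_ivl split: if_splits)
  qed
  also have "\<dots> \<le> ((?f x)\<^sup>2 + (?g x)\<^sup>2) * 3"
  proof (rule mult_left_mono)
    have "(2 + \<bar>x\<bar>) * \<bar>s - x\<bar> \<le> (2 + \<bar>x\<bar>) * \<bar>h\<bar>" using s by (intro mult_left_mono) auto
    also have "\<dots> \<le> 1" using h by (simp add: mult.commute)
    finally have "exp ((2 + \<bar>x\<bar>) * \<bar>s - x\<bar>) \<le> exp 1" by simp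
    also have "\<dots> \<le> 3" by (rule exp_le)
    finally show "exp ((2 + \<bar>x\<bar>) * \<bar>s - x\<bar>) \<le> 3" .
  qed simp
  also have "\<dots> \<le> ?B\<^sup>2 * 3"
    by (intro mult_right_mono) (auto simp: power2_sum)
  finally have "(?f s)\<^sup>2 + (?g s)\<^sup>2 \<le> ?B\<^sup>2 * 3" .
  moreover have "?A\<^sup>2 \<le> 2 * ((?f s)\<^sup>2 + (?g s)\<^sup>2)"
    using sum_squares_bound[of "\<bar>?f s\<bar>" "\<bar>?g s\<bar>"] by (simp add: power2_sum)
  moreover have "a \<le> 9 * c" if "b \<le> c * 3" "a \<le> 2 * b" "0 \<le> c" for a b c :: real
    using that by linarith
  ultimately have "?A\<^sup>2 \<le> 9 * ?B\<^sup>2" using zero_le_power2 by blast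
  also have "9 * ?B\<^sup>2 = (3 * ?B)\<^sup>2" unfolding power_mult_distrib by simp
  finally have "?A\<^sup>2 \<le> (3 * ?B)\<^sup>2" .
  then have AB: "?A \<le> 3 * ?B" by (rule power2_le_imp_le) simp
  have "\<bar>2 * ?g s + s\<^sup>2 * ?f s\<bar> \<le> (2 + s\<^sup>2) * ?A"
  proof -
    have "\<bar>2 * ?g s + s\<^sup>2 * ?f s\<bar> \<le> 2 * \<bar>?g s\<bar> + s\<^sup>2 * \<bar>?f s\<bar>"
      using abs_triangle_ineq[of "2 * ?g s" "s\<^sup>2 * ?f s"] by (simp add: abs_mult)
    also have "\<dots> \<le> (2 + s\<^sup>2) * \<bar>?g s\<bar> + (2 + s\<^sup>2) * \<bar>?f s\<bar>"
      by (intro add_mono mult_right_mono) auto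
    finally show ?thesis by (simp add: algebra_simps)
  qed
  also have "\<dots> \<le> (3 * (1 + \<bar>x\<bar>)\<^sup>2) * (3 * ?B)"
  proof (rule mult_mono[OF _ AB])
    have "s\<^sup>2 \<le> (1 + \<bar>x\<bar>)\<^sup>2" using sx by (intro power2_le_iff_abs_le[THEN iffD2]) auto
    moreover have "1 \<le> (1 + \<bar>x\<bar>)\<^sup>2" by (intro one_le_power) auto
    moreover have "2 + a \<le> 3 * b" if "a \<le> b" "1 \<le> b" for a b :: real using that by linarith
    ultimately show "2 + s\<^sup>2 \<le> 3 * (1 + \<bar>x\<bar>)\<^sup>2" by blast
  qed auto
  finally have "\<bar>2 * ?g s + s\<^sup>2 * ?f s\<bar> * (h ^ 4 / 24) \<le> (3 * (1 + \<bar>x\<bar>)\<^sup>2) * (3 * ?B) * (h ^ 4 / 24)"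
    by (rule mult_right_mono) simp
  also have "\<dots> = (9 / 24) * (h ^ 4 * (1 + \<bar>x\<bar>)\<^sup>2 * ?B)" by simp
  also have "\<dots> \<le> 1 * (h ^ 4 * (1 + \<bar>x\<bar>)\<^sup>2 * ?B)" by (intro mult_right_mono) auto
  finally show ?thesis unfolding eq' by (simp add: abs_mult)
qed simp

section \<open>Expansions in powers of the scale\<close>

text \<open>Twelfth roots make every order in the proof an integer power, including the 13 of the
  summable perturbation.\<close>

definition tt :: "real \<Rightarrow> real" where "tt n = n powr (- 1 / 12)"

lemma tt_pos: "n \<ge> 1 \<Longrightarrow> tt n > 0" by (simp add: tt_def)

lemma tt_le_1: "n \<ge> 1 \<Longrightarrow> tt n \<le> 1"
  unfolding tt_def using powr_mono[of "- 1 / 12" 0 n] by simp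

lemma tt_power: "n \<ge> 1 \<Longrightarrow> tt n ^ j = n powr (- real j / 12)"
proof -
  assume n: "n \<ge> 1"
  have "tt n ^ j = tt n powr real j" using tt_pos[OF n] by (simp add: powr_realpow)
  then show ?thesis by (simp add: tt_def powr_powr mult.commute)
qed

lemma tt_power_12: "n \<ge> 1 \<Longrightarrow> tt n ^ 12 = 1 / n"
  by (simp add: tt_power powr_minus_divide)

lemma tt_tendsto_0: "(tt \<longlongrightarrow> 0) at_top"
  unfolding tt_def by real_asymp

locale barrier =
  fixes K :: real
  assumes K: "K \<ge> 2"
begin

text \<open>\<open>2 * kap\<close> is the variance of the walk, and \<open>bb n\<close> solves \<open>kap * b\<^sup>3 = 1 / n\<close>: on this scale
  killing and diffusion balance. Heights enter through \<open>M = m + 1\<close>, so that the wall is at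
  \<open>M = 0\<close>.\<close>

definition kap :: real where "kap = (K - 1) / 2"
definition bet :: real where "bet = kap powr (- 1 / 3)"
definition bb :: "real \<Rightarrow> real" where "bb n = bet * tt n ^ 4"
definition zz :: "real \<Rightarrow> real \<Rightarrow> real" where "zz n M = bb n * M"

lemma kap_pos: "kap > 0" using K by (simp add: kap_def)

lemma bet_pos: "bet > 0" using kap_pos by (simp add: bet_def)

lemma bet_cube: "kap * bet ^ 3 = 1"
proof -
  have "bet ^ 3 = bet powr 3" using bet_pos by (simp add: powr_numeral)
  also have "\<dots> = kap powr (- 1)" unfolding bet_def powr_powr by simp
  also have "\<dots> = 1 / kap" using kap_pos by (simp add: powr_minus_divide)
  finally show ?thesis using kap_pos by simp
qed

lemma bb_pos: "n \<ge> 1 \<Longrightarrow> bb n > 0"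
  using bet_pos tt_pos[of n] by (simp add: bb_def)

lemma bb_cube: "n \<ge> 1 \<Longrightarrow> kap * bb n ^ 3 = 1 / n"
proof -
  assume n: "n \<ge> 1"
  have "kap * bb n ^ 3 = (kap * bet ^ 3) * tt n ^ 12"
    unfolding bb_def power_mult_distrib power_mult[symmetric] by simp
  then show ?thesis unfolding bet_cube tt_power_12[OF n] by simp
qed

lemma zz_nonneg: "n \<ge> 1 \<Longrightarrow> M \<ge> 0 \<Longrightarrow> zz n M \<ge> 0"
  using bb_pos[of n] by (simp add: zz_def)

text \<open>The functions of order \<open>t\<^sup>j\<close> for \<open>t = n\<^bsup>-1/12\<^esup>\<close>, up to powers of the scaled height \<open>z\<close>.\<close>

definition big :: "nat \<Rightarrow> (real \<Rightarrow> real \<Rightarrow> real) \<Rightarrow> bool" where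
  "big j f \<longleftrightarrow> (\<exists>C p n0. C \<ge> 0 \<and> n0 \<ge> 1 \<and> (\<forall>n\<ge>n0. \<forall>M\<ge>1. zz n M \<le> 1 / tt n \<longrightarrow>
     \<bar>f n M\<bar> \<le> C * tt n ^ j * (1 + zz n M) ^ p))"

lemma bigI:
  assumes "\<And>n M. n \<ge> n0 \<Longrightarrow> n \<ge> 1 \<Longrightarrow> M \<ge> 1 \<Longrightarrow> zz n M \<le> 1 / tt n \<Longrightarrow>
    \<bar>f n M\<bar> \<le> C * tt n ^ j * (1 + zz n M) ^ p"
  shows "big j f"
  unfolding big_def
proof (rule exI[of _ "\<bar>C\<bar>"], rule exI[of _ p], rule exI[of _ "max 1 n0"], intro conjI allI impI)
  fix n M assume *: "n \<ge> max 1 n0" "M \<ge> 1" "zz n M \<le> 1 / tt n"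
  then have "\<bar>f n M\<bar> \<le> C * (tt n ^ j * (1 + zz n M) ^ p)"
    using assms[of n M] by (simp add: mult.assoc)
  also have "\<dots> \<le> \<bar>C\<bar> * (tt n ^ j * (1 + zz n M) ^ p)"
    using * tt_pos[of n] zz_nonneg[of n M] by (intro mult_right_mono) auto
  finally show "\<bar>f n M\<bar> \<le> \<bar>C\<bar> * tt n ^ j * (1 + zz n M) ^ p" by (simp add: mult.assoc)
qed auto

lemma bigE:
  assumes "big j f"
  obtains C p n0 where "C \<ge> 0" "n0 \<ge> 1"
    "\<And>n M. n \<ge> n0 \<Longrightarrow> M \<ge> 1 \<Longrightarrow> zz n M \<le> 1 / tt n \<Longrightarrow> \<bar>f n M\<bar> \<le> C * tt n ^ j * (1 + zz n M) ^ p"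
  using assms unfolding big_def by blast

lemma big_cong:
  assumes "big j g" "\<And>n M. n \<ge> 2 \<Longrightarrow> M \<ge> 1 \<Longrightarrow> f n M = g n M"
  shows "big j f"
proof -
  obtain C p n0 where *: "\<And>n M. n \<ge> n0 \<Longrightarrow> M \<ge> 1 \<Longrightarrow> zz n M \<le> 1 / tt n \<Longrightarrow>
      \<bar>g n M\<bar> \<le> C * tt n ^ j * (1 + zz n M) ^ p"
    using bigE[OF assms(1)] by metis
  show ?thesis by (rule bigI[of "max 2 n0" f C j p]) (use * assms(2) in auto)
qed

lemma big_mono:
  assumes "big i f" "j \<le> i" shows "big j f"
proof -
  obtain C p n0 where *: "C \<ge> 0" "\<And>n M. n \<ge> n0 \<Longrightarrow> M \<ge> 1 \<Longrightarrow> zz n M \<le> 1 / tt n \<Longrightarrow>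
      \<bar>f n M\<bar> \<le> C * tt n ^ i * (1 + zz n M) ^ p"
    using bigE[OF assms(1)] by metis
  show ?thesis
  proof (rule bigI[of n0 f C j p])
    fix n M assume n: "n \<ge> n0" "n \<ge> 1" "M \<ge> 1" "zz n M \<le> 1 / tt n"
    have "\<bar>f n M\<bar> \<le> C * tt n ^ i * (1 + zz n M) ^ p" using * n by simp
    also have "\<dots> \<le> C * tt n ^ j * (1 + zz n M) ^ p"
      using *(1) n assms(2) tt_pos[of n] tt_le_1[of n] zz_nonneg[of n M]
      by (intro mult_right_mono mult_left_mono power_decreasing) auto
    finally show "\<bar>f n M\<bar> \<le> C * tt n ^ j * (1 + zz n M) ^ p" .
  qed
qed

lemma big_mult:
  assumes "big i f" "big j g" shows "big (i + j) (\<lambda>n M. f n M * g n M)"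
proof -
  obtain C p n0 where *: "C \<ge> 0" "\<And>n M. n \<ge> n0 \<Longrightarrow> M \<ge> 1 \<Longrightarrow> zz n M \<le> 1 / tt n \<Longrightarrow>
      \<bar>f n M\<bar> \<le> C * tt n ^ i * (1 + zz n M) ^ p"
    using bigE[OF assms(1)] by metis
  obtain C' p' n0' where **: "C' \<ge> 0" "\<And>n M. n \<ge> n0' \<Longrightarrow> M \<ge> 1 \<Longrightarrow> zz n M \<le> 1 / tt n \<Longrightarrow>
      \<bar>g n M\<bar> \<le> C' * tt n ^ j * (1 + zz n M) ^ p'"
    using bigE[OF assms(2)] by metis
  show ?thesis
  proof (rule bigI[of "max n0 n0'" _ "C * C'" "i + j" "p + p'"])
    fix n M assume n: "n \<ge> max n0 n0'" "n \<ge> 1" "M \<ge> 1" "zz n M \<le> 1 / tt n"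
    have "\<bar>f n M\<bar> * \<bar>g n M\<bar> \<le> (C * tt n ^ i * (1 + zz n M) ^ p) * (C' * tt n ^ j * (1 + zz n M) ^ p')"
      using *(2)[of n M] **(2)[of n M] n by (intro mult_mono) (auto intro: order.trans[OF abs_ge_zero])
    then show "\<bar>f n M * g n M\<bar> \<le> C * C' * tt n ^ (i + j) * (1 + zz n M) ^ (p + p')"
      by (simp add: abs_mult power_add mult_ac)
  qed
qed

lemma big_add:
  assumes "big i f" "big j g" shows "big (min i j) (\<lambda>n M. f n M + g n M)"
proof -
  have f: "big (min i j) f" and g: "big (min i j) g"
    using assms big_mono by (metis min.cobounded1, metis min.cobounded2)
  obtain C p n0 where *: "C \<ge> 0" "\<And>n M. n \<ge> n0 \<Longrightarrow> M \<ge> 1 \<Longrightarrow> zz n M \<le> 1 / tt n \<Longrightarrow>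
      \<bar>f n M\<bar> \<le> C * tt n ^ min i j * (1 + zz n M) ^ p"
    using bigE[OF f] by metis
  obtain C' p' n0' where **: "C' \<ge> 0" "\<And>n M. n \<ge> n0' \<Longrightarrow> M \<ge> 1 \<Longrightarrow> zz n M \<le> 1 / tt n \<Longrightarrow>
      \<bar>g n M\<bar> \<le> C' * tt n ^ min i j * (1 + zz n M) ^ p'"
    using bigE[OF g] by metis
  show ?thesis
  proof (rule bigI[of "max n0 n0'" _ "C + C'" "min i j" "p + p'"])
    fix n M assume n: "n \<ge> max n0 n0'" "n \<ge> 1" "M \<ge> 1" "zz n M \<le> 1 / tt n"
    let ?t = "tt n ^ min i j" and ?z = "1 + zz n M"
    have z: "?z \<ge> 1" and t: "?t \<ge> 0" using n zz_nonneg[of n M] tt_pos[of n] by auto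
    have "\<bar>f n M\<bar> \<le> C * ?t * ?z ^ p" using * n by simp
    also have "\<dots> \<le> C * ?t * ?z ^ (p + p')"
      using z t *(1) by (intro mult_left_mono power_increasing) auto
    finally have 1: "\<bar>f n M\<bar> \<le> C * ?t * ?z ^ (p + p')" .
    have "\<bar>g n M\<bar> \<le> C' * ?t * ?z ^ p'" using ** n by simp
    also have "\<dots> \<le> C' * ?t * ?z ^ (p + p')"
      using z t **(1) by (intro mult_left_mono power_increasing) auto
    finally have 2: "\<bar>g n M\<bar> \<le> C' * ?t * ?z ^ (p + p')" .
    have "\<bar>f n M + g n M\<bar> \<le> C * ?t * ?z ^ (p + p') + C' * ?t * ?z ^ (p + p')"
      using 1 2 abs_triangle_ineq[of "f n M" "g n M"] by linarith
    then show "\<bar>f n M + g n M\<bar> \<le> (C + C') * ?t * ?z ^ (p + p')" by (simp add: algebra_simps)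
  qed
qed

lemma big_const: "big 0 (\<lambda>n M. c)"
  by (rule bigI[of 1 _ "\<bar>c\<bar>" _ 0]) auto

lemma big_minus: "big i f \<Longrightarrow> big i (\<lambda>n M. - f n M)"
  using big_mult[OF big_const[of "-1"], of i f] by simp

lemma big_diff: "big i f \<Longrightarrow> big j g \<Longrightarrow> big (min i j) (\<lambda>n M. f n M - g n M)"
  using big_add[OF _ big_minus, of i f j g] by simp

lemma big_divide: "big i f \<Longrightarrow> big i (\<lambda>n M. f n M / c)"
  using big_mult[OF _ big_const[of "inverse c"], of i f] by (simp add: divide_inverse)

lemma big_abs: "big i f \<Longrightarrow> big i (\<lambda>n M. \<bar>f n M\<bar>)"
  unfolding big_def by simp

lemma big_power: "big i f \<Longrightarrow> big (p * i) (\<lambda>n M. f n M ^ p)"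
proof (induction p)
  case 0
  then show ?case using big_const[of 1] by simp
next
  case (Suc p)
  then show ?case using big_mult[of i f "p * i" "\<lambda>n M. f n M ^ p"] by simp
qed

lemma big_zz: "big 0 (\<lambda>n M. zz n M)"
  by (rule bigI[of 1 _ 1 0 1]) (use zz_nonneg in auto)

lemma big_seq:
  assumes "f \<in> O[at_top](\<lambda>n. n powr (- real j / 12))" shows "big j (\<lambda>n M. f n)"
proof -
  obtain C where "eventually (\<lambda>n. norm (f n) \<le> C * norm (n powr (- real j / 12))) at_top"
    using landau_o.bigE[OF assms] by metis
  then obtain n0 where n0: "\<And>n. n \<ge> n0 \<Longrightarrow> norm (f n) \<le> C * norm (n powr (- real j / 12))"
    by (auto simp: eventually_at_top_linorder)
  show ?thesis
    by (rule bigI[of n0 _ C j 0]) (use n0 in \<open>auto simp: tt_power\<close>)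
qed

lemma big_tt: "big 1 (\<lambda>n M. tt n)"
  by (rule big_seq) (simp add: tt_def [abs_def])

lemma big_bb: "big 4 (\<lambda>n M. bb n)"
  unfolding bb_def using big_mult[OF big_const big_power[OF big_tt, of 4]] by simp

lemmas big_intros = big_zz big_tt big_bb big_const big_mult big_add big_diff big_minus big_divide
  big_abs big_power

text \<open>For \<open>q \<ge> 2 * p + 1\<close> the factor \<open>(1 + z) ^ p\<close> costs at most
  half a power of \<open>t\<close> in this zone, so the spare power of \<open>t\<close> still tends
  to 0 after paying for it. Any larger \<open>q\<close> works too, so finitely many errors can share
  one zone.\<close>

lemma big_small:
  assumes "big (Suc j) f"
  shows "\<exists>q0. \<forall>q\<ge>q0. \<forall>\<delta>>0. \<forall>\<^sub>F n in at_top. \<forall>M\<ge>1. (1 + zz n M) ^ q \<le> 1 / tt n \<longrightarrow> \<bar>f n M\<bar> \<le> \<delta> * tt n ^ j"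
proof -
  obtain C p n0 where *: "C \<ge> 0" "n0 \<ge> 1" "\<And>n M. n \<ge> n0 \<Longrightarrow> M \<ge> 1 \<Longrightarrow> zz n M \<le> 1 / tt n \<Longrightarrow>
      \<bar>f n M\<bar> \<le> C * tt n ^ Suc j * (1 + zz n M) ^ p"
    using bigE[OF assms] by metis
  have "\<forall>\<^sub>F n in at_top. \<forall>M\<ge>1. (1 + zz n M) ^ q \<le> 1 / tt n \<longrightarrow> \<bar>f n M\<bar> \<le> \<delta> * tt n ^ j"
    if q: "q \<ge> 2 * p + 1" and \<delta>: "\<delta> > 0" for q \<delta>
  proof -
    have "((\<lambda>n. C\<^sup>2 * tt n) \<longlongrightarrow> C\<^sup>2 * 0) at_top"
      by (intro tendsto_intros tt_tendsto_0)
    then have "\<forall>\<^sub>F n in at_top. C\<^sup>2 * tt n < \<delta>\<^sup>2"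
      using \<delta> by (intro order_tendstoD(2)) auto
    then show ?thesis using eventually_ge_at_top[of n0]
    proof eventually_elim
      case (elim n)
      show ?case
      proof (intro allI impI)
        fix M assume M: "M \<ge> 1" "(1 + zz n M) ^ q \<le> 1 / tt n"
        have n1: "n \<ge> 1" using elim *(2) by simp
        let ?z = "1 + zz n M"
        have z: "?z \<ge> 1" using zz_nonneg[OF n1, of M] M by simp
        have t: "tt n > 0" using tt_pos n1 .
        have "?z ^ 1 \<le> ?z ^ q" using z q by (intro power_increasing) auto
        then have "zz n M \<le> 1 / tt n" using M(2) by simp
        then have f: "\<bar>f n M\<bar> \<le> (C * tt n * ?z ^ p) * tt n ^ j" using *(3)[of n M] elim M by (simp add: mult_ac)
        have "?z ^ (2 * p) \<le> ?z ^ q" using z q by (intro power_increasing) auto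
        then have "?z ^ (2 * p) \<le> 1 / tt n" using M(2) by simp
        then have "C\<^sup>2 * (tt n)\<^sup>2 * ?z ^ (2 * p) \<le> C\<^sup>2 * (tt n)\<^sup>2 * (1 / tt n)"
          by (intro mult_left_mono) auto
        also have "\<dots> = C\<^sup>2 * tt n" using t by (simp add: power2_eq_square)
        also have "\<dots> \<le> \<delta>\<^sup>2" using elim by simp
        finally have "(C * tt n * ?z ^ p)\<^sup>2 \<le> \<delta>\<^sup>2"
          by (simp add: power_mult_distrib mult.commute flip: power_mult)
        then have "C * tt n * ?z ^ p \<le> \<delta>" by (rule power2_le_imp_le) (use \<delta> in simp)
        then have "(C * tt n * ?z ^ p) * tt n ^ j \<le> \<delta> * tt n ^ j"
          using t by (intro mult_right_mono) auto
        with f show "\<bar>f n M\<bar> \<le> \<delta> * tt n ^ j" by linarith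
      qed
    qed
  qed
  then show ?thesis by blast
qed

section \<open>Moments of one step of the walk in scaled coordinates\<close>

definition tau :: "real \<Rightarrow> real" where "tau n = bb (n - 1) / bb n - 1"

lemma tau_eq: "n \<ge> 2 \<Longrightarrow> tau n = (n / (n - 1)) powr (1 / 3) - 1"
proof -
  assume n: "n \<ge> 2"
  have "bb (n - 1) / bb n = tt (n - 1) ^ 4 / tt n ^ 4" using bet_pos by (simp add: bb_def)
  also have "\<dots> = (n - 1) powr (- 1 / 3) / n powr (- 1 / 3)" using n by (simp add: tt_power)
  also have "\<dots> = (n / (n - 1)) powr (1 / 3)"
    using n by (simp add: powr_minus_divide powr_divide)
  finally show ?thesis by (simp add: tau_def)
qed

lemma bb_pred: "n \<ge> 2 \<Longrightarrow> bb (n - 1) = bb n * (1 + tau n)"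
  using bb_pos[of n] by (simp add: tau_def)

text \<open>Going one time unit back enlarges the scale by the relative amount 1/(3n), and
  \<open>1 / n\<close> is \<open>kap * bb n ^ 3\<close>.\<close>

lemma big_tau_err: "big 16 (\<lambda>n M. tau n - kap * bb n ^ 3 / 3)"
proof -
  have "(\<lambda>n::real. (n / (n - 1)) powr (1 / 3) - 1 - 1 / n / 3) \<in> O[at_top](\<lambda>n. n powr (- 16 / 12))"
    by real_asymp
  then have "big 16 (\<lambda>n M. (n / (n - 1)) powr (1 / 3) - 1 - 1 / n / 3)" by (intro big_seq) simp
  then show ?thesis by (rule big_cong) (simp add: tau_eq bb_cube)
qed

lemma big_tau: "big 12 (\<lambda>n M. tau n)"
proof -
  have "big 12 (\<lambda>n M. (tau n - kap * bb n ^ 3 / 3) + kap * bb n ^ 3 / 3)"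
    by (rule big_mono, (rule big_tau_err big_intros)+, simp)
  then show ?thesis by simp
qed

lemma big_t7: "big 16 (\<lambda>n M. tt (n - 1) ^ 7 - tt n ^ 7)"
proof -
  have "(\<lambda>n::real. (n - 1) powr (- 7 / 12) - n powr (- 7 / 12)) \<in> O[at_top](\<lambda>n. n powr (- 16 / 12))"
    by real_asymp
  then have "big 16 (\<lambda>n M. (n - 1) powr (- 7 / 12) - n powr (- 7 / 12))" by (intro big_seq) simp
  then show ?thesis by (rule big_cong) (simp add: tt_power)
qed

text \<open>The weight of the step from height \<open>M - 1\<close> to \<open>M\<close> at time \<open>n\<close>; the step from \<open>M + K - 1\<close>
  to \<open>M\<close> has weight \<open>1 / K\<close>.\<close>

definition w1 :: "real \<Rightarrow> real \<Rightarrow> real" where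
  "w1 n M = (K - 1) / K * ((n - (M - 1) + K) / (n + (M - 1) / (K - 1)))"

text \<open>The error of \<open>w1\<close> after linearising in \<open>(M - 1) / n\<close> and
  \<open>1 / n\<close>; by \<open>height_scaled\<close> the first of these is the killing rate in
  scaled form.\<close>

definition rw :: "real \<Rightarrow> real \<Rightarrow> real" where
  "rw n M = w1 n M - ((K - 1) / K - kap * (bb n ^ 2 * zz n M - bb n ^ 3) + (K - 1) * (kap * bb n ^ 3))"

lemma height_scaled: "n \<ge> 1 \<Longrightarrow> (M - 1) / n = kap * (bb n ^ 2 * zz n M - bb n ^ 3)"
proof -
  assume n: "n \<ge> 1"
  have "(M - 1) / n = (M - 1) * (kap * bb n ^ 3)" using bb_cube[OF n] by simp
  then show ?thesis by (simp add: zz_def algebra_simps power2_eq_square power3_eq_cube)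
qed

text \<open>The linearisation error is an explicit fraction: quadratic terms \<open>u * u\<close>
  and \<open>u * v\<close> of orders 16 and 20, over a denominator that is at least 1.\<close>

lemma big_rw: "big 16 rw"
proof -
  define u where "u = (\<lambda>n M. kap * (bb n ^ 2 * zz n M - bb n ^ 3))"
  define v where "v = (\<lambda>n (M::real). kap * bb n ^ 3)"
  define r where "r = (\<lambda>n M. (K - 1) / K * (K / (K - 1) ^ 2 * (u n M * u n M) - K / (K - 1) * (u n M * v n M)))"
  have u: "big 8 u" unfolding u_def by (rule big_mono, (rule big_intros)+, simp)
  have v: "big 12 v" unfolding v_def by (rule big_mono, (rule big_intros)+, simp)
  have r: "big 16 r" unfolding r_def by (rule big_mono, (rule u v big_intros)+, simp)
  have inv: "big 0 (\<lambda>n M. 1 / (1 + ((M - 1) / n) / (K - 1)))"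
    by (rule bigI[of 1 _ 1 0 0]) (use K in \<open>auto simp: divide_le_eq_1\<close>)
  have "big 16 (\<lambda>n M. r n M * (1 / (1 + ((M - 1) / n) / (K - 1))))"
    by (rule big_mono, (rule r inv big_intros)+, simp)
  then show ?thesis
  proof (rule big_cong)
    fix n M :: real assume n: "n \<ge> 2" and M: "M \<ge> 1"
    have u': "u n M = (M - 1) / n" and v': "v n M = 1 / n"
      using height_scaled[of n M] bb_cube[of n] n by (auto simp: u_def v_def)
    define m where "m = M - 1"
    have m: "m \<ge> 0" using M by (simp add: m_def)
    have D: "1 + m / n / (K - 1) > 0" using m n K by (intro add_pos_nonneg) auto
    have w: "w1 n M = (K - 1) / K * ((1 - m / n + K * (1 / n)) / (1 + m / n / (K - 1)))"
    proof -
      have "(1 - m / n + K * (1 / n)) / (1 + m / n / (K - 1)) =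
          (n * (1 - m / n + K * (1 / n))) / (n * (1 + m / n / (K - 1)))"
        using n by simp
      also have "n * (1 - m / n + K * (1 / n)) = n - m + K" using n by (simp add: field_simps)
      also have "n * (1 + m / n / (K - 1)) = n + m / (K - 1)" using n by (simp add: distrib_left)
      finally show ?thesis by (simp add: w1_def m_def)
    qed
    have key: "(1 - a + K * b) / (1 + a / (K - 1)) - (1 - K / (K - 1) * a + K * b)
        = (K / (K - 1) ^ 2 * (a * a) - K / (K - 1) * (a * b)) / (1 + a / (K - 1))"
      if D: "1 + a / (K - 1) > 0" for a b
    proof -
      have "(1 - a + (L + 1) * b) - (1 - (L + 1) / L * a + (L + 1) * b) * (1 + a / L)
          = (L + 1) / L ^ 2 * (a * a) - (L + 1) / L * (a * b)" if "L > 0" for L :: real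
        using that by (simp add: field_simps power2_eq_square)
      from this[of "K - 1"] K have "(1 - a + K * b) - (1 - K / (K - 1) * a + K * b) * (1 + a / (K - 1))
          = K / (K - 1) ^ 2 * (a * a) - K / (K - 1) * (a * b)" by simp
      moreover have "x / d - y = r / d" if "x - y * d = r" "d > 0" for x y d r :: real
        using that by (auto simp: diff_divide_distrib)
      ultimately show ?thesis using D by blast
    qed
    have "rw n M = (K - 1) / K * ((1 - m / n + K * (1 / n)) / (1 + m / n / (K - 1)))
        - (K - 1) / K * (1 - K / (K - 1) * (m / n) + K * (1 / n))"
    proof -
      have "(L / (L + 1)) * (1 - (L + 1) / L * a + (L + 1) * b) = L / (L + 1) - a + L * b"
        if L: "L > 0" for L a b :: real
      proof -
        have "L / (L + 1) * ((L + 1) / L * a) = a" "L / (L + 1) * ((L + 1) * b) = L * b"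
          using L by (simp_all add: divide_simps)
        then show ?thesis by (simp only: distrib_left right_diff_distrib mult_1_right)
      qed
      from this[of "K - 1"] K have
        "(K - 1) / K * (1 - K / (K - 1) * a + K * b) = (K - 1) / K - a + (K - 1) * b" for a b
        by simp
      then have "(K - 1) / K * (1 - K / (K - 1) * (m / n) + K * (1 / n)) = (K - 1) / K - u n M + (K - 1) * v n M"
        using u' v' by (simp only: m_def)
      then show ?thesis unfolding w[symmetric] by (simp add: rw_def u_def v_def)
    qed
    also have "\<dots> = (K - 1) / K * ((K / (K - 1) ^ 2 * (m / n * (m / n)) - K / (K - 1) * (m / n * (1 / n)))
        / (1 + m / n / (K - 1)))"
      unfolding key[OF D, symmetric] by (simp only: right_diff_distrib)
    finally show "rw n M = r n M * (1 / (1 + ((M - 1) / n) / (K - 1)))"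
      by (simp add: r_def u' v' m_def mult_ac)
  qed
qed

text \<open>The change of the scaled height from \<open>M\<close> at time \<open>n\<close> to
  \<open>M + j\<close> at time \<open>n - 1\<close>; the part with \<open>tau\<close> is due to the
  changing scale.\<close>

definition hj :: "real \<Rightarrow> real \<Rightarrow> real \<Rightarrow> real" where
  "hj j n M = j * bb n + tau n * (zz n M + j * bb n)"

lemma hj_eq: "n \<ge> 2 \<Longrightarrow> bb (n - 1) * (M + j) = zz n M + hj j n M"
  by (simp add: hj_def bb_pred zz_def algebra_simps)

lemma big_hj: "big 4 (hj j)"
  unfolding hj_def by (rule big_mono, (rule big_tau big_intros)+, simp)

lemma big_hj2: "big 16 (\<lambda>n M. hj j n M ^ 2 - j ^ 2 * bb n ^ 2)"
proof -
  have "big 16 (\<lambda>n M. tau n * (zz n M + j * bb n) * (tau n * (zz n M + j * bb n) + 2 * j * bb n))"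
    by (rule big_mono, (rule big_tau big_intros)+, simp)
  then show ?thesis by (rule big_cong) (simp add: hj_def algebra_simps power2_eq_square)
qed

lemma big_hj3: "big 16 (\<lambda>n M. hj j n M ^ 3 - j ^ 3 * bb n ^ 3)"
proof -
  have "big 16 (\<lambda>n M. tau n * (zz n M + j * bb n) * (3 * j ^ 2 * bb n ^ 2
      + 3 * j * bb n * tau n * (zz n M + j * bb n) + (tau n * (zz n M + j * bb n)) ^ 2))"
    by (rule big_mono, (rule big_tau big_intros)+, simp)
  then show ?thesis
    by (rule big_cong) (simp add: hj_def algebra_simps power2_eq_square power3_eq_cube)
qed

text \<open>The one-step operator of the normalised recurrence. Its total mass differs from 1 by the
  killing.\<close>

definition avg :: "(real \<Rightarrow> real) \<Rightarrow> real \<Rightarrow> real \<Rightarrow> real" where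
  "avg F n M = w1 n M * F (- 1) + 1 / K * F (K - 1)"

lemma w1_eq: "w1 n M = (K - 1) / K - kap * (bb n ^ 2 * zz n M - bb n ^ 3) + (K - 1) * (kap * bb n ^ 3) + rw n M"
  by (simp add: rw_def)

lemma big_w1: "big 0 w1"
proof -
  have "big 0 (\<lambda>n M. (K - 1) / K - kap * (bb n ^ 2 * zz n M - bb n ^ 3) + (K - 1) * (kap * bb n ^ 3) + rw n M)"
    by (rule big_mono, (rule big_rw big_intros)+, simp)
  then show ?thesis by (simp only: w1_eq[abs_def])
qed

lemma big_avg:
  assumes "\<And>j. big i (F j)" shows "big i (\<lambda>n M. avg (\<lambda>j. F j n M) n M)"
  unfolding avg_def by (rule big_mono, (rule big_w1 assms big_intros)+, simp)

lemma avg_moment0: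
  "avg (\<lambda>j. 1) n M = 1 - kap * (bb n ^ 2 * zz n M - bb n ^ 3) + (K - 1) * (kap * bb n ^ 3) + rw n M"
  unfolding avg_def w1_eq using K by (simp add: field_simps)

text \<open>The unperturbed walk is centred. Of the factor 4/3, 1 arises because the killing reduces
  only the weight of the step \<open>j = - 1\<close>, and 1/3 from the changing scale.\<close>

lemma big_moment1: "big 16 (\<lambda>n M. avg (\<lambda>j. hj j n M) n M - 4 / 3 * kap * bb n ^ 3 * zz n M)"
proof -
  define d where "d = (\<lambda>n M. - kap * (bb n ^ 2 * zz n M - bb n ^ 3) + (K - 1) * (kap * bb n ^ 3) + rw n M)"
  have d: "big 8 d" unfolding d_def by (rule big_mono, (rule big_rw big_intros)+, simp)
  have "big 16 (\<lambda>n M. - kap * bb n ^ 4 - (K - 1) * kap * bb n ^ 4 - bb n * rw n M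
      + (tau n - kap * bb n ^ 3 / 3) * zz n M + tau n * ((zz n M - bb n) * d n M))"
    by (rule big_mono, (rule d big_rw big_tau_err big_tau big_intros)+, simp)
  then show ?thesis
  proof (rule big_cong)
    fix n M :: real
    define w b z where "w = w1 n M" and "b = bb n" and "z = zz n M"
    define p2 where "p2 = 1 / K"
    have p: "K * p2 = 1" using K by (simp add: p2_def)
    have w: "w = (K - 1) * p2 + d n M" by (simp add: w_def w1_eq d_def p2_def)
    have A: "avg (\<lambda>j. hj j n M) n M = w * (- b + tau n * (z - b)) + p2 * ((K - 1) * b + tau n * (z + (K - 1) * b))"
      by (simp add: avg_def hj_def w_def b_def z_def p2_def)
    also have "\<dots> = - b * d n M + tau n * z + tau n * ((z - b) * d n M)"
      unfolding w using p by algebra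
    also have "- b * d n M = kap * b ^ 3 * z - kap * b ^ 4 - (K - 1) * kap * b ^ 4 - b * rw n M"
      unfolding d_def b_def z_def by (simp add: algebra_simps power2_eq_square power3_eq_cube power4_eq_xxxx)
    finally show "avg (\<lambda>j. hj j n M) n M - 4 / 3 * kap * bb n ^ 3 * zz n M =
      - kap * bb n ^ 4 - (K - 1) * kap * bb n ^ 4 - bb n * rw n M
      + (tau n - kap * bb n ^ 3 / 3) * zz n M + tau n * ((zz n M - bb n) * d n M)"
      by (simp add: b_def z_def algebra_simps)
  qed
qed

lemma big_delta: "big 8 (\<lambda>n M. w1 n M - (K - 1) / K)"
proof -
  have "big 8 (\<lambda>n M. - kap * (bb n ^ 2 * zz n M - bb n ^ 3) + (K - 1) * (kap * bb n ^ 3) + rw n M)"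
    by (rule big_mono, (rule big_rw big_intros)+, simp)
  then show ?thesis by (rule big_cong) (simp add: w1_eq)
qed

lemma big_moment2: "big 16 (\<lambda>n M. avg (\<lambda>j. hj j n M ^ 2) n M - (K - 1) * bb n ^ 2)"
proof -
  have "big 16 (\<lambda>n M. (w1 n M - (K - 1) / K) * bb n ^ 2 + avg (\<lambda>j. hj j n M ^ 2 - j ^ 2 * bb n ^ 2) n M)"
    by (rule big_mono, (rule big_delta big_avg big_hj2 big_intros)+, simp)
  then show ?thesis
    by (rule big_cong) (use K in \<open>simp add: avg_def field_simps power2_eq_square\<close>)
qed

lemma big_moment3: "big 16 (\<lambda>n M. avg (\<lambda>j. hj j n M ^ 3) n M - (K - 1) * (K - 2) * bb n ^ 3)"
proof -
  have "big 16 (\<lambda>n M. - (w1 n M - (K - 1) / K) * bb n ^ 3 + avg (\<lambda>j. hj j n M ^ 3 - j ^ 3 * bb n ^ 3) n M)"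
    by (rule big_mono, (rule big_delta big_avg big_hj3 big_intros)+, simp)
  then show ?thesis
    by (rule big_cong) (use K in \<open>simp add: avg_def field_simps power2_eq_square power3_eq_cube\<close>)
qed

end

section \<open>One step applied to the corrected Airy profile\<close>

context barrier
begin

text \<open>The constants \<open>cc\<close> and \<open>dd\<close> are those for which the coefficient of \<open>Ai'\<close> in \<open>step (Y \<eta>)\<close>
  vanishes up to order \<open>1 / n\<close>. The term with \<open>\<eta>\<close> then makes this coefficient one-signed, which
  beats all remaining errors near the wall, where \<open>Ai\<close> vanishes.\<close>

definition cc :: real where "cc = - (K + 2) / 12"
definition dd :: real where "dd = 2 * airy_a1 / 3"
definition mu :: real where "mu = (7 * K - 6) / 6"

text \<open>The exponent 7: the slope \<open>\<eta> * tt n ^ 7\<close> times a variance of order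
  \<open>t ^ 8\<close> moves the coefficient of \<open>Ai'\<close> at order \<open>t ^ 15\<close>.
  This dominates the errors of order \<open>t ^ 16\<close> and is dominated by the margin
  \<open>t ^ 13\<close> on \<open>Ai\<close> where \<open>Ai'\<close> is negative.\<close>

definition gg :: "real \<Rightarrow> real \<Rightarrow> real \<Rightarrow> real" where
  "gg \<eta> n z = 1 + bb n * (cc * (airy_a1 + z) ^ 2 + dd * (airy_a1 + z)) + \<eta> * tt n ^ 7 * z"

text \<open>The derivative of \<open>gg\<close> with respect to the scaled height.\<close>

definition g1 :: "real \<Rightarrow> real \<Rightarrow> real \<Rightarrow> real" where
  "g1 \<eta> n M = bb n * (2 * cc * (airy_a1 + zz n M) + dd) + \<eta> * tt n ^ 7"

definition Y :: "real \<Rightarrow> real \<Rightarrow> real \<Rightarrow> real" where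
  "Y \<eta> n M = gg \<eta> n (zz n M) * airy_Ai (airy_a1 + zz n M)"

definition step :: "(real \<Rightarrow> real \<Rightarrow> real) \<Rightarrow> real \<Rightarrow> real \<Rightarrow> real" where
  "step X n M = avg (\<lambda>j. X (n - 1) (M + j)) n M"

definition gj :: "real \<Rightarrow> real \<Rightarrow> real \<Rightarrow> real \<Rightarrow> real" where
  "gj \<eta> j n M = gg \<eta> (n - 1) (zz n M + hj j n M)"

definition xx :: "real \<Rightarrow> real \<Rightarrow> real" where "xx n M = airy_a1 + zz n M"

text \<open>\<open>PP\<close> and \<open>QQ\<close> are the coefficients of \<open>Ai\<close> and
  \<open>Ai'\<close> in \<open>airy_Ai_taylor\<close> with increment \<open>hj\<close>, and
  \<open>RR\<close> is the remainder; \<open>UU\<close> and \<open>VV\<close> are the resulting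
  coefficients after one step.\<close>

definition PP :: "real \<Rightarrow> real \<Rightarrow> real \<Rightarrow> real" where
  "PP j n M = 1 + xx n M * hj j n M ^ 2 / 2 + hj j n M ^ 3 / 6"

definition QQ :: "real \<Rightarrow> real \<Rightarrow> real \<Rightarrow> real" where
  "QQ j n M = hj j n M + xx n M * hj j n M ^ 3 / 6"

definition RR :: "real \<Rightarrow> real \<Rightarrow> real \<Rightarrow> real" where
  "RR j n M = airy_Ai (xx n M + hj j n M) - (airy_Ai (xx n M) * PP j n M + airy_Ai' (xx n M) * QQ j n M)"

definition UU :: "real \<Rightarrow> real \<Rightarrow> real \<Rightarrow> real" where
  "UU \<eta> n M = avg (\<lambda>j. gj \<eta> j n M * PP j n M) n M"

definition VV :: "real \<Rightarrow> real \<Rightarrow> real \<Rightarrow> real" where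
  "VV \<eta> n M = avg (\<lambda>j. gj \<eta> j n M * QQ j n M) n M"

lemma step_Y_eq:
  assumes "n \<ge> 2"
  shows "step (Y \<eta>) n M = UU \<eta> n M * airy_Ai (xx n M) + VV \<eta> n M * airy_Ai' (xx n M)
    + avg (\<lambda>j. gj \<eta> j n M * RR j n M) n M"
proof -
  have "zz (n - 1) (M + j) = zz n M + hj j n M" for j
    using hj_eq[OF assms, of M j] by (simp add: zz_def)
  then have "Y \<eta> (n - 1) (M + j) =
      gj \<eta> j n M * (airy_Ai (xx n M) * PP j n M + airy_Ai' (xx n M) * QQ j n M + RR j n M)" for j
    by (simp add: Y_def gj_def RR_def xx_def add.assoc)
  then show ?thesis by (simp add: step_def UU_def VV_def avg_def algebra_simps)
qed

lemma big_xx: "big 0 xx"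
  unfolding xx_def by (rule big_mono, (rule big_intros)+, simp)

lemma big_g1: "big 4 (g1 \<eta>)"
  unfolding g1_def by (rule big_mono, (rule big_intros)+, simp)

lemma big_g0': "big 4 (\<lambda>n M. gg \<eta> n (zz n M) - 1)"
proof -
  have "big 4 (\<lambda>n M. bb n * (cc * (airy_a1 + zz n M) ^ 2 + dd * (airy_a1 + zz n M)) + \<eta> * tt n ^ 7 * zz n M)"
    by (rule big_mono, (rule big_intros)+, simp)
  then show ?thesis by (rule big_cong) (simp add: gg_def)
qed

lemma big_g0: "big 0 (\<lambda>n M. gg \<eta> n (zz n M))"
proof -
  have "big 0 (\<lambda>n M. (gg \<eta> n (zz n M) - 1) + 1)"
    by (rule big_mono, (rule big_g0' big_intros)+, simp)
  then show ?thesis by simp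
qed

text \<open>As \<open>gg\<close> is quadratic in the scaled height, its expansion in space is exact;
  only the passage from time \<open>n\<close> to \<open>n - 1\<close> leaves an error.\<close>

definition gr :: "real \<Rightarrow> real \<Rightarrow> real \<Rightarrow> real \<Rightarrow> real" where
  "gr \<eta> j n M = gj \<eta> j n M - (gg \<eta> n (zz n M) + g1 \<eta> n M * hj j n M + cc * bb n * hj j n M ^ 2)"

lemma big_gr: "big 16 (gr \<eta> j)"
proof -
  have "big 16 (\<lambda>n M. bb n * tau n * (cc * (xx n M + hj j n M) ^ 2 + dd * (xx n M + hj j n M))
      + \<eta> * (tt (n - 1) ^ 7 - tt n ^ 7) * (zz n M + hj j n M))"
    by (rule big_mono, (rule big_tau big_t7 big_hj big_xx big_intros)+, simp)
  then show ?thesis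
    by (rule big_cong) (simp add: gr_def gj_def gg_def g1_def bb_pred xx_def algebra_simps power2_eq_square)
qed

lemma big_gj: "big 0 (gj \<eta> j)"
proof -
  have "big 0 (\<lambda>n M. gr \<eta> j n M + (gg \<eta> n (zz n M) + g1 \<eta> n M * hj j n M + cc * bb n * hj j n M ^ 2))"
    by (rule big_mono, (rule big_gr big_g0 big_g1 big_hj big_intros)+, simp)
  then show ?thesis by (simp add: gr_def)
qed

lemma big_PP: "big 0 (PP j)"
  unfolding PP_def by (rule big_mono, (rule big_hj big_xx big_intros)+, simp)

lemma big_QQ: "big 0 (QQ j)"
  unfolding QQ_def by (rule big_mono, (rule big_hj big_xx big_intros)+, simp)

text \<open>Half the variance, \<open>kap * bb n ^ 2\<close>, times x = \<open>airy_a1\<close> + z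
  from Ai'' = x Ai, minus the killing \<open>kap * bb n ^ 2 * z\<close>, leaves the constant
  eigenvalue \<open>kap * airy_a1 * bb n ^ 2\<close>.\<close>

definition s0 :: "real \<Rightarrow> real" where
  "s0 n = 1 + kap * airy_a1 * bb n ^ 2 + mu * kap * bb n ^ 3"

lemma big_UU: "big 16 (\<lambda>n M. s0 n * gg \<eta> n (zz n M) - UU \<eta> n M)"
proof -
  let ?g = "\<lambda>n M. gg \<eta> n (zz n M)"
  have e: "big 16 (\<lambda>n M. gj \<eta> j n M * PP j n M - (?g n M + g1 \<eta> n M * hj j n M + cc * bb n * hj j n M ^ 2
      + ?g n M * xx n M * hj j n M ^ 2 / 2 + hj j n M ^ 3 / 6))" for j
  proof -
    have "big 16 (\<lambda>n M. gr \<eta> j n M * PP j n M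
       + (g1 \<eta> n M * hj j n M + cc * bb n * hj j n M ^ 2) * (xx n M * hj j n M ^ 2 / 2 + hj j n M ^ 3 / 6)
       + (?g n M - 1) * (hj j n M ^ 3 / 6))"
      by (rule big_mono, (rule big_g0' big_gr big_g0 big_g1 big_hj big_PP big_xx big_intros)+, simp)
    then show ?thesis by (rule big_cong) (simp add: gr_def PP_def algebra_simps diff_divide_distrib)
  qed
  define m1 where "m1 = (\<lambda>n M. avg (\<lambda>j. hj j n M) n M)"
  define m2 where "m2 = (\<lambda>n M. avg (\<lambda>j. hj j n M ^ 2) n M - (K - 1) * bb n ^ 2)"
  define m3 where "m3 = (\<lambda>n M. avg (\<lambda>j. hj j n M ^ 3) n M - (K - 1) * (K - 2) * bb n ^ 3)"
  have m1: "big 12 m1"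
  proof -
    have "big 12 (\<lambda>n M. (m1 n M - 4 / 3 * kap * bb n ^ 3 * zz n M) + 4 / 3 * kap * bb n ^ 3 * zz n M)"
      unfolding m1_def by (rule big_mono, (rule big_moment1 big_intros)+, simp)
    then show ?thesis by simp
  qed
  have m23: "big 16 m2" "big 16 m3"
    unfolding m2_def m3_def by (rule big_moment2 big_moment3)+
  have "big 16 (\<lambda>n M. (?g n M - 1) * (2 * cc + (K - 2) / 3) * kap * bb n ^ 3
      - ?g n M * (rw n M + xx n M * m2 n M / 2) - g1 \<eta> n M * m1 n M - cc * bb n * m2 n M - m3 n M / 6
      - avg (\<lambda>j. gj \<eta> j n M * PP j n M - (?g n M + g1 \<eta> n M * hj j n M + cc * bb n * hj j n M ^ 2
      + ?g n M * xx n M * hj j n M ^ 2 / 2 + hj j n M ^ 3 / 6)) n M)"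
    by (rule big_mono, (rule big_avg e m1 m23 big_rw big_g0' big_g0 big_g1 big_xx big_intros)+, simp)
  then show ?thesis
  proof (rule big_cong)
    fix n M :: real assume n: "n \<ge> 2"
    define g b x z where "g = ?g n M" and "b = bb n" and "x = xx n M" and "z = zz n M"
    have lin: "avg (\<lambda>j. gj \<eta> j n M * PP j n M - (g + g1 \<eta> n M * hj j n M + cc * b * hj j n M ^ 2
      + g * x * hj j n M ^ 2 / 2 + hj j n M ^ 3 / 6)) n M = UU \<eta> n M
      - (g * avg (\<lambda>j. 1) n M + g1 \<eta> n M * m1 n M + cc * b * avg (\<lambda>j. hj j n M ^ 2) n M
      + g * x * avg (\<lambda>j. hj j n M ^ 2) n M / 2 + avg (\<lambda>j. hj j n M ^ 3) n M / 6)"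
      by (simp add: UU_def m1_def avg_def algebra_simps add_divide_distrib)
    have a0: "avg (\<lambda>j. 1) n M = 1 - kap * (b ^ 2 * z - b ^ 3) + (K - 1) * (kap * b ^ 3) + rw n M"
      by (simp add: avg_moment0 b_def z_def)
    have a2: "avg (\<lambda>j. hj j n M ^ 2) n M = 2 * kap * b ^ 2 + m2 n M"
      by (simp add: m2_def b_def kap_def)
    have a3: "avg (\<lambda>j. hj j n M ^ 3) n M = 2 * kap * (K - 2) * b ^ 3 + m3 n M"
      by (simp add: m3_def b_def kap_def)
    have x: "x = airy_a1 + z" by (simp add: x_def z_def xx_def)
    have mu: "mu = K + 2 * cc + (K - 2) / 3" by (simp add: mu_def cc_def field_simps)
    have s0: "s0 n = 1 + kap * airy_a1 * b ^ 2 + (K + 2 * cc + (K - 2) / 3) * kap * b ^ 3"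
      by (simp add: s0_def b_def mu)
    have "s0 n * g - (g * avg (\<lambda>j. 1) n M + g1 \<eta> n M * m1 n M + cc * b * avg (\<lambda>j. hj j n M ^ 2) n M
      + g * x * avg (\<lambda>j. hj j n M ^ 2) n M / 2 + avg (\<lambda>j. hj j n M ^ 3) n M / 6) =
      (g - 1) * (2 * cc + (K - 2) / 3) * kap * b ^ 3
      - g * (rw n M + x * m2 n M / 2) - g1 \<eta> n M * m1 n M - cc * b * m2 n M - m3 n M / 6"
      unfolding s0 a0 a2 a3 x by (simp add: field_simps power2_eq_square power3_eq_cube)
    then show "s0 n * ?g n M - UU \<eta> n M = (?g n M - 1) * (2 * cc + (K - 2) / 3) * kap * bb n ^ 3
      - ?g n M * (rw n M + xx n M * m2 n M / 2) - g1 \<eta> n M * m1 n M - cc * bb n * m2 n M - m3 n M / 6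
      - avg (\<lambda>j. gj \<eta> j n M * PP j n M - (?g n M + g1 \<eta> n M * hj j n M + cc * bb n * hj j n M ^ 2
      + ?g n M * xx n M * hj j n M ^ 2 / 2 + hj j n M ^ 3 / 6)) n M"
      using lin unfolding g_def b_def x_def by linarith
  qed
qed

text \<open>The drift, the correction \<open>gg\<close> and the third moment cancel at order 12,
  which leaves the tilt alone to decide the sign of the coefficient of \<open>Ai'\<close>.\<close>

lemma big_VV: "big 16 (\<lambda>n M. VV \<eta> n M - 2 * kap * \<eta> * tt n ^ 7 * bb n ^ 2)"
proof -
  let ?g = "\<lambda>n M. gg \<eta> n (zz n M)"
  have e: "big 16 (\<lambda>n M. gj \<eta> j n M * QQ j n M - (?g n M * hj j n M + g1 \<eta> n M * hj j n M ^ 2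
      + xx n M * hj j n M ^ 3 / 6))" for j
  proof -
    have "big 16 (\<lambda>n M. gr \<eta> j n M * QQ j n M + cc * bb n * hj j n M ^ 3
       + (?g n M - 1) * xx n M * hj j n M ^ 3 / 6
       + (g1 \<eta> n M * hj j n M + cc * bb n * hj j n M ^ 2) * (xx n M * hj j n M ^ 3 / 6))"
      by (rule big_mono, (rule big_g0' big_gr big_g0 big_g1 big_hj big_QQ big_xx big_intros)+, simp)
    then show ?thesis
      by (rule big_cong) (simp add: gr_def QQ_def algebra_simps diff_divide_distrib power2_eq_square power3_eq_cube)
  qed
  define m1 where "m1 = (\<lambda>n M. avg (\<lambda>j. hj j n M) n M - 4 / 3 * kap * bb n ^ 3 * zz n M)"
  define m2 where "m2 = (\<lambda>n M. avg (\<lambda>j. hj j n M ^ 2) n M - (K - 1) * bb n ^ 2)"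
  define m3 where "m3 = (\<lambda>n M. avg (\<lambda>j. hj j n M ^ 3) n M - (K - 1) * (K - 2) * bb n ^ 3)"
  have m: "big 16 m1" "big 16 m2" "big 16 m3"
    unfolding m1_def m2_def m3_def by (rule big_moment1 big_moment2 big_moment3)+
  have "big 16 (\<lambda>n M. (?g n M - 1) * (4 / 3 * kap * bb n ^ 3 * zz n M) + ?g n M * m1 n M
      + g1 \<eta> n M * m2 n M + xx n M * m3 n M / 6
      + avg (\<lambda>j. gj \<eta> j n M * QQ j n M - (?g n M * hj j n M + g1 \<eta> n M * hj j n M ^ 2
      + xx n M * hj j n M ^ 3 / 6)) n M)"
    by (rule big_mono, (rule big_avg e m big_g0' big_g0 big_g1 big_xx big_intros)+, simp)
  then show ?thesis
  proof (rule big_cong)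
    fix n M :: real assume n: "n \<ge> 2"
    define g b x z where "g = ?g n M" and "b = bb n" and "x = xx n M" and "z = zz n M"
    have lin: "avg (\<lambda>j. gj \<eta> j n M * QQ j n M - (g * hj j n M + g1 \<eta> n M * hj j n M ^ 2
      + x * hj j n M ^ 3 / 6)) n M = VV \<eta> n M
      - (g * avg (\<lambda>j. hj j n M) n M + g1 \<eta> n M * avg (\<lambda>j. hj j n M ^ 2) n M
      + x * avg (\<lambda>j. hj j n M ^ 3) n M / 6)"
      by (simp add: VV_def avg_def algebra_simps add_divide_distrib)
    have a1: "avg (\<lambda>j. hj j n M) n M = 4 / 3 * kap * b ^ 3 * z + m1 n M"
      by (simp add: m1_def b_def z_def)
    have a2: "avg (\<lambda>j. hj j n M ^ 2) n M = 2 * kap * b ^ 2 + m2 n M"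
      by (simp add: m2_def b_def kap_def)
    have a3: "avg (\<lambda>j. hj j n M ^ 3) n M = 2 * kap * (K - 2) * b ^ 3 + m3 n M"
      by (simp add: m3_def b_def kap_def)
    have g1: "g1 \<eta> n M = b * (2 * cc * x + dd) + \<eta> * tt n ^ 7"
      by (simp add: g1_def b_def x_def xx_def)
    have x: "airy_a1 = x - z" by (simp add: x_def z_def xx_def)
    \<comment> \<open>The equation that determines the constants: with z = x -
      \<open>airy_a1\<close>, the terms linear in x give \<open>cc\<close> and the constant terms
      give \<open>dd\<close>.\<close>
    have "4 / 3 * kap * b ^ 3 * z + (b * (2 * cc * x + dd)) * (2 * kap * b ^ 2) + x * (2 * kap * (K - 2) * b ^ 3) / 6 = 0"
      unfolding cc_def dd_def x by (simp add: field_simps power2_eq_square power3_eq_cube)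
    then have "g * avg (\<lambda>j. hj j n M) n M + g1 \<eta> n M * avg (\<lambda>j. hj j n M ^ 2) n M
      + x * avg (\<lambda>j. hj j n M ^ 3) n M / 6 - 2 * kap * \<eta> * tt n ^ 7 * b ^ 2 =
      (g - 1) * (4 / 3 * kap * b ^ 3 * z) + g * m1 n M + g1 \<eta> n M * m2 n M + x * m3 n M / 6"
      unfolding a1 a2 a3 g1
      by (simp add: algebra_simps add_divide_distrib diff_divide_distrib power2_eq_square power3_eq_cube)
    then show "VV \<eta> n M - 2 * kap * \<eta> * tt n ^ 7 * bb n ^ 2 =
      (?g n M - 1) * (4 / 3 * kap * bb n ^ 3 * zz n M) + ?g n M * m1 n M
      + g1 \<eta> n M * m2 n M + xx n M * m3 n M / 6
      + avg (\<lambda>j. gj \<eta> j n M * QQ j n M - (?g n M * hj j n M + g1 \<eta> n M * hj j n M ^ 2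
      + xx n M * hj j n M ^ 3 / 6)) n M"
      using lin unfolding g_def b_def x_def z_def by linarith
  qed
qed

definition WB :: "real \<Rightarrow> real \<Rightarrow> real \<Rightarrow> real" where
  "WB \<eta> n M = \<bar>w1 n M\<bar> * \<bar>gj \<eta> (- 1) n M\<bar> * (hj (- 1) n M ^ 4 * (1 + \<bar>xx n M\<bar>) ^ 2)
     + 1 / K * \<bar>gj \<eta> (K - 1) n M\<bar> * (hj (K - 1) n M ^ 4 * (1 + \<bar>xx n M\<bar>) ^ 2)"

lemma big_WB: "big 16 (WB \<eta>)"
  unfolding WB_def by (rule big_mono, (rule big_w1 big_gj big_hj big_xx big_intros)+, simp)

lemma step_remainder:
  assumes "\<And>j. j \<in> {- 1, K - 1} \<Longrightarrow> \<bar>hj j n M\<bar> * (2 + \<bar>xx n M\<bar>) \<le> 1"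
  shows "\<bar>avg (\<lambda>j. gj \<eta> j n M * RR j n M) n M\<bar>
    \<le> WB \<eta> n M * (\<bar>airy_Ai (xx n M)\<bar> + \<bar>airy_Ai' (xx n M)\<bar>)"
proof -
  let ?A = "\<bar>airy_Ai (xx n M)\<bar> + \<bar>airy_Ai' (xx n M)\<bar>"
  have R: "\<bar>RR j n M\<bar> \<le> hj j n M ^ 4 * (1 + \<bar>xx n M\<bar>) ^ 2 * ?A" if "j \<in> {- 1, K - 1}" for j
    unfolding RR_def PP_def QQ_def by (rule airy_Ai_taylor) (rule assms[OF that])
  have "\<bar>avg (\<lambda>j. gj \<eta> j n M * RR j n M) n M\<bar> \<le>
     \<bar>w1 n M\<bar> * \<bar>gj \<eta> (- 1) n M\<bar> * \<bar>RR (- 1) n M\<bar> + 1 / K * \<bar>gj \<eta> (K - 1) n M\<bar> * \<bar>RR (K - 1) n M\<bar>"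
    unfolding avg_def
    using abs_triangle_ineq[of "w1 n M * (gj \<eta> (- 1) n M * RR (- 1) n M)"
        "1 / K * (gj \<eta> (K - 1) n M * RR (K - 1) n M)"] K by (simp add: abs_mult mult.assoc)
  also have "\<dots> \<le> \<bar>w1 n M\<bar> * \<bar>gj \<eta> (- 1) n M\<bar> * (hj (- 1) n M ^ 4 * (1 + \<bar>xx n M\<bar>) ^ 2 * ?A)
     + 1 / K * \<bar>gj \<eta> (K - 1) n M\<bar> * (hj (K - 1) n M ^ 4 * (1 + \<bar>xx n M\<bar>) ^ 2 * ?A)"
    using R[of "-1"] R[of "K - 1"] K by (intro add_mono mult_left_mono) auto
  also have "\<dots> = WB \<eta> n M * ?A" by (simp add: WB_def algebra_simps add_divide_distrib)
  finally show ?thesis .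
qed

end

context barrier
begin

section \<open>Super- and subsolutions\<close>

definition lam :: real where "lam = kap powr (1 / 3) * airy_a1"

text \<open>The first two factors have one-step ratio \<open>s0\<close> up to order
  \<open>t ^ 16\<close>. The last one lies between exp (- 24) and exp 24 when
  \<open>\<bar>\<sigma>\<bar> = 1\<close> and \<open>n \<ge> 1\<close>, yet shifts the ratio by
  \<open>2 * \<sigma> * n powr (- 13 / 12)\<close>, where 2 = 24/12.\<close>

definition hh :: "real \<Rightarrow> real \<Rightarrow> real" where
  "hh \<sigma> n = exp (3 * lam * n powr (1 / 3)) * n powr mu * exp (- 24 * \<sigma> * n powr (- 1 / 12))"

definition rho :: "real \<Rightarrow> real \<Rightarrow> real" where
  "rho \<sigma> n = hh \<sigma> n / hh \<sigma> (n - 1)"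

lemma hh_pos: "n \<ge> 1 \<Longrightarrow> hh \<sigma> n > 0" by (simp add: hh_def)

lemma s0_eq: "n \<ge> 1 \<Longrightarrow> s0 n = 1 + lam * n powr (- 2 / 3) + mu * n powr (- 1)"
proof -
  assume n: "n \<ge> 1"
  have "kap * bet ^ 2 = kap powr 1 * kap powr (- 2 / 3)"
  proof -
    have "bet ^ 2 = bet powr 2" using bet_pos by (simp add: powr_numeral)
    also have "\<dots> = kap powr (- 2 / 3)" unfolding bet_def powr_powr by simp
    finally show ?thesis using kap_pos by simp
  qed
  also have "\<dots> = kap powr (1 / 3)" unfolding powr_add[symmetric] by simp
  finally have k: "kap * bet ^ 2 = kap powr (1 / 3)" .
  have "kap * airy_a1 * bb n ^ 2 = (kap * bet ^ 2) * airy_a1 * tt n ^ 8"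
    unfolding bb_def power_mult_distrib power_mult[symmetric] by simp
  also have "\<dots> = lam * n powr (- 2 / 3)" unfolding k lam_def using n by (simp add: tt_power)
  finally have 1: "kap * airy_a1 * bb n ^ 2 = lam * n powr (- 2 / 3)" .
  have "mu * kap * bb n ^ 3 = mu * n powr (- 1)"
    using bb_cube[OF n] n by (simp add: powr_minus_divide mult.assoc)
  with 1 show ?thesis by (simp add: s0_def)
qed

text \<open>The logarithm \<open>L\<close> of the ratio is a sum of differences, each expanded to
  order \<open>n powr (- 4 / 3)\<close>; exponentiating adds terms bounded by a multiple of the
  square of \<open>L\<close>, which is of the same order.\<close>

lemma rho_expansion:
  "(\<lambda>n. rho \<sigma> n - s0 n - 2 * \<sigma> * n powr (- 13 / 12)) \<in> O[at_top](\<lambda>n. n powr (- 4 / 3))"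
  "(\<lambda>n. rho \<sigma> n - 1) \<in> O[at_top](\<lambda>n. n powr (- 2 / 3))"
proof -
  define L where "L = (\<lambda>n. 3 * lam * (n powr (1 / 3) - (n - 1) powr (1 / 3))
     + mu * (ln n - ln (n - 1)) - 24 * \<sigma> * (n powr (- 1 / 12) - (n - 1) powr (- 1 / 12)))"
  define D where "D = (\<lambda>n. L n - (lam * n powr (- 2 / 3) + mu * n powr (- 1) + 2 * \<sigma> * n powr (- 13 / 12)))"
  have rho: "rho \<sigma> n = exp (L n)" if "n \<ge> 2" for n
  proof -
    have "n powr mu = exp (mu * ln n)" "(n - 1) powr mu = exp (mu * ln (n - 1))"
      using that by (simp_all add: powr_def)
    then have "hh \<sigma> n = exp (3 * lam * n powr (1 / 3) + mu * ln n - 24 * \<sigma> * n powr (- 1 / 12))"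
      "hh \<sigma> (n - 1) = exp (3 * lam * (n - 1) powr (1 / 3) + mu * ln (n - 1) - 24 * \<sigma> * (n - 1) powr (- 1 / 12))"
      by (simp_all add: hh_def exp_add exp_diff exp_minus field_simps)
    then have "rho \<sigma> n = exp ((3 * lam * n powr (1 / 3) + mu * ln n - 24 * \<sigma> * n powr (- 1 / 12))
      - (3 * lam * (n - 1) powr (1 / 3) + mu * ln (n - 1) - 24 * \<sigma> * (n - 1) powr (- 1 / 12)))"
      unfolding rho_def by (simp only: exp_diff)
    also have "\<dots> = exp (L n)" by (simp add: L_def algebra_simps)
    finally show ?thesis .
  qed
  have a1: "(\<lambda>n::real. n powr (1 / 3) - (n - 1) powr (1 / 3) - n powr (- 2 / 3) / 3) \<in> O[at_top](\<lambda>n. n powr (- 4 / 3))"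
    by real_asymp
  have a2: "(\<lambda>n::real. ln n - ln (n - 1) - n powr (- 1)) \<in> O[at_top](\<lambda>n. n powr (- 4 / 3))"
    by real_asymp
  have a3: "(\<lambda>n::real. n powr (- 1 / 12) - (n - 1) powr (- 1 / 12) + n powr (- 13 / 12) / 12) \<in> O[at_top](\<lambda>n. n powr (- 4 / 3))"
    by real_asymp
  have c: "(\<lambda>n. c * f n) \<in> O[at_top](g)" if "f \<in> O[at_top](g)" for c :: real and f g :: "real \<Rightarrow> real"
    using that by (cases "c = 0") auto
  have "(\<lambda>n. 3 * lam * (n powr (1 / 3) - (n - 1) powr (1 / 3) - n powr (- 2 / 3) / 3)
     + mu * (ln n - ln (n - 1) - n powr (- 1))
     + (- 24 * \<sigma>) * (n powr (- 1 / 12) - (n - 1) powr (- 1 / 12) + n powr (- 13 / 12) / 12))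
      \<in> O[at_top](\<lambda>n. n powr (- 4 / 3))"
    by (intro sum_in_bigo c a1 a2 a3)
  also have "(\<lambda>n. 3 * lam * (n powr (1 / 3) - (n - 1) powr (1 / 3) - n powr (- 2 / 3) / 3)
     + mu * (ln n - ln (n - 1) - n powr (- 1))
     + (- 24 * \<sigma>) * (n powr (- 1 / 12) - (n - 1) powr (- 1 / 12) + n powr (- 13 / 12) / 12)) = D"
    by (rule ext) (simp add: D_def L_def algebra_simps)
  finally have D: "D \<in> O[at_top](\<lambda>n. n powr (- 4 / 3))" .
  have L: "L \<in> O[at_top](\<lambda>n. n powr (- 2 / 3))"
  proof -
    have "(\<lambda>n::real. n powr (- 4 / 3)) \<in> O[at_top](\<lambda>n. n powr (- 2 / 3))" by real_asymp
    with D have "D \<in> O[at_top](\<lambda>n. n powr (- 2 / 3))" by (rule landau_o.big_trans)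
    moreover have "(\<lambda>n::real. n powr (- 1)) \<in> O[at_top](\<lambda>n. n powr (- 2 / 3))"
      "(\<lambda>n::real. n powr (- 13 / 12)) \<in> O[at_top](\<lambda>n. n powr (- 2 / 3))" by real_asymp+
    ultimately have "(\<lambda>n. D n + (lam * n powr (- 2 / 3) + mu * n powr (- 1) + (2 * \<sigma>) * n powr (- 13 / 12)))
       \<in> O[at_top](\<lambda>n. n powr (- 2 / 3))"
      by (intro sum_in_bigo c) auto
    then show ?thesis by (simp add: D_def)
  qed
  have L0: "(L \<longlongrightarrow> 0) at_top"
  proof -
    have "(\<lambda>n::real. n powr (- 2 / 3)) \<in> o[at_top](\<lambda>_. 1)" by real_asymp
    with L have "L \<in> o[at_top](\<lambda>_. 1)" by (rule landau_o.big_small_trans)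
    from smalloD_tendsto[OF this] show ?thesis by simp
  qed
  have expL: "(\<lambda>n. exp (L n) - 1 - L n) \<in> O[at_top](\<lambda>n. n powr (- 4 / 3))"
  proof -
    have b: "\<bar>exp x - 1 - x\<bar> \<le> 2 * (x * x)" if x: "\<bar>x\<bar> \<le> 1" for x :: real
    proof -
      obtain t where t: "\<bar>t\<bar> \<le> \<bar>x\<bar>" "exp x = (\<Sum>m<2. x ^ m / fact m) + exp t / fact 2 * x ^ 2"
        using Maclaurin_exp_le[of x 2] by blast
      have "exp t \<le> exp 1" using t(1) x by simp
      also have "exp (1::real) \<le> 3" by (rule exp_le)
      finally have e: "exp t / 2 \<le> 2" by simp
      have "exp x - 1 - x = exp t / 2 * (x * x)" using t(2) by (simp add: numeral_2_eq_2)
      then have "\<bar>exp x - 1 - x\<bar> = \<bar>exp t / 2 * (x * x)\<bar>" by (rule arg_cong)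
      also have "\<dots> = exp t / 2 * (x * x)" by (simp add: abs_mult)
      also have "\<dots> \<le> 2 * (x * x)" using e by (intro mult_right_mono) auto
      finally show ?thesis .
    qed
    have "eventually (\<lambda>n. \<bar>L n\<bar> \<le> 1) at_top"
      using order_tendstoD(2)[OF tendsto_rabs_zero[OF L0], of 1] by (auto elim: eventually_mono)
    then have "(\<lambda>n. exp (L n) - 1 - L n) \<in> O[at_top](\<lambda>n. L n * L n)"
      by (intro bigoI[of _ 2]) (auto elim!: eventually_mono intro: b)
    also have "(\<lambda>n. L n * L n) \<in> O[at_top](\<lambda>n. n powr (- 2 / 3) * n powr (- 2 / 3))"
      by (intro landau_o.big.mult L)
    also have "(\<lambda>n::real. n powr (- 2 / 3) * n powr (- 2 / 3)) = (\<lambda>n. n powr (- 4 / 3))"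
      by (simp flip: powr_add)
    finally show ?thesis .
  qed
  have "(\<lambda>n. (exp (L n) - 1 - L n) + D n) \<in> O[at_top](\<lambda>n. n powr (- 4 / 3))"
    by (rule sum_in_bigo(1)[OF expL D])
  then show "(\<lambda>n. rho \<sigma> n - s0 n - 2 * \<sigma> * n powr (- 13 / 12)) \<in> O[at_top](\<lambda>n. n powr (- 4 / 3))"
    by (rule landau_o.big.ev_eq_trans2[rotated])
      (auto simp: eventually_at_top_linorder D_def rho s0_eq intro!: exI[of _ 2])
  have "(\<lambda>n::real. n powr (- 4 / 3)) \<in> O[at_top](\<lambda>n. n powr (- 2 / 3))" by real_asymp
  with expL have "(\<lambda>n. exp (L n) - 1 - L n) \<in> O[at_top](\<lambda>n. n powr (- 2 / 3))"
    by (rule landau_o.big_trans)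
  then have "(\<lambda>n. (exp (L n) - 1 - L n) + L n) \<in> O[at_top](\<lambda>n. n powr (- 2 / 3))"
    by (rule sum_in_bigo(1)[OF _ L])
  then show "(\<lambda>n. rho \<sigma> n - 1) \<in> O[at_top](\<lambda>n. n powr (- 2 / 3))"
    by (rule landau_o.big.ev_eq_trans2[rotated])
      (auto simp: eventually_at_top_linorder rho intro!: exI[of _ 2])
qed

lemma rho_margin:
  assumes "\<sigma> = 1 \<or> \<sigma> = - 1"
  shows "\<forall>\<^sub>F n in at_top. \<sigma> * (rho \<sigma> n - s0 n) \<ge> tt n ^ 13"
proof -
  have "(\<lambda>n::real. n powr (- 4 / 3)) \<in> o[at_top](\<lambda>n. n powr (- 13 / 12))" by real_asymp
  with rho_expansion(1)[of \<sigma>]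
  have "(\<lambda>n. rho \<sigma> n - s0 n - 2 * \<sigma> * n powr (- 13 / 12)) \<in> o[at_top](\<lambda>n. n powr (- 13 / 12))"
    by (rule landau_o.big_small_trans)
  then have "\<forall>\<^sub>F n in at_top. norm (rho \<sigma> n - s0 n - 2 * \<sigma> * n powr (- 13 / 12)) \<le> 1 * norm (n powr (- 13 / 12))"
    by (rule landau_o.smallD) simp
  then show ?thesis using eventually_ge_at_top[of 1]
  proof eventually_elim
    case (elim n)
    then show ?case using assms by (auto simp: tt_power)
  qed
qed

lemma rho_near_1: "\<exists>C>0. \<forall>\<^sub>F n in at_top. \<bar>rho \<sigma> n - 1\<bar> \<le> C * tt n ^ 8"
proof -
  obtain C where C: "C > 0" "\<forall>\<^sub>F n in at_top. norm (rho \<sigma> n - 1) \<le> C * norm (n powr (- 2 / 3))"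
    using landau_o.bigE[OF rho_expansion(2)] by blast
  have "\<forall>\<^sub>F n in at_top. \<bar>rho \<sigma> n - 1\<bar> \<le> C * tt n ^ 8"
    using C(2) eventually_ge_at_top[of 1] by eventually_elim (simp add: tt_power)
  with C(1) show ?thesis by blast
qed

text \<open>Inside, polynomial factors of the scaled height cost less than one power of
  \<open>t\<close>; outside, the exponential decay of \<open>Ai\<close> beats every power of
  \<open>t\<close>.\<close>

definition inner_zone :: "nat \<Rightarrow> real \<Rightarrow> real \<Rightarrow> bool" where
  "inner_zone q n M \<longleftrightarrow> (1 + zz n M) ^ q \<le> 1 / tt n"

lemma tt_eventually_small: "c > 0 \<Longrightarrow> \<forall>\<^sub>F n in at_top. tt n < c"
  by (rule order_tendstoD(2)[OF tt_tendsto_0])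

lemma big_smallE:
  assumes "big (Suc j) f"
  obtains q0 where "\<And>q \<delta>. q \<ge> q0 \<Longrightarrow> \<delta> > 0 \<Longrightarrow>
    \<forall>\<^sub>F n in at_top. \<forall>M\<ge>1. inner_zone q n M \<longrightarrow> \<bar>f n M\<bar> \<le> \<delta> * tt n ^ j"
  using big_small[OF assms] unfolding inner_zone_def by blast

text \<open>The arithmetic of the defect at one point: \<open>f\<close> and \<open>f'\<close> stand
  for \<open>Ai\<close> and \<open>Ai'\<close>. The perturbed eigenvalue contributes
  \<open>t ^ 13 * f / 2\<close>, the tilt \<open>c * t ^ 15 * f'\<close>, and all errors carry the
  factor \<open>\<delta> * t ^ 15\<close>. Where \<open>f' \<ge> 0\<close> both contributions
  help.\<close>

lemma margin_pointwise:
  fixes t f f' g U V W \<rho> s \<sigma> \<delta> c z A :: real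
  assumes \<sigma>: "\<sigma> = 1 \<or> \<sigma> = - 1" and t: "0 < t" "t \<le> 1" and f: "f \<ge> 0" and c: "c > 0"
    and \<delta>: "0 \<le> \<delta>" "\<delta> \<le> c / 4" "\<delta> \<le> 1 / 16"
    and \<rho>: "\<sigma> * (\<rho> - s) \<ge> t ^ 13" and g: "g \<ge> 1 / 2"
    and U: "\<bar>s * g - U\<bar> \<le> \<delta> * t ^ 15" and V: "\<bar>V + \<sigma> * c * t ^ 15\<bar> \<le> \<delta> * t ^ 15"
    and W: "\<bar>W\<bar> \<le> \<delta> * t ^ 15 * (f + \<bar>f'\<bar>)"
    and neg: "f' < 0 \<Longrightarrow> - f' \<le> A * z * f" and z: "z * t \<le> 1" and A: "A > 0" "12 * c * A * t \<le> 1"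
  shows "\<sigma> * (\<rho> * (g * f) - (U * f + V * f' + W)) \<ge> min (1 / 4) (c / 2) * t ^ 15 * (f + max f' 0)"
proof -
  have t15: "t ^ 15 > 0" "t ^ 15 \<le> t ^ 13" using t by (auto intro: power_decreasing)
  have s2: "\<sigma> * \<sigma> = 1" "\<bar>\<sigma>\<bar> = 1" using \<sigma> by auto
  have le: "x \<ge> - y" if "\<bar>x\<bar> \<le> y" for x y :: real using that by linarith
  have "\<sigma> * (\<rho> - s) \<ge> 0" using \<rho> zero_le_power[of t 13] t by linarith
  then have T1: "\<sigma> * (\<rho> - s) * (g * f) \<ge> t ^ 13 * (1 / 2 * f)"
    using \<rho> g f t by (intro mult_mono) auto
  have T2: "\<sigma> * (s * g - U) * f \<ge> - (\<delta> * t ^ 15 * f)"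
    by (rule le) (use U f s2 in \<open>simp add: abs_mult mult_right_mono\<close>)
  have T3: "- \<sigma> * (V + \<sigma> * c * t ^ 15) * f' \<ge> - (\<delta> * t ^ 15 * \<bar>f'\<bar>)"
    by (rule le) (use V s2 in \<open>simp add: abs_mult mult_right_mono\<close>)
  have T4: "- \<sigma> * W \<ge> - (\<delta> * t ^ 15 * (f + \<bar>f'\<bar>))"
    by (rule le) (use W s2 in \<open>simp add: abs_mult\<close>)
  have "\<sigma> * (\<rho> * (g * f) - (U * f + V * f' + W)) = \<sigma> * (\<rho> - s) * (g * f) + \<sigma> * (s * g - U) * f
    + (- \<sigma> * (V + \<sigma> * c * t ^ 15) * f' + (\<sigma> * \<sigma>) * c * t ^ 15 * f') - \<sigma> * W"
    by (simp add: algebra_simps)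
  then have total: "\<sigma> * (\<rho> * (g * f) - (U * f + V * f' + W)) \<ge> t ^ 13 * (1 / 2 * f) - \<delta> * t ^ 15 * f
    - \<delta> * t ^ 15 * \<bar>f'\<bar> + c * t ^ 15 * f' - \<delta> * t ^ 15 * (f + \<bar>f'\<bar>)"
    using T1 T2 T3 T4 unfolding s2 by linarith
  have df: "\<delta> * (t ^ 15 * f) \<le> 1 / 16 * (t ^ 13 * f)"
    using \<delta> t15 f by (intro mult_mono) (auto intro: mult_right_mono)
  have tf: "t ^ 15 * f \<le> t ^ 13 * f" "0 \<le> t ^ 15 * f" using t15 f by (auto intro: mult_right_mono)
  have df': "\<delta> * (t ^ 15 * \<bar>f'\<bar>) \<le> c / 4 * (t ^ 15 * \<bar>f'\<bar>)"
    using \<delta> t15 by (intro mult_right_mono) auto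
  show ?thesis
  proof (cases "f' \<ge> 0")
    case True
    have "min (1 / 4) (c / 2) * (t ^ 15 * f) \<le> 1 / 4 * (t ^ 15 * f)"
      "min (1 / 4) (c / 2) * (t ^ 15 * f') \<le> c / 2 * (t ^ 15 * f')"
      using tf True t15 by (intro mult_right_mono; simp)+
    moreover have "max f' 0 = f'" "\<bar>f'\<bar> = f'" using True by auto
    ultimately show ?thesis using total df df' tf by (simp add: algebra_simps)
  next
    case False
    have "min (1 / 4) (c / 2) * (t ^ 15 * f) \<le> 1 / 4 * (t ^ 15 * f)"
      using tf by (intro mult_right_mono) auto
    \<comment> \<open>A negative \<open>f'\<close> costs one factor \<open>z\<close>, paid by
      \<open>z * t \<le> 1\<close>; the other spare power of \<open>t\<close> makes the constant
      small.\<close>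
    moreover have "c * (t ^ 15 * \<bar>f'\<bar>) \<le> 1 / 12 * (t ^ 13 * f)"
    proof -
      have "c * (t ^ 15 * \<bar>f'\<bar>) \<le> c * (t ^ 15 * (A * z * f))"
        using neg False c t15 by (intro mult_left_mono) auto
      also have "\<dots> = (z * t) * (c * A * t * (t ^ 13 * f))" by (simp add: eval_nat_numeral)
      also have "\<dots> \<le> 1 * (c * A * t * (t ^ 13 * f))"
        using z c A t f by (intro mult_right_mono) auto
      also have "\<dots> \<le> 1 / 12 * (t ^ 13 * f)"
        unfolding mult_1_left using A t f by (intro mult_right_mono) auto
      finally show ?thesis .
    qed
    moreover have "max f' 0 = 0" "f' = - \<bar>f'\<bar>" using False by auto
    moreover have "c * t ^ 15 * f' = - (c * (t ^ 15 * \<bar>f'\<bar>))" using False by simp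
    ultimately show ?thesis using total df df' tf by (simp add: algebra_simps)
  qed
qed

text \<open>The choice \<open>\<eta> = - \<sigma>\<close> makes \<open>- \<sigma> * VV\<close> close
  to \<open>c2 * t ^ 15\<close> for both signs, so the tilt always favours positive
  \<open>Ai'\<close>. One exponent \<open>q0\<close> serves all error terms.\<close>

lemma Y_margin:
  assumes \<sigma>: "\<sigma> = 1 \<or> \<sigma> = - 1"
  shows "\<exists>c>0. \<exists>q0. \<forall>q\<ge>q0. \<forall>\<^sub>F n in at_top. \<forall>M\<ge>1. inner_zone q n M \<longrightarrow>
    gg (- \<sigma>) n (zz n M) \<ge> 1 / 2 \<and>
    \<sigma> * (rho \<sigma> n * Y (- \<sigma>) n M - step (Y (- \<sigma>)) n M)
      \<ge> c * tt n ^ 15 * (airy_Ai (xx n M) + max (airy_Ai' (xx n M)) 0)"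
proof -
  define c2 where "c2 = 2 * kap * bet ^ 2"
  have c2: "c2 > 0" using kap_pos bet_pos by (simp add: c2_def)
  define \<delta> where "\<delta> = min (c2 / 4) (1 / 16)"
  have \<delta>: "\<delta> > 0" "\<delta> \<le> c2 / 4" "\<delta> \<le> 1 / 16" using c2 by (auto simp: \<delta>_def)
  obtain A where A: "A > 0" "\<And>x. x \<ge> airy_a1 \<Longrightarrow> airy_Ai' x < 0 \<Longrightarrow> - airy_Ai' x \<le> A * (1 + (x - airy_a1)) * airy_Ai x"
    using airy_Ai'_neg_bound by blast
  have bg: "big (Suc 3) (\<lambda>n M. gg (- \<sigma>) n (zz n M) - 1)" using big_g0' by simp
  have bU: "big (Suc 15) (\<lambda>n M. s0 n * gg (- \<sigma>) n (zz n M) - UU (- \<sigma>) n M)" using big_UU by simp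
  have bV: "big (Suc 15) (\<lambda>n M. VV (- \<sigma>) n M - 2 * kap * (- \<sigma>) * tt n ^ 7 * bb n ^ 2)" using big_VV[of "- \<sigma>"] by simp
  have bW: "big (Suc 15) (WB (- \<sigma>))" using big_WB by simp
  have bh: "big (Suc 3) (\<lambda>n M. \<bar>hj j n M\<bar> * (2 + \<bar>xx n M\<bar>))" for j
    by (rule big_mono, (rule big_hj big_xx big_intros)+, simp)
  obtain qg where qg: "\<And>q \<delta>. q \<ge> qg \<Longrightarrow> \<delta> > 0 \<Longrightarrow> \<forall>\<^sub>F n in at_top. \<forall>M\<ge>1. inner_zone q n M \<longrightarrow>
      \<bar>gg (- \<sigma>) n (zz n M) - 1\<bar> \<le> \<delta> * tt n ^ 3" using big_smallE[OF bg] by blast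
  obtain qU where qU: "\<And>q \<delta>. q \<ge> qU \<Longrightarrow> \<delta> > 0 \<Longrightarrow> \<forall>\<^sub>F n in at_top. \<forall>M\<ge>1. inner_zone q n M \<longrightarrow>
      \<bar>s0 n * gg (- \<sigma>) n (zz n M) - UU (- \<sigma>) n M\<bar> \<le> \<delta> * tt n ^ 15" using big_smallE[OF bU] by blast
  obtain qV where qV: "\<And>q \<delta>. q \<ge> qV \<Longrightarrow> \<delta> > 0 \<Longrightarrow> \<forall>\<^sub>F n in at_top. \<forall>M\<ge>1. inner_zone q n M \<longrightarrow>
      \<bar>VV (- \<sigma>) n M - 2 * kap * (- \<sigma>) * tt n ^ 7 * bb n ^ 2\<bar> \<le> \<delta> * tt n ^ 15" using big_smallE[OF bV] by blast
  obtain qW where qW: "\<And>q \<delta>. q \<ge> qW \<Longrightarrow> \<delta> > 0 \<Longrightarrow> \<forall>\<^sub>F n in at_top. \<forall>M\<ge>1. inner_zone q n M \<longrightarrow>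
      \<bar>WB (- \<sigma>) n M\<bar> \<le> \<delta> * tt n ^ 15" using big_smallE[OF bW] by blast
  obtain q1 where q1: "\<And>q \<delta>. q \<ge> q1 \<Longrightarrow> \<delta> > 0 \<Longrightarrow> \<forall>\<^sub>F n in at_top. \<forall>M\<ge>1. inner_zone q n M \<longrightarrow>
      \<bar>\<bar>hj (- 1) n M\<bar> * (2 + \<bar>xx n M\<bar>)\<bar> \<le> \<delta> * tt n ^ 3" using big_smallE[OF bh[of "- 1"]] by blast
  obtain q2 where q2: "\<And>q \<delta>. q \<ge> q2 \<Longrightarrow> \<delta> > 0 \<Longrightarrow> \<forall>\<^sub>F n in at_top. \<forall>M\<ge>1. inner_zone q n M \<longrightarrow>
      \<bar>\<bar>hj (K - 1) n M\<bar> * (2 + \<bar>xx n M\<bar>)\<bar> \<le> \<delta> * tt n ^ 3" using big_smallE[OF bh[of "K - 1"]] by blast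
  define q0 where "q0 = 1 + qg + qU + qV + qW + q1 + q2"
  define c where "c = min (1 / 4) (c2 / 2)"
  have "c > 0" using c2 by (simp add: c_def)
  moreover have "\<forall>\<^sub>F n in at_top. \<forall>M\<ge>1. inner_zone q n M \<longrightarrow>
    gg (- \<sigma>) n (zz n M) \<ge> 1 / 2 \<and>
    \<sigma> * (rho \<sigma> n * Y (- \<sigma>) n M - step (Y (- \<sigma>)) n M)
      \<ge> c * tt n ^ 15 * (airy_Ai (xx n M) + max (airy_Ai' (xx n M)) 0)" if q: "q \<ge> q0" for q
  proof -
    have qs: "q \<ge> qg" "q \<ge> qU" "q \<ge> qV" "q \<ge> qW" "q \<ge> q1" "q \<ge> q2" "q \<ge> 1"
      using q by (auto simp: q0_def)
    have half: "(1/2::real) > 0" by simp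
    have eA: "\<forall>\<^sub>F n in at_top. tt n < 1 / (12 * c2 * A)"
      using c2 A(1) by (intro tt_eventually_small) simp
    show ?thesis
      using eventually_ge_at_top[of 2] rho_margin[OF \<sigma>] qg[OF qs(1) half] qU[OF qs(2) \<delta>(1)]
        qV[OF qs(3) \<delta>(1)] qW[OF qs(4) \<delta>(1)] q1[OF qs(5) half] q2[OF qs(6) half] eA
    proof eventually_elim
      case (elim n)
      show ?case
      proof (intro allI impI)
        fix M :: real assume M: "M \<ge> 1" "inner_zone q n M"
        have n1: "n \<ge> 1" using elim by simp
        note t = tt_pos[OF n1] tt_le_1[OF n1]
        have t3: "tt n ^ 3 \<le> 1" using t by (simp add: power_le_one)
        have z0: "zz n M \<ge> 0" using zz_nonneg[OF n1] M by simp
        let ?x = "xx n M"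
        have x: "?x \<ge> airy_a1" using z0 by (simp add: xx_def)
        have g: "gg (- \<sigma>) n (zz n M) \<ge> 1 / 2"
        proof -
          have "\<bar>gg (- \<sigma>) n (zz n M) - 1\<bar> \<le> 1 / 2 * tt n ^ 3" using elim(3) M by blast
          then show ?thesis using t3 by linarith
        qed
        have h: "\<bar>hj j n M\<bar> * (2 + \<bar>?x\<bar>) \<le> 1" if "j \<in> {- 1, K - 1}" for j
        proof -
          have "\<bar>\<bar>hj j n M\<bar> * (2 + \<bar>?x\<bar>)\<bar> \<le> 1 / 2 * tt n ^ 3"
            using that elim(7,8) M by blast
          then show ?thesis using t3 by linarith
        qed
        have f: "airy_Ai ?x \<ge> 0" using airy_Ai_nonneg[OF x] .
        have Wb: "WB (- \<sigma>) n M \<le> \<delta> * tt n ^ 15" using elim(6) M abs_ge_self order_trans by blast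
        have W: "\<bar>avg (\<lambda>j. gj (- \<sigma>) j n M * RR j n M) n M\<bar> \<le> \<delta> * tt n ^ 15 * (airy_Ai ?x + \<bar>airy_Ai' ?x\<bar>)"
          using step_remainder[where n = n and M = M and \<eta> = "- \<sigma>", OF h] mult_right_mono[OF Wb, of "airy_Ai ?x + \<bar>airy_Ai' ?x\<bar>"] f
          by simp
        have Veq: "2 * kap * (- \<sigma>) * tt n ^ 7 * bb n ^ 2 = - (\<sigma> * c2 * tt n ^ 15)"
          by (simp add: bb_def c2_def power_mult_distrib flip: power_mult power_add)
        have "1 + zz n M \<le> (1 + zz n M) ^ q"
          using z0 qs(7) self_le_power[of "1 + zz n M" q] by simp
        also have "\<dots> \<le> 1 / tt n" using M(2) by (simp add: inner_zone_def)
        finally have z: "(1 + zz n M) * tt n \<le> 1" using t by (simp add: field_simps)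
        have "\<sigma> * (rho \<sigma> n * (gg (- \<sigma>) n (zz n M) * airy_Ai ?x) - (UU (- \<sigma>) n M * airy_Ai ?x
            + VV (- \<sigma>) n M * airy_Ai' ?x + avg (\<lambda>j. gj (- \<sigma>) j n M * RR j n M) n M))
          \<ge> min (1 / 4) (c2 / 2) * tt n ^ 15 * (airy_Ai ?x + max (airy_Ai' ?x) 0)"
        proof (rule margin_pointwise[where \<delta> = \<delta> and s = "s0 n" and z = "1 + zz n M" and A = A])
          show "\<bar>s0 n * gg (- \<sigma>) n (zz n M) - UU (- \<sigma>) n M\<bar> \<le> \<delta> * tt n ^ 15" using elim(4) M by simp
          show "\<bar>VV (- \<sigma>) n M + \<sigma> * c2 * tt n ^ 15\<bar> \<le> \<delta> * tt n ^ 15"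
            using elim(5) M unfolding Veq by simp
          show "12 * c2 * A * tt n \<le> 1"
            using elim(9) c2 A(1) by (simp add: field_simps)
          show "- airy_Ai' ?x \<le> A * (1 + zz n M) * airy_Ai ?x" if "airy_Ai' ?x < 0"
            using A(2)[OF x that] by (simp add: xx_def)
        qed (use \<sigma> t f c2 \<delta> elim(2) g W z A in auto)
        then show "gg (- \<sigma>) n (zz n M) \<ge> 1 / 2 \<and>
          \<sigma> * (rho \<sigma> n * Y (- \<sigma>) n M - step (Y (- \<sigma>)) n M)
          \<ge> c * tt n ^ 15 * (airy_Ai ?x + max (airy_Ai' ?x) 0)"
          using g step_Y_eq[of n "- \<sigma>" M] elim(1) by (simp add: Y_def c_def xx_def)
      qed
    qed
  qed
  ultimately show ?thesis by blast
qed

end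

section \<open>The additive correction and the region far from the wall\<close>

context barrier
begin

text \<open>The range \<open>M \<le> n + 1\<close> covers every state at time \<open>n\<close>,
  since \<open>m \<le> k * y + m\<close>. Half of the killing rate is kept, because
  \<open>(K - 1) / K\<close> is at least 1/2.\<close>

lemma w1_bounds:
  assumes "n \<ge> K" "1 \<le> M" "M \<le> n + 1"
  shows "0 \<le> w1 n M" "w1 n M \<le> 2" "avg (\<lambda>j. 1) n M \<le> 1 - (M - 1) / n / 2 + K / n"
proof -
  define m where "m = M - 1"
  have m: "0 \<le> m" "m \<le> n" and n: "n > 0" using assms K by (auto simp: m_def)
  define c where "c = (n - m + K) / (n + m / (K - 1))"
  have w: "w1 n M = (K - 1) / K * c" by (simp add: w1_def c_def m_def)
  have c0: "c \<ge> 0" unfolding c_def using m n K by (intro divide_nonneg_nonneg add_nonneg_nonneg) auto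
  have "c \<le> (n - m + K) / n"
    unfolding c_def using m n K by (intro divide_left_mono mult_pos_pos add_pos_nonneg) auto
  also have "\<dots> = 1 - m / n + K / n" using n by (simp add: field_simps)
  finally have c: "c \<le> 1 - m / n + K / n" .
  have r: "1 / 2 \<le> (K - 1) / K" "(K - 1) / K \<le> 1" using K by (simp_all add: field_simps)
  show "0 \<le> w1 n M" unfolding w using c0 K by simp
  have "w1 n M \<le> 1 * c" unfolding w using r c0 by (intro mult_right_mono) auto
  moreover have "K / n \<le> 1" "m / n \<ge> 0" using assms n m by (simp_all add: divide_le_eq_1)
  ultimately show "w1 n M \<le> 2" using c by linarith
  have "avg (\<lambda>j. 1) n M = (K - 1) / K * c + 1 / K" by (simp add: avg_def w)
  also have "\<dots> \<le> (K - 1) / K * (1 - m / n + K / n) + 1 / K"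
    using c K by (intro add_right_mono mult_left_mono) auto
  also have "\<dots> = 1 - (K - 1) / K * (m / n) + (K - 1) / K * (K / n)"
  proof -
    have "r * (1 - a + b) + s = 1 - r * a + r * b" if "r + s = 1" for r s a b :: real
      using that by (simp add: algebra_simps)
    moreover have "(K - 1) / K + 1 / K = 1" using K by (simp add: field_simps)
    ultimately show ?thesis by blast
  qed
  also have "\<dots> \<le> 1 - 1 / 2 * (m / n) + 1 * (K / n)"
    using r m n K by (intro add_mono diff_mono mult_right_mono) auto
  finally show "avg (\<lambda>j. 1) n M \<le> 1 - (M - 1) / n / 2 + K / n" by (simp add: m_def)
qed

text \<open>At bounded scaled height its cost \<open>4 * t ^ 20\<close> is covered by the margin of
  \<open>Y\<close>, of order \<open>t ^ 15\<close>; far out killing of order \<open>t ^ 8\<close>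
  earns \<open>t ^ 28\<close>, covering \<open>Y\<close>, which is at most \<open>t ^ 30\<close>
  there. At \<open>M = 1\<close> it is negligible against \<open>bb n\<close>.\<close>

definition Z :: "real \<Rightarrow> real" where "Z n = tt n ^ 20"

lemma Z_ratio: "\<forall>\<^sub>F n in at_top. Z (n - 1) \<le> Z n * (1 + 4 * tt n ^ 12)"
proof -
  have "\<forall>\<^sub>F n::real in at_top. (n - 1) powr (- 20 / 12) \<le> n powr (- 20 / 12) * (1 + 4 * (1 / n))"
    by real_asymp
  then show ?thesis using eventually_ge_at_top[of 2]
  proof eventually_elim
    case (elim n)
    then have "n \<ge> 1" "n - 1 \<ge> 1" by auto
    then show ?case using elim tt_power[of n 20] tt_power[of "n - 1" 20] by (simp add: Z_def tt_power_12)
  qed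
qed

text \<open>The lower bound of order \<open>t ^ 20\<close> only uses that all weights are bounded.
  Beyond \<open>z0\<close> the killing \<open>e * t ^ 8 * z\<close> outweighs the deviation of
  \<open>rho\<close> from 1, the mass gain \<open>K / n\<close> and the change of \<open>Z\<close>
  in time.\<close>

lemma Z_barrier:
  "\<exists>z0. \<forall>\<^sub>F n in at_top. \<forall>M\<ge>1. M \<le> n + 1 \<longrightarrow>
     rho \<sigma> n * Z n - avg (\<lambda>j. 1) n M * Z (n - 1) \<ge> - 4 * tt n ^ 20 \<and>
     (zz n M \<ge> z0 \<longrightarrow> rho \<sigma> n * Z n - avg (\<lambda>j. 1) n M * Z (n - 1) \<ge> tt n ^ 28)"
proof -
  obtain C where C: "C > 0" "\<forall>\<^sub>F n in at_top. \<bar>rho \<sigma> n - 1\<bar> \<le> C * tt n ^ 8"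
    using rho_near_1 by blast
  define e where "e = kap * bet ^ 2 / 2"
  have e: "e > 0" using kap_pos bet_pos by (simp add: e_def)
  define z0 where "z0 = (C + K + 10) / e"
  have "\<forall>\<^sub>F n in at_top. \<forall>M\<ge>1. M \<le> n + 1 \<longrightarrow>
     rho \<sigma> n * Z n - avg (\<lambda>j. 1) n M * Z (n - 1) \<ge> - 4 * tt n ^ 20 \<and>
     (zz n M \<ge> z0 \<longrightarrow> rho \<sigma> n * Z n - avg (\<lambda>j. 1) n M * Z (n - 1) \<ge> tt n ^ 28)"
    using C(2) Z_ratio eventually_ge_at_top[of "K + 4"]
  proof eventually_elim
    case (elim n)
    have n1: "n \<ge> 1" "n \<ge> K" using elim(3) K by auto
    note t = tt_pos[OF n1(1)] tt_le_1[OF n1(1)]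
    show ?case
    proof (intro allI impI)
      fix M assume M: "M \<ge> 1" "M \<le> n + 1"
      let ?a = "avg (\<lambda>j. 1) n M" and ?z = "zz n M"
      have a0: "?a \<ge> 0" using w1_bounds(1)[OF n1(2) M] K by (simp add: avg_def)
      have kn: "K / n = K * tt n ^ 12" using tt_power_12[OF n1(1)] by simp
      have K1: "K / n \<le> 1" using n1 K by (simp add: divide_le_eq_1)
      have m0: "(M - 1) / n \<ge> 0" using M n1 by simp
      have "a \<le> 2" if "a \<le> 1 - x / 2 + y" "y \<le> 1" "0 \<le> x" for a x y :: real
        using that by linarith
      from this[OF w1_bounds(3)[OF n1(2) M] K1 m0] have a2: "?a \<le> 2" .
      have t12: "4 * tt n ^ 12 \<le> 1" unfolding tt_power_12[OF n1(1)] using elim(3) K by (simp add: field_simps)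
      have hs: "(M - 1) / n / 2 = e * tt n ^ 8 * ?z - tt n ^ 12 / 2"
      proof -
        have "kap * bb n ^ 3 = tt n ^ 12" using bb_cube[OF n1(1)] tt_power_12[OF n1(1)] by simp
        moreover have "kap * bb n ^ 2 = 2 * e * tt n ^ 8"
          unfolding bb_def power_mult_distrib power_mult[symmetric] by (simp add: e_def)
        moreover have "(M - 1) / n = (kap * bb n ^ 2) * ?z - kap * bb n ^ 3"
          using height_scaled[OF n1(1), of M] by (simp add: algebra_simps)
        ultimately show ?thesis by simp
      qed
      have Zn: "Z n > 0" using t by (simp add: Z_def)
      have "?a * Z (n - 1) \<le> ?a * (Z n * (1 + 4 * tt n ^ 12))" using elim(2) a0 by (intro mult_left_mono) auto
      also have "\<dots> = (?a + ?a * (4 * tt n ^ 12)) * Z n" by (simp add: algebra_simps)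
      also have "\<dots> \<le> (?a + 2 * (4 * tt n ^ 12)) * Z n"
        using a2 t Zn by (intro mult_right_mono add_left_mono) auto
      finally have up: "?a * Z (n - 1) \<le> (?a + 8 * tt n ^ 12) * Z n" by simp
      have r: "rho \<sigma> n \<ge> 1 - C * tt n ^ 8" using elim(1) by linarith
      have rZ: "rho \<sigma> n * Z n \<ge> (1 - C * tt n ^ 8) * Z n" using r Zn by (intro mult_right_mono) auto
      have "rho \<sigma> n * Z n \<ge> 0" using hh_pos[of n \<sigma>] hh_pos[of "n - 1" \<sigma>] n1 elim(3) K Zn
        by (simp add: rho_def)
      moreover have "(?a + 8 * tt n ^ 12) * Z n \<le> 4 * Z n" using a2 t12 Zn by (intro mult_right_mono) auto
      ultimately have 1: "rho \<sigma> n * Z n - ?a * Z (n - 1) \<ge> - 4 * tt n ^ 20"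
        using up by (simp add: Z_def)
      have 2: "rho \<sigma> n * Z n - ?a * Z (n - 1) \<ge> tt n ^ 28" if z: "?z \<ge> z0"
      proof -
        have ez: "e * ?z \<ge> C + K + 10" using z e by (simp add: z0_def field_simps)
        have t128: "tt n ^ 12 \<le> tt n ^ 8" using t by (intro power_decreasing) auto
        have "?a \<le> 1 - (e * ?z) * tt n ^ 8 + tt n ^ 12 / 2 + K * tt n ^ 12"
          using w1_bounds(3)[OF n1(2) M] hs kn by (simp add: algebra_simps)
        also have "\<dots> \<le> 1 - (C + K + 10) * tt n ^ 8 + tt n ^ 8 / 2 + K * tt n ^ 8"
          using ez t128 t K by (intro add_mono diff_mono mult_right_mono mult_left_mono divide_right_mono) auto
        finally have "?a \<le> 1 - (C + K + 10) * tt n ^ 8 + tt n ^ 8 / 2 + K * tt n ^ 8" .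
        moreover have "a + 8 * u \<le> 1 - C * v - v"
          if "a \<le> 1 - (C + K + 10) * v + v / 2 + K * v" "u \<le> v" "0 \<le> v" for a u v :: real
          using that by (simp add: algebra_simps)
        ultimately have "?a + 8 * tt n ^ 12 \<le> 1 - C * tt n ^ 8 - tt n ^ 8"
          using t128 t by simp
        then have "(?a + 8 * tt n ^ 12) * Z n \<le> (1 - C * tt n ^ 8 - tt n ^ 8) * Z n"
          using Zn by (intro mult_right_mono) auto
        then have "rho \<sigma> n * Z n - ?a * Z (n - 1) \<ge> tt n ^ 8 * Z n"
          using up rZ by (simp add: algebra_simps)
        then show ?thesis by (simp add: Z_def flip: power_add)
      qed
      from 1 2 show "rho \<sigma> n * Z n - avg (\<lambda>j. 1) n M * Z (n - 1) \<ge> - 4 * tt n ^ 20 \<and>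
         (zz n M \<ge> z0 \<longrightarrow> rho \<sigma> n * Z n - avg (\<lambda>j. 1) n M * Z (n - 1) \<ge> tt n ^ 28)" by blast
    qed
  qed
  then show ?thesis by blast
qed

text \<open>The quadratic growth of \<open>gg\<close> is paid for by half of the exponential decay
  of \<open>Ai\<close>.\<close>

lemma Y_le_exp: "\<exists>C>0. \<forall>n\<ge>1. \<forall>M\<ge>0. \<bar>Y \<eta> n M\<bar> \<le> C * exp (- zz n M / 2)"
proof -
  obtain A where A: "A > 0" "\<And>x. x \<ge> airy_a1 \<Longrightarrow> airy_Ai x \<le> A * exp (- (x - airy_a1))"
    using airy_Ai_le_exp by blast
  define B where "B = 1 + bet * (\<bar>cc\<bar> * (1 + \<bar>airy_a1\<bar>) ^ 2 + \<bar>dd\<bar> * (1 + \<bar>airy_a1\<bar>)) + \<bar>\<eta>\<bar>"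
  have B: "B > 0" unfolding B_def using bet_pos by (intro add_pos_nonneg) auto
  have "\<bar>Y \<eta> n M\<bar> \<le> 16 * B * A * exp (- zz n M / 2)" if n: "n \<ge> 1" and M: "M \<ge> 0" for n M
  proof -
    define z where "z = zz n M"
    have z: "z \<ge> 0" using zz_nonneg[OF n M] by (simp add: z_def)
    note t = tt_pos[OF n] tt_le_1[OF n]
    have z2: "1 \<le> (1 + z) ^ 2" "1 + z \<le> (1 + z) ^ 2" "z \<le> (1 + z) ^ 2"
      using z by (auto simp: power2_eq_square algebra_simps)
    have b: "0 \<le> bb n" "bb n \<le> bet"
      using bb_pos[OF n] bet_pos t by (auto simp: bb_def mult_left_le power_le_one)
    have ax: "\<bar>airy_a1 + z\<bar> \<le> (1 + \<bar>airy_a1\<bar>) * (1 + z)"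
    proof -
      have "0 \<le> \<bar>airy_a1\<bar> * z" using z by simp
      moreover have "\<bar>airy_a1 + z\<bar> \<le> \<bar>airy_a1\<bar> + z" using z by linarith
      moreover have "(1 + \<bar>airy_a1\<bar>) * (1 + z) = 1 + z + \<bar>airy_a1\<bar> + \<bar>airy_a1\<bar> * z"
        by (simp add: algebra_simps)
      ultimately show ?thesis by linarith
    qed
    have "\<bar>cc * (airy_a1 + z) ^ 2\<bar> \<le> \<bar>cc\<bar> * (1 + \<bar>airy_a1\<bar>) ^ 2 * (1 + z) ^ 2"
    proof -
      have "(airy_a1 + z) ^ 2 \<le> ((1 + \<bar>airy_a1\<bar>) * (1 + z)) ^ 2"
        using ax z by (intro power2_le_iff_abs_le[THEN iffD2]) auto
      then show ?thesis by (simp add: abs_mult power_mult_distrib mult_left_mono mult.assoc)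
    qed
    moreover have "\<bar>dd * (airy_a1 + z)\<bar> \<le> \<bar>dd\<bar> * (1 + \<bar>airy_a1\<bar>) * (1 + z) ^ 2"
    proof -
      have "\<bar>dd * (airy_a1 + z)\<bar> \<le> \<bar>dd\<bar> * ((1 + \<bar>airy_a1\<bar>) * (1 + z))"
        unfolding abs_mult using ax by (intro mult_left_mono) auto
      also have "\<dots> \<le> \<bar>dd\<bar> * ((1 + \<bar>airy_a1\<bar>) * (1 + z) ^ 2)"
        using z2 by (intro mult_left_mono) auto
      finally show ?thesis by (simp add: mult.assoc)
    qed
    ultimately have p: "\<bar>cc * (airy_a1 + z) ^ 2 + dd * (airy_a1 + z)\<bar>
       \<le> (\<bar>cc\<bar> * (1 + \<bar>airy_a1\<bar>) ^ 2 + \<bar>dd\<bar> * (1 + \<bar>airy_a1\<bar>)) * (1 + z) ^ 2"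
      using abs_triangle_ineq[of "cc * (airy_a1 + z) ^ 2" "dd * (airy_a1 + z)"]
      unfolding distrib_right by linarith
    have 1: "\<bar>bb n * (cc * (airy_a1 + z) ^ 2 + dd * (airy_a1 + z))\<bar>
      \<le> bet * ((\<bar>cc\<bar> * (1 + \<bar>airy_a1\<bar>) ^ 2 + \<bar>dd\<bar> * (1 + \<bar>airy_a1\<bar>)) * (1 + z) ^ 2)"
      unfolding abs_mult using p b bet_pos by (intro mult_mono) auto
    have "\<bar>\<eta> * tt n ^ 7 * z\<bar> = \<bar>\<eta>\<bar> * (tt n ^ 7 * z)" using z t by (simp add: abs_mult)
    also have "\<dots> \<le> \<bar>\<eta>\<bar> * (1 * (1 + z) ^ 2)"
      using z z2 t by (intro mult_left_mono mult_mono power_le_one) auto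
    finally have 2: "\<bar>\<eta> * tt n ^ 7 * z\<bar> \<le> \<bar>\<eta>\<bar> * (1 + z) ^ 2" by simp
    have "\<bar>gg \<eta> n z\<bar> \<le> 1 + \<bar>bb n * (cc * (airy_a1 + z) ^ 2 + dd * (airy_a1 + z))\<bar> + \<bar>\<eta> * tt n ^ 7 * z\<bar>"
      unfolding gg_def by linarith
    also have "\<dots> \<le> B * (1 + z) ^ 2"
      unfolding B_def distrib_right using 1 2 z2(1) by (simp add: mult.assoc distrib_right)
    finally have g: "\<bar>gg \<eta> n z\<bar> \<le> B * (1 + z) ^ 2" .
    have ex: "(1 + z) ^ 2 \<le> 16 * exp (z / 2)"
    proof -
      have "1 + z \<le> 4 * (1 + z / 4)" using z by simp
      also have "\<dots> \<le> 4 * exp (z / 4)" by (intro mult_left_mono exp_ge_add_one_self) auto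
      finally have "(1 + z) ^ 2 \<le> (4 * exp (z / 4)) ^ 2" using z by (intro power_mono) auto
      also have "\<dots> = 16 * exp (z / 4) ^ 2" by (simp add: power_mult_distrib)
      also have "exp (z / 4) ^ 2 = exp (z / 2)" by (simp flip: exp_of_nat_mult)
      finally show ?thesis .
    qed
    have "\<bar>Y \<eta> n M\<bar> = \<bar>gg \<eta> n z\<bar> * airy_Ai (airy_a1 + z)"
      using airy_Ai_nonneg[of "airy_a1 + z"] z by (simp add: Y_def z_def abs_mult)
    also have "\<dots> \<le> (B * (16 * exp (z / 2))) * (A * exp (- z))"
      using g ex A(2)[of "airy_a1 + z"] z B airy_Ai_nonneg[of "airy_a1 + z"]
      by (intro mult_mono order.trans[OF g mult_left_mono[OF ex]]) auto
    also have "\<dots> = 16 * B * A * (exp (z / 2) * exp (- z))" by simp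
    also have "exp (z / 2) * exp (- z) = exp (- z / 2)" by (simp flip: exp_add)
    finally show ?thesis by (simp add: z_def)
  qed
  moreover have "16 * B * A > 0" using A B by simp
  ultimately show ?thesis by blast
qed

lemma bb_antimono: "1 \<le> n \<Longrightarrow> n \<le> n' \<Longrightarrow> bb n' \<le> bb n"
  unfolding bb_def tt_def using bet_pos by (intro mult_left_mono power_mono powr_mono2') auto

lemma Y_outer:
  assumes "q \<ge> 1"
  shows "\<forall>\<^sub>F n in at_top. \<forall>M\<ge>1. \<not> inner_zone q n M \<longrightarrow>
    \<bar>Y \<eta> n M\<bar> \<le> tt n ^ 30 \<and> (M \<le> n + 1 \<longrightarrow> \<bar>step (Y \<eta>) n M\<bar> \<le> tt n ^ 30)"
proof -
  obtain C where C: "C > 0" "\<And>n M. n \<ge> 1 \<Longrightarrow> M \<ge> 0 \<Longrightarrow> \<bar>Y \<eta> n M\<bar> \<le> C * exp (- zz n M / 2)"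
    using Y_le_exp by blast
  define D where "D = 3 * C * exp (bet / 2)"
  have D: "D > 0" using C by (simp add: D_def)
  have CD: "C \<le> D"
  proof -
    have "1 \<le> exp (bet / 2)" using bet_pos by simp
    then have "1 \<le> 3 * exp (bet / 2)" by linarith
    then show ?thesis using C(1) by (simp add: D_def)
  qed
  \<comment> \<open>Outside the inner zone \<open>(1 + z) ^ p\<close> exceeds \<open>t\<close> to
    the power - 31; the power beyond 30 absorbs the constant \<open>c\<close>.\<close>
  define p where "p = 31 * q"
  have p: "p > 0" using assms by (simp add: p_def)
  define c where "c = D * real (2 * p) ^ p"
  have c: "c > 0" using D p by (simp add: c_def)
  have ec: "\<forall>\<^sub>F n in at_top. tt n < 1 / c" using c by (intro tt_eventually_small) simp
  show ?thesis
    using eventually_ge_at_top[of "K + 2"] ec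
  proof eventually_elim
    case (elim n)
    have n1: "n \<ge> 1" "n \<ge> K" "n \<ge> 2" "n - 1 \<ge> 1" using elim(1) K by auto
    note t = tt_pos[OF n1(1)] tt_le_1[OF n1(1)]
    show ?case
    proof (intro allI impI)
      fix M assume M: "M \<ge> 1" and out: "\<not> inner_zone q n M"
      let ?z = "zz n M"
      have z: "?z \<ge> 0" using zz_nonneg[OF n1(1)] M by simp
      have big_z: "(1 + ?z) ^ p \<ge> 1 / tt n ^ 31"
      proof -
        have "(1 / tt n) ^ 31 \<le> ((1 + ?z) ^ q) ^ 31"
          using out t by (intro power_mono) (auto simp: inner_zone_def)
        also have "\<dots> = (1 + ?z) ^ p" unfolding p_def power_mult[symmetric] by (simp add: mult.commute)
        finally show ?thesis by (simp add: power_divide)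
      qed
      have "((1 + ?z) / real (2 * p)) ^ p \<le> (1 + (?z / 2) / real p) ^ p"
      proof (intro power_mono)
        have "1 \<le> 2 * real p" using p by simp
        then show "(1 + ?z) / real (2 * p) \<le> 1 + (?z / 2) / real p"
          using p by (simp add: field_simps)
      qed (use z in auto)
      also have "\<dots> \<le> exp (?z / 2)" using z p by (intro exp_ge_one_plus_x_over_n_power_n) auto
      finally have "(1 + ?z) ^ p \<le> real (2 * p) ^ p * exp (?z / 2)"
        using p by (simp add: power_divide field_simps)
      then have "1 / tt n ^ 31 \<le> real (2 * p) ^ p * exp (?z / 2)" using big_z by linarith
      then have "exp (- ?z / 2) \<le> real (2 * p) ^ p * tt n ^ 31"
        using t by (simp add: exp_minus field_simps)
      then have "D * exp (- ?z / 2) \<le> D * (real (2 * p) ^ p * tt n ^ 31)"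
        using D by (intro mult_left_mono) auto
      also have "\<dots> = (c * tt n) * tt n ^ 30"
        using power_Suc[of "tt n" 30] by (simp add: c_def mult.assoc)
      also have "\<dots> \<le> 1 * tt n ^ 30"
        using elim(2) c t by (intro mult_right_mono) (auto simp: field_simps)
      finally have small: "D * exp (- ?z / 2) \<le> tt n ^ 30" by simp
      have "\<bar>Y \<eta> n M\<bar> \<le> C * exp (- ?z / 2)" using C(2)[of n M] n1 M by simp
      also have "\<dots> \<le> D * exp (- ?z / 2)" using CD by (intro mult_right_mono) auto
      finally have 1: "\<bar>Y \<eta> n M\<bar> \<le> tt n ^ 30" using small by linarith
      \<comment> \<open>Going back one step lowers the scaled height by at most \<open>bet\<close>,
        because \<open>bb\<close> is larger at earlier times and \<open>j \<ge> - 1\<close>.\<close>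
      have pred: "\<bar>Y \<eta> (n - 1) (M + j)\<bar> \<le> C * (exp (bet / 2) * exp (- ?z / 2))" if j: "j \<ge> - 1" for j
      proof -
        have "?z - bet \<le> bb n * (M - 1)"
          using bb_antimono[of 1 n] n1(1) by (simp add: zz_def algebra_simps bb_def tt_def)
        also have "\<dots> \<le> bb (n - 1) * (M + j)"
          using bb_antimono[of "n - 1" n] bb_pos[of "n - 1"] n1 M j by (intro mult_mono) auto
        finally have "- zz (n - 1) (M + j) / 2 \<le> bet / 2 + (- ?z / 2)" by (simp add: zz_def)
        then have "exp (- zz (n - 1) (M + j) / 2) \<le> exp (bet / 2) * exp (- ?z / 2)"
          unfolding exp_add[symmetric] by simp
        then have "C * exp (- zz (n - 1) (M + j) / 2) \<le> C * (exp (bet / 2) * exp (- ?z / 2))"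
          using C(1) by (intro mult_left_mono) auto
        moreover have "\<bar>Y \<eta> (n - 1) (M + j)\<bar> \<le> C * exp (- zz (n - 1) (M + j) / 2)"
          using C(2)[of "n - 1" "M + j"] n1 M j by simp
        ultimately show ?thesis by linarith
      qed
      let ?E = "C * (exp (bet / 2) * exp (- ?z / 2))"
      have E: "?E \<ge> 0" using C by simp
      have 2: "\<bar>step (Y \<eta>) n M\<bar> \<le> tt n ^ 30" if M': "M \<le> n + 1"
      proof -
        note M = M M'
        have "\<bar>step (Y \<eta>) n M\<bar> \<le> w1 n M * \<bar>Y \<eta> (n - 1) (M + - 1)\<bar> + 1 / K * \<bar>Y \<eta> (n - 1) (M + (K - 1))\<bar>"
          unfolding step_def avg_def
          using abs_triangle_ineq[of "w1 n M * Y \<eta> (n - 1) (M + - 1)" "1 / K * Y \<eta> (n - 1) (M + (K - 1))"]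
            w1_bounds(1)[OF n1(2) M] K by (simp add: abs_mult)
        also have "\<dots> \<le> 2 * ?E + 1 * ?E"
          using w1_bounds(1,2)[OF n1(2) M] pred[of "-1"] pred[of "K - 1"] K E
          by (intro add_mono mult_mono) auto
        also have "\<dots> = D * exp (- ?z / 2)" by (simp add: D_def)
        finally show ?thesis using small by linarith
      qed
      from 1 2 show "\<bar>Y \<eta> n M\<bar> \<le> tt n ^ 30 \<and> (M \<le> n + 1 \<longrightarrow> \<bar>step (Y \<eta>) n M\<bar> \<le> tt n ^ 30)" by blast
    qed
  qed
qed

text \<open>The signed defect of \<open>Y + \<sigma> Z\<close>: near the wall the margin of \<open>Y\<close> absorbs \<open>Z\<close>, far out the
  killing makes the margin of \<open>Z\<close> absorb \<open>Y\<close>, and in between both margins have the right sign.\<close>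

lemma barrier_defect:
  assumes \<sigma>: "\<sigma> = 1 \<or> \<sigma> = - 1"
  shows "\<exists>q\<ge>1. \<forall>\<^sub>F n in at_top. \<forall>M\<ge>1.
    (inner_zone q n M \<longrightarrow> Y (- \<sigma>) n M \<ge> 0) \<and>
    (\<not> inner_zone q n M \<longrightarrow> \<bar>Y (- \<sigma>) n M\<bar> < Z n) \<and>
    (M \<le> n + 1 \<longrightarrow> \<sigma> = 1 \<or> inner_zone q n M \<longrightarrow>
     \<sigma> * (rho \<sigma> n * Y (- \<sigma>) n M - step (Y (- \<sigma>)) n M)
     + (rho \<sigma> n * Z n - avg (\<lambda>j. 1) n M * Z (n - 1)) \<ge> 0)"
proof -
  obtain c q0 where c: "c > 0" and m: "\<And>q. q \<ge> q0 \<Longrightarrow> \<forall>\<^sub>F n in at_top. \<forall>M\<ge>1. inner_zone q n M \<longrightarrow>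
    gg (- \<sigma>) n (zz n M) \<ge> 1 / 2 \<and>
    \<sigma> * (rho \<sigma> n * Y (- \<sigma>) n M - step (Y (- \<sigma>)) n M)
      \<ge> c * tt n ^ 15 * (airy_Ai (xx n M) + max (airy_Ai' (xx n M)) 0)"
    using Y_margin[OF \<sigma>] by blast
  define q where "q = q0 + 1"
  obtain z0 where z0: "\<forall>\<^sub>F n in at_top. \<forall>M\<ge>1. M \<le> n + 1 \<longrightarrow>
     rho \<sigma> n * Z n - avg (\<lambda>j. 1) n M * Z (n - 1) \<ge> - 4 * tt n ^ 20 \<and>
     (zz n M \<ge> z0 \<longrightarrow> rho \<sigma> n * Z n - avg (\<lambda>j. 1) n M * Z (n - 1) \<ge> tt n ^ 28)"
    using Z_barrier by blast
  obtain c' where c': "c' > 0" "\<And>x. x \<ge> airy_a1 \<Longrightarrow> x \<le> airy_a1 + z0 \<Longrightarrow> c' \<le> airy_Ai x + max (airy_Ai' x) 0"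
    using airy_Ai_compact_lower by blast
  have q1: "q \<ge> 1" "q \<ge> q0" by (simp_all add: q_def)
  \<comment> \<open>The inner zone eventually contains every bounded scaled height, so the two
    regions where a margin is available cover everything.\<close>
  have cut: "\<forall>\<^sub>F n in at_top. \<forall>M\<ge>1. inner_zone q n M \<or> zz n M \<ge> z0"
  proof -
    have "\<forall>\<^sub>F n in at_top. tt n < 1 / (1 + \<bar>z0\<bar>) ^ q" by (intro tt_eventually_small) simp
    then show ?thesis using eventually_ge_at_top[of 1]
    proof eventually_elim
      case (elim n)
      show ?case
      proof (intro allI impI disjCI)
        fix M :: real assume M: "M \<ge> 1" "\<not> zz n M \<ge> z0"
        have "zz n M \<ge> 0" using zz_nonneg[OF elim(2)] M by simp
        then have "(1 + zz n M) ^ q \<le> (1 + \<bar>z0\<bar>) ^ q" using M by (intro power_mono) auto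
        also have "\<dots> \<le> 1 / tt n" using elim tt_pos[of n] by (simp add: field_simps)
        finally show "inner_zone q n M" by (simp add: inner_zone_def)
      qed
    qed
  qed
  have e1: "\<forall>\<^sub>F n in at_top. tt n < min (1 / 2) (c * c' / 4)"
    using c c' by (intro tt_eventually_small) simp
  obtain C where C: "\<forall>\<^sub>F n in at_top. \<bar>rho \<sigma> n - 1\<bar> \<le> C * tt n ^ 8" "C > 0"
    using rho_near_1 by blast
  have e2: "\<forall>\<^sub>F n in at_top. tt n < 1 / C" using C by (intro tt_eventually_small) simp
  have "\<forall>\<^sub>F n in at_top. \<forall>M\<ge>1.
    (inner_zone q n M \<longrightarrow> Y (- \<sigma>) n M \<ge> 0) \<and>
    (\<not> inner_zone q n M \<longrightarrow> \<bar>Y (- \<sigma>) n M\<bar> < Z n) \<and>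
    (M \<le> n + 1 \<longrightarrow> \<sigma> = 1 \<or> inner_zone q n M \<longrightarrow>
     \<sigma> * (rho \<sigma> n * Y (- \<sigma>) n M - step (Y (- \<sigma>)) n M)
     + (rho \<sigma> n * Z n - avg (\<lambda>j. 1) n M * Z (n - 1)) \<ge> 0)"
    using m[OF q1(2)] z0 cut e1 C(1) e2 Y_outer[OF q1(1), of "- \<sigma>"] eventually_ge_at_top[of 2]
  proof eventually_elim
    case (elim n)
    have n1: "n \<ge> 1" using elim by simp
    note t = tt_pos[OF n1] tt_le_1[OF n1]
    have th: "tt n \<le> 1 / 2" using elim(4) by simp
    have t30: "tt n ^ 30 < Z n"
      unfolding Z_def using t th by (intro power_strict_decreasing) auto
    have rho2: "\<bar>rho \<sigma> n\<bar> \<le> 2"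
    proof -
      have "C * tt n ^ 8 \<le> C * tt n ^ 1" using C t by (intro mult_left_mono power_decreasing) auto
      also have "\<dots> \<le> 1" using elim(6) C(2) by (simp add: field_simps)
      finally show ?thesis using elim(5) by linarith
    qed
    show ?case
    proof (intro allI impI)
      fix M :: real assume M: "M \<ge> 1"
      let ?D = "\<sigma> * (rho \<sigma> n * Y (- \<sigma>) n M - step (Y (- \<sigma>)) n M)"
      let ?E = "rho \<sigma> n * Z n - avg (\<lambda>j. 1) n M * Z (n - 1)"
      have x: "xx n M \<ge> airy_a1" using zz_nonneg[OF n1, of M] M by (simp add: xx_def)
      have P1: "Y (- \<sigma>) n M \<ge> 0" if "inner_zone q n M"
      proof -
        have "gg (- \<sigma>) n (zz n M) \<ge> 1 / 2" using elim(1) M that by blast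
        then show ?thesis using airy_Ai_nonneg[OF x] by (simp add: Y_def xx_def)
      qed
      have out: "\<bar>Y (- \<sigma>) n M\<bar> \<le> tt n ^ 30" "M \<le> n + 1 \<longrightarrow> \<bar>step (Y (- \<sigma>)) n M\<bar> \<le> tt n ^ 30"
        if "\<not> inner_zone q n M" using elim(7) M that by blast+
      have P2: "\<bar>Y (- \<sigma>) n M\<bar> < Z n" if "\<not> inner_zone q n M"
        using out(1)[OF that] t30 by linarith
      have P3: "?D + ?E \<ge> 0" if M': "M \<le> n + 1"
      proof -
        note M = M M'
        have E1: "?E \<ge> - 4 * tt n ^ 20" and E2: "zz n M \<ge> z0 \<Longrightarrow> ?E \<ge> tt n ^ 28"
          using elim(2) M by blast+
        show ?thesis
        proof (cases "inner_zone q n M")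
          case True
          have D: "?D \<ge> c * tt n ^ 15 * (airy_Ai (xx n M) + max (airy_Ai' (xx n M)) 0)"
            using elim(1) M True by blast
          show ?thesis
          proof (cases "zz n M \<ge> z0")
            case True
            have "c * tt n ^ 15 * (airy_Ai (xx n M) + max (airy_Ai' (xx n M)) 0) \<ge> 0"
              using c t airy_Ai_nonneg[OF x] by (intro mult_nonneg_nonneg) auto
            moreover have "tt n ^ 28 \<ge> 0" using t by simp
            ultimately show ?thesis using D E2[OF True] by linarith
          next
            case False
            have "c' \<le> airy_Ai (xx n M) + max (airy_Ai' (xx n M)) 0"
              using c'(2)[OF x] False by (simp add: xx_def)
            then have "c * tt n ^ 15 * c' \<le> c * tt n ^ 15 * (airy_Ai (xx n M) + max (airy_Ai' (xx n M)) 0)"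
              using c t by (intro mult_left_mono) auto
            moreover have "4 * tt n ^ 20 \<le> c * tt n ^ 15 * c'"
            proof -
              have "tt n ^ 20 \<le> tt n ^ 16" using t by (intro power_decreasing) auto
              then have "4 * tt n ^ 20 \<le> 4 * tt n * tt n ^ 15" by (simp add: eval_nat_numeral)
              also have "\<dots> \<le> (c * c') * tt n ^ 15" using elim(4) t by (intro mult_right_mono) auto
              finally show ?thesis by (simp add: mult_ac)
            qed
            ultimately show ?thesis using D E1 by linarith
          qed
        next
          case False
          have "\<bar>rho \<sigma> n * Y (- \<sigma>) n M\<bar> \<le> 2 * tt n ^ 30"
            unfolding abs_mult using rho2 out(1)[OF False] by (intro mult_mono) auto
          then have "\<bar>rho \<sigma> n * Y (- \<sigma>) n M - step (Y (- \<sigma>)) n M\<bar> \<le> 3 * tt n ^ 30"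
            using out(2)[OF False] M by linarith
          moreover have "\<bar>?D\<bar> = \<bar>rho \<sigma> n * Y (- \<sigma>) n M - step (Y (- \<sigma>)) n M\<bar>"
            using \<sigma> by (auto simp: abs_mult)
          moreover have "3 * tt n ^ 30 \<le> tt n ^ 28"
          proof -
            have "3 * (tt n) ^ 2 \<le> 3 * (1 / 2) ^ 2" using t th by (intro mult_left_mono power_mono) auto
            then have "3 * (tt n) ^ 2 \<le> 1" by (simp add: power2_eq_square)
            then have "(3 * (tt n) ^ 2) * tt n ^ 28 \<le> 1 * tt n ^ 28" using t by (intro mult_right_mono) auto
            then show ?thesis by (simp add: mult.assoc flip: power_add)
          qed
          moreover have "zz n M \<ge> z0" using elim(3) M False by blast
          ultimately show ?thesis using E2 by linarith
        qed
      qed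
      from P1 P2 P3 show "(inner_zone q n M \<longrightarrow> Y (- \<sigma>) n M \<ge> 0) \<and>
        (\<not> inner_zone q n M \<longrightarrow> \<bar>Y (- \<sigma>) n M\<bar> < Z n) \<and>
        (M \<le> n + 1 \<longrightarrow> \<sigma> = 1 \<or> inner_zone q n M \<longrightarrow> ?D + ?E \<ge> 0)" by blast
    qed
  qed
  with q1 show ?thesis by blast
qed

end

section \<open>Construction of the two barriers\<close>

context barrier
begin

lemma bb_tendsto: "(bb \<longlongrightarrow> 0) at_top"
proof -
  have "((\<lambda>n. bet * tt n ^ 4) \<longlongrightarrow> bet * 0 ^ 4) at_top"
    by (intro tendsto_intros tt_tendsto_0)
  then show ?thesis by (simp add: bb_def[abs_def])
qed

text \<open>\<open>M = 1\<close> is the row \<open>m = 0\<close> of complete trees. The difference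
  quotient of \<open>Ai\<close> at its zero shows that the profile there has size
  \<open>bb n\<close>, the source of an extra \<open>n powr (- 1 / 3)\<close>.\<close>

lemma Y_bottom: "((\<lambda>n. Y \<eta> n 1 / bb n) \<longlongrightarrow> airy_Ai' airy_a1) at_top"
proof -
  have "((\<lambda>h. (airy_Ai (airy_a1 + h) - airy_Ai airy_a1) / h) \<longlongrightarrow> airy_Ai' airy_a1) (at 0)"
    using airy_Ai_deriv(1)[of airy_a1] by (simp add: DERIV_def)
  moreover have "filterlim bb (at 0) at_top"
    by (rule filterlim_atI[OF bb_tendsto])
      (use bb_pos in \<open>force simp: eventually_at_top_linorder intro!: exI[of _ 1]\<close>)
  ultimately have 1: "((\<lambda>n. airy_Ai (airy_a1 + bb n) / bb n) \<longlongrightarrow> airy_Ai' airy_a1) at_top"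
    using airy_a1(1) by (auto dest: filterlim_compose)
  have "((\<lambda>n. gg \<eta> n (bb n)) \<longlongrightarrow>
     1 + 0 * (cc * (airy_a1 + 0) ^ 2 + dd * (airy_a1 + 0)) + \<eta> * 0 ^ 7 * 0) at_top"
    unfolding gg_def by (intro tendsto_intros bb_tendsto tt_tendsto_0)
  then have "((\<lambda>n. gg \<eta> n (bb n) * (airy_Ai (airy_a1 + bb n) / bb n)) \<longlongrightarrow> 1 * airy_Ai' airy_a1) at_top"
    by (intro tendsto_mult 1) simp
  then show ?thesis by (simp add: Y_def zz_def)
qed

lemma Z_small: "((\<lambda>n. Z n / bb n) \<longlongrightarrow> 0) at_top"
proof -
  have "((\<lambda>n. tt n ^ 16 / bet) \<longlongrightarrow> 0 ^ 16 / bet) at_top"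
    using bet_pos by (intro tendsto_intros tt_tendsto_0) auto
  moreover have "\<forall>\<^sub>F n in at_top. tt n ^ 16 / bet = Z n / bb n"
    using eventually_ge_at_top[of 1]
  proof eventually_elim
    case (elim n)
    have "tt n ^ 20 = tt n ^ 16 * tt n ^ 4" by (simp flip: power_add)
    show ?case unfolding Z_def bb_def \<open>tt n ^ 20 = _\<close> 
      by (rule nonzero_mult_divide_mult_cancel_right[symmetric]) (use tt_pos[OF elim] in simp)
  qed
  ultimately show ?thesis using tendsto_cong by force
qed

lemma Y_wall: "Y \<eta> n 0 = 0"
  by (simp add: Y_def zz_def airy_a1)

text \<open>The supersolution is \<open>Y + Z\<close>: \<open>Z\<close> keeps it positive where the
  sign of \<open>Y\<close> is not controlled. At the wall it need only be nonnegative, as a missing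
  predecessor counts as 0.\<close>

lemma upper_barrier:
  "\<exists>X C n0. \<forall>n\<ge>n0. X n 0 \<ge> 0 \<and> X n 1 \<le> C * bb n \<and>
     (\<forall>M\<ge>1. X n M > 0 \<and> (M \<le> n + 1 \<longrightarrow> step X n M \<le> rho 1 n * X n M))"
proof -
  define X where "X = (\<lambda>n M. Y (- 1) n M + Z n)"
  define C where "C = airy_Ai' airy_a1 + 1"
  obtain q where q: "\<forall>\<^sub>F n in at_top. \<forall>M\<ge>1.
    (inner_zone q n M \<longrightarrow> Y (- 1) n M \<ge> 0) \<and> (\<not> inner_zone q n M \<longrightarrow> \<bar>Y (- 1) n M\<bar> < Z n) \<and>
    (M \<le> n + 1 \<longrightarrow> (1::real) = 1 \<or> inner_zone q n M \<longrightarrow> 1 * (rho 1 n * Y (- 1) n M - step (Y (- 1)) n M)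
     + (rho 1 n * Z n - avg (\<lambda>j. 1) n M * Z (n - 1)) \<ge> 0)"
    using barrier_defect[of 1] by auto
  have "((\<lambda>n. Y (- 1) n 1 / bb n + Z n / bb n) \<longlongrightarrow> airy_Ai' airy_a1 + 0) at_top"
    by (intro tendsto_add Y_bottom Z_small)
  then have lim: "\<forall>\<^sub>F n in at_top. Y (- 1) n 1 / bb n + Z n / bb n < C"
    by (rule order_tendstoD(2)) (simp add: C_def)
  have "\<forall>\<^sub>F n in at_top. X n 0 \<ge> 0 \<and> X n 1 \<le> C * bb n \<and>
     (\<forall>M\<ge>1. X n M > 0 \<and> (M \<le> n + 1 \<longrightarrow> step X n M \<le> rho 1 n * X n M))"
    using q lim eventually_ge_at_top[of 1]
  proof eventually_elim
    case (elim n)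
    have Zn: "Z n > 0" using tt_pos[OF elim(3)] by (simp add: Z_def)
    have "X n 1 \<le> C * bb n"
      using elim(2) bb_pos[OF elim(3)] by (simp add: X_def field_simps)
    moreover have "X n M > 0" if "M \<ge> 1" for M
      using elim(1) that Zn unfolding X_def
      by (cases "inner_zone q n M") (auto simp: abs_less_iff intro: add_nonneg_pos)
    moreover have "step X n M \<le> rho 1 n * X n M" if "M \<ge> 1" "M \<le> n + 1" for M
    proof -
      have "step X n M = step (Y (- 1)) n M + avg (\<lambda>j. 1) n M * Z (n - 1)"
        by (simp add: step_def avg_def X_def algebra_simps)
      moreover have "1 * (rho 1 n * Y (- 1) n M - step (Y (- 1)) n M)
        + (rho 1 n * Z n - avg (\<lambda>j. 1) n M * Z (n - 1)) \<ge> 0" using elim(1) that by blast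
      ultimately show ?thesis by (simp add: X_def algebra_simps)
    qed
    ultimately show ?case using Zn by (auto simp: X_def Y_wall)
  qed
  then show ?thesis unfolding eventually_at_top_linorder by blast
qed

text \<open>At height \<open>n\<close> the scaled height is \<open>bet\<close> times
  \<open>t\<close> to the power - 8, far beyond \<open>1 / t\<close>. This lets the subsolution
  vanish at heights that no code can have.\<close>

lemma top_not_inner:
  assumes "q \<ge> 1" shows "\<forall>\<^sub>F n in at_top. \<forall>M\<ge>n + 1. \<not> inner_zone q n M"
proof -
  have "\<forall>\<^sub>F n in at_top. tt n < min 1 bet" using bet_pos by (intro tt_eventually_small) simp
  then show ?thesis using eventually_ge_at_top[of 1]
  proof eventually_elim
    case (elim n)
    note t = tt_pos[OF elim(2)]
    have t12: "n * tt n ^ 12 = 1" using tt_power_12[OF elim(2)] elim(2) by simp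
    show ?case
    proof (intro allI impI notI)
      fix M assume M: "M \<ge> n + 1" "inner_zone q n M"
      have "bb n * n \<le> zz n M" using bb_pos[OF elim(2)] M by (simp add: zz_def)
      moreover have z: "zz n M \<ge> 0" using zz_nonneg[OF elim(2)] M elim by simp
      moreover have "1 + zz n M \<le> (1 + zz n M) ^ q"
        using z assms self_le_power[of "1 + zz n M" q] by simp
      ultimately have "bb n * n < 1 / tt n" using M(2) by (simp add: inner_zone_def)
      then have "bb n * n * tt n < 1" using t by (simp add: field_simps)
      then have "bb n * n * tt n * tt n ^ 7 < 1 * tt n ^ 7" using t by (intro mult_strict_right_mono) auto
      moreover have "bb n * n * tt n * tt n ^ 7 = bet * (n * tt n ^ 12)"
        by (simp add: bb_def eval_nat_numeral)
      moreover have "tt n ^ 7 \<le> tt n ^ 1" using t elim(1) by (intro power_decreasing) auto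
      ultimately show False using t12 elim(1) by simp
    qed
  qed
qed

text \<open>The subsolution is the positive part of \<open>Y - Z\<close>. Where it is positive the
  point lies in the inner zone and the defect has the right sign; elsewhere the inequality is
  trivial, and since the weights are nonnegative, truncating the predecessors at 0 only raises the
  step.\<close>

lemma lower_barrier:
  "\<exists>X c n0. c > 0 \<and> (\<forall>n\<ge>n0. X n 0 = 0 \<and> X n 1 \<ge> c * bb n \<and>
     (\<forall>M\<ge>1. X n M \<ge> 0 \<and> (M \<ge> n + 1 \<longrightarrow> X n M = 0) \<and> (M \<le> n + 1 \<longrightarrow> rho (- 1) n * X n M \<le> step X n M)))"
proof -
  define X where "X = (\<lambda>n M. max 0 (Y 1 n M - Z n))"
  define c where "c = airy_Ai' airy_a1 / 2"
  have c: "c > 0" using airy_Ai'_a1_pos by (simp add: c_def)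
  obtain q where q1: "q \<ge> 1" and q: "\<forall>\<^sub>F n in at_top. \<forall>M\<ge>1.
    (inner_zone q n M \<longrightarrow> Y (- (- 1)) n M \<ge> 0) \<and> (\<not> inner_zone q n M \<longrightarrow> \<bar>Y (- (- 1)) n M\<bar> < Z n) \<and>
    (M \<le> n + 1 \<longrightarrow> (- 1::real) = 1 \<or> inner_zone q n M \<longrightarrow> - 1 * (rho (- 1) n * Y (- (- 1)) n M - step (Y (- (- 1))) n M)
     + (rho (- 1) n * Z n - avg (\<lambda>j. 1) n M * Z (n - 1)) \<ge> 0)"
    using barrier_defect[of "- 1"] by blast
  have "((\<lambda>n. Y 1 n 1 / bb n - Z n / bb n) \<longlongrightarrow> airy_Ai' airy_a1 - 0) at_top"
    by (intro tendsto_diff Y_bottom Z_small)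
  then have lim: "\<forall>\<^sub>F n in at_top. Y 1 n 1 / bb n - Z n / bb n > c"
    by (rule order_tendstoD(1)) (use airy_Ai'_a1_pos in \<open>simp add: c_def\<close>)
  have "\<forall>\<^sub>F n in at_top. X n 0 = 0 \<and> X n 1 \<ge> c * bb n \<and>
     (\<forall>M\<ge>1. X n M \<ge> 0 \<and> (M \<ge> n + 1 \<longrightarrow> X n M = 0) \<and> (M \<le> n + 1 \<longrightarrow> rho (- 1) n * X n M \<le> step X n M))"
    using q lim eventually_ge_at_top[of "K + 2"] top_not_inner[OF q1]
  proof eventually_elim
    case (elim n)
    have n: "n \<ge> 1" "n \<ge> K" using elim(3) K by auto
    have Zn: "Z n > 0" using tt_pos[OF n(1)] by (simp add: Z_def)
    have "c * bb n \<le> Y 1 n 1 - Z n"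
      using elim(2) bb_pos[OF n(1)] by (simp add: field_simps)
    then have "c * bb n \<le> X n 1" by (simp add: X_def)
    moreover have zero: "X n M = 0" if "M \<ge> 1" "\<not> inner_zone q n M" for M
    proof -
      have "\<bar>Y 1 n M\<bar> < Z n" using elim(1) that by simp
      then show ?thesis by (simp add: X_def)
    qed
    moreover have "rho (- 1) n * X n M \<le> step X n M" if M: "M \<ge> 1" "M \<le> n + 1" for M
    proof -
      have w: "w1 n M \<ge> 0" using w1_bounds(1)[OF n(2) M] .
      have K0: "1 / K \<ge> 0" using K by simp
      have pos: "step X n M \<ge> 0" using w K0 by (simp add: step_def avg_def X_def)
      show ?thesis
      proof (cases "X n M = 0")
        case False
        then have inn: "inner_zone q n M" using zero M by blast
        have XY: "X n M = Y 1 n M - Z n" using False by (auto simp: X_def max_def split: if_splits)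
        have "- 1 * (rho (- 1) n * Y (- (- 1)) n M - step (Y (- (- 1))) n M)
         + (rho (- 1) n * Z n - avg (\<lambda>j. 1) n M * Z (n - 1)) \<ge> 0" using elim(1) M inn by blast
        then have "rho (- 1) n * X n M \<le> step (Y 1) n M - avg (\<lambda>j. 1) n M * Z (n - 1)"
          unfolding XY by (simp add: algebra_simps)
        also have "\<dots> = avg (\<lambda>j. Y 1 (n - 1) (M + j) - Z (n - 1)) n M"
          by (simp add: step_def avg_def algebra_simps diff_divide_distrib)
        also have "\<dots> \<le> step X n M"
          unfolding step_def avg_def X_def using w K0 by (intro add_mono mult_left_mono) auto
        finally show ?thesis .
      qed (use pos in simp)
    qed
    moreover have "X n M = 0" if "M \<ge> 1" "M \<ge> n + 1" for M
      using zero that elim(4) by blast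
    ultimately show ?case using Zn by (auto simp: X_def Y_wall)
  qed
  then show ?thesis using c unfolding eventually_at_top_linorder by blast
qed

end

section \<open>Comparison\<close>

text \<open>There are \<open>(k - 1) * y + m\<close> pointer steps, each of weight
  \<open>y + 1\<close>, which the factorial compensates. The powers of \<open>k - 1\<close> and of
  \<open>(k - 1) / k\<close> then turn the step weights into approximately
  \<open>(k - 1) / k\<close> and exactly \<open>1 / k\<close>, a centred walk.\<close>

definition norm_codes :: "nat \<Rightarrow> nat \<Rightarrow> nat \<Rightarrow> real" where
  "norm_codes k y m = real (num_codes k y m) * (real k - 1) ^ ((k - 2) * y + m)
     / fact ((k - 1) * y + m) * ((real k - 1) / real k) ^ (k * y + m)"

lemma norm_codes_pos: "k \<ge> 2 \<Longrightarrow> norm_codes k y m > 0"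
  using num_codes_pos[of k y m] by (simp add: norm_codes_def)

lemma barrier_nat: "k \<ge> 2 \<Longrightarrow> barrier (real k)"
  by unfold_locales simp

text \<open>The weight \<open>w1\<close> is (k - 1)/k times (k - 1)(y + 1)/x, where x is the number
  of pointers, rewritten in terms of the time \<open>k * y + m\<close> and the height
  \<open>m + 1\<close>.\<close>

lemma norm_codes_rec:
  assumes k: "k \<ge> 2" and pos: "k * y + m > 0"
  shows "norm_codes k y m =
     barrier.w1 (real k) (real (k * y + m)) (real m + 1) * (if m > 0 then norm_codes k y (m - 1) else 0)
     + 1 / real k * (if y > 0 then norm_codes k (y - 1) (m + k - 1) else 0)"
proof -
  interpret barrier "real k" using k by (rule barrier_nat)
  define x where "x = (k - 1) * y + m"
  define F where "F = (real k - 1) ^ ((k - 2) * y + m) / fact x * ((real k - 1) / real k) ^ (k * y + m)"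
  have k1: "real k - 1 > 0" using k by simp
  have xpos: "x > 0" using pos k by (cases "m = 0") (auto simp: x_def)
  have rec: "real (num_codes k y m) =
    (if m > 0 then (real y + 1) * real (num_codes k y (m - 1)) else 0) +
    (if y > 0 then real (num_codes k (y - 1) (m + k - 1)) else 0)"
    using num_codes_rec[of k y m] k pos by (simp add: algebra_simps)
  have 1: "(real y + 1) * real (num_codes k y (m - 1)) * F = w1 (real (k * y + m)) (real m + 1) * norm_codes k y (m - 1)"
    if m: "m > 0"
  proof -
    obtain m' where m': "m = Suc m'" using m by (cases m) auto
    define x' where "x' = (k - 1) * y + m'"
    have x': "x = Suc x'" by (simp add: x_def x'_def m')
    have rx: "real x = (real k - 1) * real y + real m"
      using k by (simp add: x_def of_nat_diff)
    have xp: "real x > 0" using xpos by simp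
    have den: "real (k * y + m) + (real m + 1 - 1) / (real k - 1) = real k * real x / (real k - 1)"
      unfolding rx using k1 by (simp add: field_simps)
    have num: "real (k * y + m) - (real m + 1 - 1) + real k = real k * (real y + 1)"
      by (simp add: algebra_simps)
    have "w1 (real (k * y + m)) (real m + 1) =
        (real k - 1) / real k * ((real k * (real y + 1)) / (real k * real x / (real k - 1)))"
      unfolding w1_def den num ..
    also have "\<dots> = (real k - 1) / real k * ((real y + 1) * (real k - 1) / real x)"
      using k k1 xp by simp
    finally have w: "w1 (real (k * y + m)) (real m + 1) =
        (real k - 1) / real k * ((real y + 1) * (real k - 1) / real x)" .
    have "F = (real k - 1) / real k * ((real k - 1) / real x) *
        ((real k - 1) ^ ((k - 2) * y + m') / fact x' * ((real k - 1) / real k) ^ (k * y + m'))"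
      using xp unfolding F_def m' x' by (simp add: mult_ac)
    then show ?thesis
      unfolding w by (simp add: norm_codes_def m' x'_def)
  qed
  have 2: "real (num_codes k (y - 1) (m + k - 1)) * F = 1 / real k * norm_codes k (y - 1) (m + k - 1)"
    if y: "y > 0"
  proof -
    obtain y' where y': "y = Suc y'" using y by (cases y) auto
    have e1: "(k - 2) * y' + (m + k - 1) = Suc ((k - 2) * y + m)" using k by (simp add: y')
    have e2: "(k - 1) * y' + (m + k - 1) = x" using k by (simp add: y' x_def)
    have e3: "k * y + m = Suc (k * y' + (m + k - 1))" using k by (simp add: y')
    have Feq: "F = 1 / real k * ((real k - 1) ^ ((k - 2) * y' + (m + k - 1)) / fact x
       * ((real k - 1) / real k) ^ (k * y' + (m + k - 1)))"
      unfolding F_def e1 e3 by (simp add: mult_ac)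
    show ?thesis unfolding Feq norm_codes_def y' diff_Suc_1 e2 by (simp add: mult_ac)
  qed
  have "norm_codes k y m = real (num_codes k y m) * F" by (simp add: norm_codes_def F_def x_def)
  also have "\<dots> = (if m > 0 then (real y + 1) * real (num_codes k y (m - 1)) * F else 0) +
    (if y > 0 then real (num_codes k (y - 1) (m + k - 1)) * F else 0)"
    unfolding rec by (simp add: distrib_right)
  also have "(if m > 0 then (real y + 1) * real (num_codes k y (m - 1)) * F else 0) =
      w1 (real (k * y + m)) (real m + 1) * (if m > 0 then norm_codes k y (m - 1) else 0)"
    by (cases "m > 0") (simp_all only: 1 if_True if_False mult_zero_right)
  also have "(if y > 0 then real (num_codes k (y - 1) (m + k - 1)) * F else 0) =
      1 / real k * (if y > 0 then norm_codes k (y - 1) (m + k - 1) else 0)"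
    by (cases "y > 0") (simp_all only: 2 if_True if_False mult_zero_right)
  finally show ?thesis .
qed

lemma finite_level: "k \<ge> 1 \<Longrightarrow> finite {(y, m). k * y + m = (N::nat)}"
proof (rule finite_subset)
  assume k: "k \<ge> 1"
  show "{(y, m). k * y + m = N} \<subseteq> {..N} \<times> {..N}"
  proof (rule subsetI)
    fix p assume "p \<in> {(y, m). k * y + m = N}"
    then obtain y m where p: "p = (y, m)" "k * y + m = N" by auto
    have "y \<le> k * y" using k by simp
    then have "y \<le> N" "m \<le> N" using p(2) by linarith+
    then show "p \<in> {..N} \<times> {..N}" using p(1) by simp
  qed
qed auto

text \<open>Starts the comparison: only finitely many states share the time \<open>N\<close>, so a
  sum of ratios bounds them all.\<close>

lemma level_ratio_bound:
  fixes f g :: "nat \<Rightarrow> nat \<Rightarrow> real"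
  assumes "k \<ge> 1" "\<And>y m. k * y + m = N \<Longrightarrow> g y m > 0"
  shows "\<exists>C>0. \<forall>y m. k * y + m = N \<longrightarrow> f y m \<le> C * g y m"
proof -
  let ?S = "{(y, m). k * y + m = N}"
  define F where "F = (\<lambda>(y, m). \<bar>f y m\<bar> / g y m)"
  define C where "C = 1 + sum F ?S"
  have nn: "F p \<ge> 0" if "p \<in> ?S" for p
    using that assms(2) by (auto simp: F_def less_imp_le)
  have "f y m \<le> C * g y m" if "k * y + m = N" for y m
  proof -
    have g: "g y m > 0" using assms(2) that .
    have "F (y, m) \<le> sum F ?S"
      by (rule member_le_sum) (use that nn finite_level[OF assms(1)] in auto)
    then have "\<bar>f y m\<bar> / g y m \<le> C" by (simp add: C_def F_def)
    then have "\<bar>f y m\<bar> \<le> C * g y m" using g by (simp add: field_simps)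
    then show ?thesis by linarith
  qed
  moreover have "C > 0" unfolding C_def using sum_nonneg[of ?S F, OF nn] by linarith
  ultimately show ?thesis by blast
qed

text \<open>Comparison principle: the weights are nonnegative, so domination on the level
  \<open>N0\<close> passes from each level to the next, with \<open>hh\<close> accumulating the
  ratios \<open>rho\<close>.\<close>

lemma norm_codes_upper:
  assumes k: "k \<ge> 2"
  shows "\<exists>C N0. \<forall>n\<ge>N0. norm_codes k n 0 \<le> C * (barrier.hh (real k) 1 (real (k * n)) * barrier.bb (real k) (real (k * n)))"
proof -
  interpret barrier "real k" using k by (rule barrier_nat)
  obtain X C n0 where X: "\<And>n. n \<ge> n0 \<Longrightarrow> X n 0 \<ge> 0 \<and> X n 1 \<le> C * bb n \<and>
     (\<forall>M\<ge>1. X n M > 0 \<and> (M \<le> n + 1 \<longrightarrow> step X n M \<le> rho 1 n * X n M))"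
    using upper_barrier by blast
  obtain N0 :: nat where N0: "real N0 \<ge> max (real k + 2) n0" using real_arch_simple by blast
  let ?h = "\<lambda>N. hh 1 (real N)"
  have "\<exists>D>0. \<forall>y m. k * y + m = N0 \<longrightarrow> norm_codes k y m \<le> D * (?h N0 * X (real N0) (real m + 1))"
  proof (rule level_ratio_bound)
    show "?h N0 * X (real N0) (real m + 1) > 0" for m
      using X[of "real N0"] N0 hh_pos[of "real N0"] by simp
  qed (use k in simp)
  then obtain D where D: "D > 0" "\<And>y m. k * y + m = N0 \<Longrightarrow> norm_codes k y m \<le> D * (?h N0 * X (real N0) (real m + 1))"
    by blast
  have main: "norm_codes k y m \<le> D * (?h N * X (real N) (real m + 1))" if "N \<ge> N0" "k * y + m = N" for N y m
    using that
  proof (induction N arbitrary: y m rule: dec_induct)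
    case base
    then show ?case using D by blast
  next
    case (step N)
    let ?n = "real (Suc N)"
    have nN: "?n - 1 = real N" by simp
    have hN: "?h N > 0" using hh_pos[of "real N"] step(1) N0 by simp
    have XN: "X (real N) 0 \<ge> 0" "\<And>M. M \<ge> 1 \<Longrightarrow> X (real N) M > 0"
      using X[of "real N"] step(1) N0 by auto
    have w: "w1 ?n (real m + 1) \<ge> 0"
      by (rule w1_bounds(1)) (use step(1,4) N0 in auto)
    \<comment> \<open>For \<open>m = 0\<close> there is no predecessor, and nonnegativity of
      \<open>X\<close> at the wall suffices.\<close>
    have a: "(if m > 0 then norm_codes k y (m - 1) else 0) \<le> D * (?h N * X (real N) (real m))"
    proof (cases "m > 0")
      case True
      then have "norm_codes k y (m - 1) \<le> D * (?h N * X (real N) (real (m - 1) + 1))"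
        using step(3)[of y "m - 1"] step(4) by simp
      then show ?thesis using True by (simp add: of_nat_diff)
    qed (use D hN XN in simp)
    have b: "(if y > 0 then norm_codes k (y - 1) (m + k - 1) else 0) \<le> D * (?h N * X (real N) (real m + real k))"
    proof (cases "y > 0")
      case True
      have "k * (y - 1) + (m + k - 1) = N" using step(4) True k by (cases y) auto
      then have "norm_codes k (y - 1) (m + k - 1) \<le> D * (?h N * X (real N) (real (m + k - 1) + 1))"
        using step(3) by blast
      then show ?thesis using True k by (simp add: of_nat_diff)
    next
      case False
      then show ?thesis using D hN XN(2)[of "real m + real k"] k by simp
    qed
    have "norm_codes k y m = w1 ?n (real m + 1) * (if m > 0 then norm_codes k y (m - 1) else 0)
     + 1 / real k * (if y > 0 then norm_codes k (y - 1) (m + k - 1) else 0)"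
      using norm_codes_rec[OF k, of y m] step(4) by simp
    also have "\<dots> \<le> w1 ?n (real m + 1) * (D * (?h N * X (real N) (real m)))
     + 1 / real k * (D * (?h N * X (real N) (real m + real k)))"
      using a b w by (intro add_mono mult_left_mono) auto
    also have "\<dots> = D * ?h N * local.step X ?n (real m + 1)"
      unfolding step_def avg_def nN by (simp add: algebra_simps)
    also have "\<dots> \<le> D * ?h N * (rho 1 ?n * X ?n (real m + 1))"
      using X[of ?n] step(1,4) N0 D hN by (intro mult_left_mono) auto
    also have "\<dots> = D * (?h (Suc N) * X ?n (real m + 1))"
      using hN by (simp add: rho_def nN del: of_nat_Suc)
    finally show ?case .
  qed
  have "norm_codes k n 0 \<le> (D * C) * (?h (k * n) * bb (real (k * n)))" if n: "n \<ge> N0" for n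
  proof -
    have "1 * n \<le> k * n" using k by (intro mult_le_mono1) simp
    then have kn: "k * n \<ge> N0" using n by linarith
    then have r: "real (k * n) \<ge> real N0" by (simp only: of_nat_le_iff)
    have "real (k * n) \<ge> 1" using r N0 by linarith
    then have h: "?h (k * n) \<ge> 0" using hh_pos less_imp_le by blast
    have "norm_codes k n 0 \<le> D * (?h (k * n) * X (real (k * n)) 1)"
      using main[OF kn, of n 0] by simp
    also have "\<dots> \<le> D * (?h (k * n) * (C * bb (real (k * n))))"
      using X[of "real (k * n)"] r N0 D(1) h
      by (intro mult_left_mono) (auto simp del: of_nat_mult)
    finally show ?thesis by (simp add: mult_ac)
  qed
  then show ?thesis by blast
qed

lemma norm_codes_lower:
  assumes k: "k \<ge> 2"
  shows "\<exists>c>0. \<exists>N0. \<forall>n\<ge>N0. norm_codes k n 0 \<ge> c * (barrier.hh (real k) (- 1) (real (k * n)) * barrier.bb (real k) (real (k * n)))"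
proof -
  interpret barrier "real k" using k by (rule barrier_nat)
  obtain X c n0 where c: "c > 0" and X: "\<And>n. n \<ge> n0 \<Longrightarrow> X n 0 = 0 \<and> X n 1 \<ge> c * bb n \<and>
     (\<forall>M\<ge>1. X n M \<ge> 0 \<and> (M \<ge> n + 1 \<longrightarrow> X n M = 0) \<and> (M \<le> n + 1 \<longrightarrow> rho (- 1) n * X n M \<le> step X n M))"
    using lower_barrier by blast
  obtain N0 :: nat where N0: "real N0 \<ge> max (real k + 2) n0" using real_arch_simple by blast
  let ?h = "\<lambda>N. hh (- 1) (real N)"
  have "\<exists>D>0. \<forall>y m. k * y + m = N0 \<longrightarrow> ?h N0 * X (real N0) (real m + 1) \<le> D * norm_codes k y m"
    using k norm_codes_pos[OF k] by (intro level_ratio_bound) auto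
  then obtain D where D: "D > 0" "\<And>y m. k * y + m = N0 \<Longrightarrow> ?h N0 * X (real N0) (real m + 1) \<le> D * norm_codes k y m"
    by blast
  have main: "?h N * X (real N) (real m + 1) \<le> D * norm_codes k y m" if "N \<ge> N0" "k * y + m = N" for N y m
    using that
  proof (induction N arbitrary: y m rule: dec_induct)
    case base
    then show ?case using D by blast
  next
    case (step N)
    let ?n = "real (Suc N)"
    have nN: "?n - 1 = real N" by simp
    have hN: "?h N > 0" using hh_pos[of "real N"] step(1) N0 by simp
    have XN: "X (real N) 0 = 0" "\<And>M. M \<ge> 1 \<Longrightarrow> M \<ge> real N + 1 \<Longrightarrow> X (real N) M = 0"
      using X[of "real N"] step(1) N0 by auto
    have w: "w1 ?n (real m + 1) \<ge> 0"
      by (rule w1_bounds(1)) (use step(1,4) N0 in auto)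
    have a: "?h N * X (real N) (real m) \<le> D * (if m > 0 then norm_codes k y (m - 1) else 0)"
    proof (cases "m > 0")
      case True
      then have "?h N * X (real N) (real (m - 1) + 1) \<le> D * norm_codes k y (m - 1)"
        using step(3)[of y "m - 1"] step(4) by simp
      then show ?thesis using True by (simp add: of_nat_diff)
    qed (use XN in simp)
    have b: "?h N * X (real N) (real m + real k) \<le> D * (if y > 0 then norm_codes k (y - 1) (m + k - 1) else 0)"
    proof (cases "y > 0")
      case True
      have "k * (y - 1) + (m + k - 1) = N" using step(4) True k by (cases y) auto
      then have "?h N * X (real N) (real (m + k - 1) + 1) \<le> D * norm_codes k (y - 1) (m + k - 1)"
        using step(3) by blast
      then show ?thesis using True k by (simp add: of_nat_diff)
    next
      \<comment> \<open>Here \<open>m = Suc N\<close>, so the missing predecessor lies at a height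
        where the subsolution vanishes.\<close>
      case False
      then have "real m + real k \<ge> real N + 1" using step(4) by simp
      then show ?thesis using False XN(2)[of "real m + real k"] k by simp
    qed
    have "?h (Suc N) * X ?n (real m + 1) = ?h N * (rho (- 1) ?n * X ?n (real m + 1))"
      using hN by (simp add: rho_def nN del: of_nat_Suc)
    also have "\<dots> \<le> ?h N * local.step X ?n (real m + 1)"
      using X[of ?n] step(1,4) N0 hN by (intro mult_left_mono) auto
    also have "\<dots> = w1 ?n (real m + 1) * (?h N * X (real N) (real m))
     + 1 / real k * (?h N * X (real N) (real m + real k))"
      unfolding step_def avg_def nN by (simp add: algebra_simps)
    also have "\<dots> \<le> w1 ?n (real m + 1) * (D * (if m > 0 then norm_codes k y (m - 1) else 0))
     + 1 / real k * (D * (if y > 0 then norm_codes k (y - 1) (m + k - 1) else 0))"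
      using a b w by (intro add_mono mult_left_mono) auto
    also have "\<dots> = D * (w1 ?n (real m + 1) * (if m > 0 then norm_codes k y (m - 1) else 0)
     + 1 / real k * (if y > 0 then norm_codes k (y - 1) (m + k - 1) else 0))"
      by (simp only: distrib_left mult.left_commute)
    also have "\<dots> = D * norm_codes k y m"
      using norm_codes_rec[OF k, of y m] step(4) by simp
    finally show ?case .
  qed
  have "(c / D) * (?h (k * n) * bb (real (k * n))) \<le> norm_codes k n 0" if n: "n \<ge> N0" for n
  proof -
    have "1 * n \<le> k * n" using k by (intro mult_le_mono1) simp
    then have kn: "k * n \<ge> N0" using n by linarith
    then have r: "real (k * n) \<ge> real N0" by (simp only: of_nat_le_iff)
    have "real (k * n) \<ge> 1" using r N0 by linarith
    then have h: "?h (k * n) \<ge> 0" using hh_pos less_imp_le by blast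
    have "?h (k * n) * (c * bb (real (k * n))) \<le> ?h (k * n) * X (real (k * n)) 1"
      using X[of "real (k * n)"] r N0 h
      by (intro mult_left_mono) (auto simp del: of_nat_mult)
    also have "\<dots> \<le> D * norm_codes k n 0" using main[OF kn, of n 0] by simp
    finally show ?thesis using D(1) by (simp add: field_simps)
  qed
  moreover have "c / D > 0" using c D by simp
  ultimately show ?thesis by blast
qed

section \<open>Asymptotics of factorials of multiples and the final assembly\<close>

lemma pochhammer_asymptotics:
  fixes a :: real
  assumes "a > 0"
  shows "(\<lambda>n. pochhammer a n) \<in> \<Theta>(\<lambda>n. fact n * real n powr (a - 1))"
proof (rule bigthetaI_tendsto[where c = "1 / Gamma a"])
  have G: "Gamma a > 0" using assms by (rule Gamma_real_pos)
  then show "1 / Gamma a \<noteq> 0" by simp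
  have "(\<lambda>n. (real n / (a + real n)) / Gamma_series a n) \<longlonglongrightarrow> 1 / Gamma a"
  proof (intro tendsto_divide Gamma_series_LIMSEQ)
    show "(\<lambda>n. real n / (a + real n)) \<longlonglongrightarrow> 1" by real_asymp
  qed (use G in simp)
  moreover have "\<forall>\<^sub>F n in sequentially.
      (real n / (a + real n)) / Gamma_series a n = pochhammer a n / (fact n * real n powr (a - 1))"
    using eventually_gt_at_top[of 0]
  proof eventually_elim
    case (elim n)
    have p: "pochhammer a n > 0" using assms by (rule pochhammer_pos)
    have e: "exp (a * ln (real n)) = real n * real n powr (a - 1)"
      using elim by (simp add: powr_def exp_diff algebra_simps)
    have "Gamma_series a n = fact n * (real n * real n powr (a - 1)) / (pochhammer a n * (a + real n))"
      by (simp add: Gamma_series_def pochhammer_Suc e)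
    moreover have "(x / y) / (c * (x * w) / (p * y)) = p / (c * w)"
      if "x > 0" "y > 0" "c > 0" "w > 0" "p > 0" for x y c w p :: real
      using that by (simp add: divide_simps)
    ultimately show ?case using p elim assms by simp
  qed
  ultimately show "(\<lambda>n. pochhammer a n / (fact n * real n powr (a - 1))) \<longlonglongrightarrow> 1 / Gamma a"
    by (rule Lim_transform_eventually)
qed

text \<open>The integer case of Gauss's multiplication formula: the factors of the factorial are
  grouped by their residue modulo \<open>j\<close>.\<close>

lemma fact_mult_pochhammer:
  assumes "j > 0"
  shows "fact (j * n) = real j ^ (j * n) * (\<Prod>i<j. pochhammer (real (Suc i) / real j) n)"
proof (induction n)
  case (Suc n)
  have fact_add: "fact (a + l) = fact a * (\<Prod>i<l. real (a + Suc i))" for a l :: nat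
    by (induction l) (simp_all add: algebra_simps)
  have "fact (j * Suc n) = fact (j * n) * (\<Prod>i<j. real (j * n + Suc i))"
    using fact_add[of "j * n" j] by (simp add: add.commute)
  also have "(\<Prod>i<j. real (j * n + Suc i)) = (\<Prod>i<j. real j * (real (Suc i) / real j + real n))"
    using assms by (intro prod.cong) (auto simp: field_simps)
  also have "\<dots> = real j ^ j * (\<Prod>i<j. real (Suc i) / real j + real n)"
    by (simp only: prod.distrib prod_constant card_lessThan)
  finally show ?case
    unfolding Suc.IH pochhammer_Suc prod.distrib by (simp add: power_add mult_ac)
qed simp

lemma bigtheta_prod:
  fixes f g :: "'i \<Rightarrow> 'a \<Rightarrow> real"
  assumes "finite A" "\<And>i. i \<in> A \<Longrightarrow> f i \<in> \<Theta>[F](g i)"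
  shows "(\<lambda>x. \<Prod>i\<in>A. f i x) \<in> \<Theta>[F](\<lambda>x. \<Prod>i\<in>A. g i x)"
  using assms by (induction A rule: finite_induct) (auto intro: landau_theta.mult)

text \<open>Each residue class contributes n! times a power of \<open>n\<close>; the exponents
  \<open>(i + 1) / j - 1\<close> add up to \<open>(1 - j) / 2\<close>.\<close>

lemma fact_mult_asymptotics:
  assumes "j > 0"
  shows "(\<lambda>n. fact (j * n) / real j ^ (j * n)) \<in> \<Theta>(\<lambda>n. fact n ^ j * real n powr ((1 - real j) / 2))"
proof -
  have "(\<lambda>n. \<Prod>i<j. pochhammer (real (Suc i) / real j) n) \<in>
      \<Theta>(\<lambda>n. \<Prod>i<j. fact n * real n powr (real (Suc i) / real j - 1))"
    using assms by (intro bigtheta_prod pochhammer_asymptotics) auto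
  also have "(\<lambda>n. \<Prod>i<j. fact n * real n powr (real (Suc i) / real j - 1)) \<in>
      \<Theta>(\<lambda>n. fact n ^ j * real n powr ((1 - real j) / 2))"
  proof (rule bigthetaI_cong)
    have "2 * (\<Sum>i<l. real (Suc i)) = real l * (real l + 1)" for l
      by (induction l) (simp_all add: algebra_simps)
    then have "(\<Sum>i<j. real (Suc i)) = real j * (real j + 1) / 2" by (simp add: field_simps)
    then have s: "(\<Sum>i<j. real (Suc i) / real j - 1) = (1 - real j) / 2"
      using assms unfolding sum_subtractf sum_divide_distrib[symmetric] by (simp add: field_simps)
    show "\<forall>\<^sub>F n in sequentially. (\<Prod>i<j. fact n * real n powr (real (Suc i) / real j - 1)) =
        fact n ^ j * real n powr ((1 - real j) / 2)"
      using eventually_gt_at_top[of 0]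
    proof eventually_elim
      case (elim n)
      then have "real n \<noteq> 0" by simp
      from powr_sum[OF this, of "\<lambda>i. real (Suc i) / real j - 1" "{..<j}"]
      show ?case by (simp only: prod.distrib prod_constant card_lessThan s)
    qed
  qed
  also have "(\<lambda>n. \<Prod>i<j. pochhammer (real (Suc i) / real j) n) = (\<lambda>n. fact (j * n) / real j ^ (j * n))"
    using assms by (auto simp: fact_mult_pochhammer)
  finally show ?thesis .
qed

text \<open>The two barriers differ by a bounded factor. At time \<open>k * n\<close> the product
  \<open>kap * k\<close> is the k (k - 1)/2 of the theorem, and \<open>bb\<close> lowers the
  exponent \<open>mu\<close> by 1/3.\<close>

lemma norm_codes_asymptotics:
  assumes k: "k \<ge> 2"
  shows "(\<lambda>n. norm_codes k n 0) \<in> \<Theta>(\<lambda>n.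
    exp (3 * (real k * (real k - 1) / 2) powr (1 / 3) * airy_a1 * real n powr (1 / 3))
    * real n powr ((7 * real k - 8) / 6))"
proof -
  interpret barrier "real k" using k by (rule barrier_nat)
  define G where "G = (\<lambda>n. exp (3 * (real k * (real k - 1) / 2) powr (1 / 3) * airy_a1 * real n powr (1 / 3))
    * real n powr ((7 * real k - 8) / 6))"
  define B where "B = real k powr ((7 * real k - 8) / 6) * bet"
  have B: "B > 0" using bet_pos k by (simp add: B_def)
  have hb: "hh \<sigma> (real (k * n)) * bb (real (k * n)) = B * exp (- 24 * \<sigma> * real (k * n) powr (- 1 / 12)) * G n"
    if n: "n \<ge> 1" for \<sigma> n
  proof -
    have "1 * 1 \<le> k * n" using n k by (intro mult_le_mono) auto
    then have kn: "real (k * n) \<ge> 1" by linarith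
    have "lam * real (k * n) powr (1 / 3) = (real k * (real k - 1) / 2) powr (1 / 3) * airy_a1 * real n powr (1 / 3)"
    proof -
      have "kap powr (1 / 3) * real (k * n) powr (1 / 3) = (kap * real k) powr (1 / 3) * real n powr (1 / 3)"
        using kap_pos k by (simp add: powr_mult)
      also have "kap * real k = real k * (real k - 1) / 2" by (simp add: kap_def)
      finally show ?thesis by (simp add: lam_def mult_ac)
    qed
    moreover have "real (k * n) powr mu * bb (real (k * n)) = B * real n powr ((7 * real k - 8) / 6)"
    proof -
      have "bb (real (k * n)) = bet * real (k * n) powr (- 1 / 3)"
        using tt_power[OF kn, of 4] by (simp add: bb_def)
      then have "real (k * n) powr mu * bb (real (k * n)) = bet * real (k * n) powr (mu + - 1 / 3)"
        unfolding powr_add by simp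
      also have "mu + - 1 / 3 = (7 * real k - 8) / 6" by (simp add: mu_def field_simps)
      finally show ?thesis by (simp add: B_def powr_mult)
    qed
    ultimately show ?thesis unfolding hh_def G_def by (simp add: mult_ac)
  qed
  have e24: "exp (- 24) \<le> exp (- 24 * \<sigma> * real N powr (- 1 / 12)) \<and> exp (- 24 * \<sigma> * real N powr (- 1 / 12)) \<le> exp 24"
    if "N \<ge> 1" "\<bar>\<sigma>\<bar> = 1" for \<sigma> :: real and N :: nat
  proof -
    have "real N powr (- 1 / 12) \<le> 1" using tt_le_1[of "real N"] that by (simp add: tt_def)
    then have "\<bar>\<sigma> * real N powr (- 1 / 12)\<bar> \<le> 1" using that by (simp add: abs_mult)
    then show ?thesis by (simp add: abs_le_iff)
  qed
  obtain C N1 where C: "\<And>n. n \<ge> N1 \<Longrightarrow> norm_codes k n 0 \<le> C * (hh 1 (real (k * n)) * bb (real (k * n)))"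
    using norm_codes_upper[OF k] by blast
  obtain c N2 where c: "c > 0" "\<And>n. n \<ge> N2 \<Longrightarrow> norm_codes k n 0 \<ge> c * (hh (- 1) (real (k * n)) * bb (real (k * n)))"
    using norm_codes_lower[OF k] by blast
  have kn1: "k * n \<ge> 1" if "n \<ge> 1" for n using that k by simp
  have Gpos: "G n > 0" if "n \<ge> 1" for n using that by (simp add: G_def)
  have "(\<lambda>n. norm_codes k n 0) \<in> O(G)"
  proof (rule bigoI[where c = "\<bar>C\<bar> * (B * exp 24)"])
    show "\<forall>\<^sub>F n in sequentially. norm (norm_codes k n 0) \<le> \<bar>C\<bar> * (B * exp 24) * norm (G n)"
      using eventually_ge_at_top[of "max 1 N1"]
    proof eventually_elim
      case (elim n)
      then have n: "n \<ge> 1" "n \<ge> N1" by auto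
      have "norm_codes k n 0 \<le> C * (hh 1 (real (k * n)) * bb (real (k * n)))" using C[OF n(2)] .
      also have "\<dots> \<le> \<bar>C\<bar> * (hh 1 (real (k * n)) * bb (real (k * n)))"
        unfolding hb[OF n(1)] using B Gpos[OF n(1)] by (intro mult_right_mono) auto
      also have "\<dots> \<le> \<bar>C\<bar> * (B * exp 24 * G n)"
        unfolding hb[OF n(1)] using B Gpos[OF n(1)] e24[OF kn1[OF n(1)], of 1]
        by (intro mult_left_mono mult_right_mono) auto
      finally show ?case using norm_codes_pos[OF k, of n 0] Gpos[OF n(1)] by (simp add: mult.assoc)
    qed
  qed
  moreover have "(\<lambda>n. norm_codes k n 0) \<in> \<Omega>(G)"
  proof (rule landau_omega.bigI[where c = "c * (B * exp (- 24))"])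
    show "c * (B * exp (- 24)) > 0" using c B by simp
    show "\<forall>\<^sub>F n in sequentially. c * (B * exp (- 24)) * norm (G n) \<le> norm (norm_codes k n 0)"
      using eventually_ge_at_top[of "max 1 N2"]
    proof eventually_elim
      case (elim n)
      then have n: "n \<ge> 1" "n \<ge> N2" by auto
      have "c * (B * exp (- 24) * G n) \<le> c * (hh (- 1) (real (k * n)) * bb (real (k * n)))"
        unfolding hb[OF n(1)] using B c Gpos[OF n(1)] e24[OF kn1[OF n(1)], of "- 1"]
        by (intro mult_left_mono mult_right_mono) auto
      also have "\<dots> \<le> norm_codes k n 0" using c(2)[OF n(2)] .
      finally show ?case using norm_codes_pos[OF k, of n 0] Gpos[OF n(1)] by (simp add: mult.assoc)
    qed
  qed
  ultimately show ?thesis unfolding G_def[symmetric] by (rule bigthetaI)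
qed

theorem theorem1:
  fixes k :: nat
  assumes "k \<ge> 2"
  shows "(\<lambda>n. real (num_relaxed_trees k n)) \<in> \<Theta>(\<lambda>n.
           fact n ^ (k - 1)
           * (real k ^ k / (real k - 1) ^ (k - 1)) ^ n
           * exp (3 * (real k * (real k - 1) / 2) powr (1 / 3) * airy_a1 * real n powr (1 / 3))
           * real n powr ((2 * real k - 1) / 3))"
proof -
  let ?e = "\<lambda>n. exp (3 * (real k * (real k - 1) / 2) powr (1 / 3) * airy_a1 * real n powr (1 / 3))"
  let ?r = "real k ^ k / (real k - 1) ^ (k - 1)"
  let ?f = "\<lambda>n. fact ((k - 1) * n) / real (k - 1) ^ ((k - 1) * n)"
  have k1: "real (k - 1) = real k - 1" "real k - 1 > 0" using assms by (auto simp: of_nat_diff)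
  \<comment> \<open>An exact identity: undoing the normalisation collects all its powers into
    \<open>?r ^ n\<close> and a power of \<open>k - 1\<close> under the factorial.\<close>
  have eq: "real (num_relaxed_trees k n) = ?f n * ?r ^ n * norm_codes k n 0" for n
  proof -
    have num: "num_relaxed_trees k n = num_codes k n 0"
      using num_relaxed_trees_eq_num_codes[of k n] assms by simp
    have "(real k - 1) ^ ((k - 2) * n) * ((real k - 1) / real k) ^ (k * n) * ?r ^ n = (real k - 1) ^ ((k - 1) * n)"
    proof -
      have "k = Suc (k - 1)" "k - 1 = Suc (k - 2)" using assms by auto
      then have p: "(real k - 1) ^ k = (real k - 1) ^ (k - 1) * (real k - 1)"
        "(real k - 1) ^ (k - 1) = (real k - 1) ^ (k - 2) * (real k - 1)"
        by (metis power_Suc2)+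
      have "(real k - 1) ^ (k - 2) * (((real k - 1) / real k) ^ k * ?r) = (real k - 1) ^ (k - 2) * (real k - 1)"
        unfolding power_divide p(1) using k1(2) assms by simp
      then have "(real k - 1) ^ (k - 2) * (((real k - 1) / real k) ^ k * ?r) = (real k - 1) ^ (k - 1)"
        unfolding p(2) .
      then have "((real k - 1) ^ (k - 2) * (((real k - 1) / real k) ^ k * ?r)) ^ n = ((real k - 1) ^ (k - 1)) ^ n"
        by simp
      then show ?thesis by (simp only: power_mult power_mult_distrib mult.assoc)
    qed
    then have "?f n * ?r ^ n * norm_codes k n 0 = real (num_codes k n 0) * ((real k - 1) ^ ((k - 1) * n) / (real k - 1) ^ ((k - 1) * n))"
      unfolding norm_codes_def k1(1) by (simp add: mult_ac) 
    then show ?thesis using num k1(2) by simp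
  qed
  have "(\<lambda>n. ?f n * ?r ^ n * norm_codes k n 0) \<in> \<Theta>(\<lambda>n. (fact n ^ (k - 1) * real n powr ((1 - real (k - 1)) / 2))
      * ?r ^ n * (?e n * real n powr ((7 * real k - 8) / 6)))"
    using assms by (intro landau_theta.mult fact_mult_asymptotics norm_codes_asymptotics) auto
  also have "(\<lambda>n. (fact n ^ (k - 1) * real n powr ((1 - real (k - 1)) / 2))
      * ?r ^ n * (?e n * real n powr ((7 * real k - 8) / 6))) =
      (\<lambda>n. fact n ^ (k - 1) * ?r ^ n * ?e n * real n powr ((2 * real k - 1) / 3))"
  proof
    fix n
    \<comment> \<open>The factorial is taken with \<open>j = k - 1\<close>, hence the exponent (2 -
      k)/2 next to (7k - 8)/6.\<close>
    have "(1 - real (k - 1)) / 2 + (7 * real k - 8) / 6 = (2 * real k - 1) / 3"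
      unfolding k1(1) by (simp add: field_simps)
    then have "real n powr ((1 - real (k - 1)) / 2) * real n powr ((7 * real k - 8) / 6) = real n powr ((2 * real k - 1) / 3)"
      by (simp only: powr_add[symmetric])
    moreover have "A * p * R * (E * q) = A * R * E * s" if "p * q = s" for A p R E q s :: real
      using that by auto
    ultimately show "(fact n ^ (k - 1) * real n powr ((1 - real (k - 1)) / 2))
      * ?r ^ n * (?e n * real n powr ((7 * real k - 8) / 6)) =
      fact n ^ (k - 1) * ?r ^ n * ?e n * real n powr ((2 * real k - 1) / 3)"
      by blast
  qed
  finally show ?thesis unfolding eq .
qed

end
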